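(* Let $n\ge 21$ and let $U$ be a unicyclic graph of order $n$ with girth $5$. Then $\lambda_2(U)\ge 1-\frac{\sqrt6}{3}$ if and only if one of the following holds: (i) $U\cong S_5(2,k,2,1,1)$ for some integer $k$ with $15\le k\le 18$. (ii) $U\cong C_5(K_{1,1},T(12,1,0),K_{1,1},K_1,K_1)$ or $U\cong C_5(K_{1,1},T(13,1,0),K_{1,1},K_1,K_1)$. (iii) $U\cong C_5(K_{1,1},T(l_0,l_1,0),K_1,K_1,K_1)$, where $l_0,l_1$ are nonnegative integers with $15\le l_0+2l_1\le 29$, $0\le l_1\le 7$, and one of the following holds: (1) $l_1=7$ and $l_0=1$; (2) $l_1=6$ and $3\le l_0\le 5$; (3) $l_1=5$ and $5\le l_0\le 9$; (4) $l_1=4$ and $7\le l_0\le 13$; (5) $l_1=3$ and $9\le l_0\le 17$; (6) $l_1=2$ and $11\le l_0\le 21$; (7) $l_1=1$ and $13\le l_0\le 25$; (8) $l_1=0$ and $15\le l_0\le 29$. (iv) $U\cong C_5(T(l_0,l_1,l_2),K_1,K_1,K_1,K_1)$, where $l_0,l_1,l_2$ are nonnegative integers with $l_0+2l_1+3l_2+5=n\ge 21$. Furthermore, $\lambda_2(U)=1-\frac{\sqrt6}{3}$ if and only if $U\cong C_5(T(l_0,l_1,l_2),K_1,K_1,K_1,K_1)$ for some nonnegative integers $l_0,l_1,l_2$ with $l_0+2l_1+3l_2+5=n$ and $l_2\ge 2$.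
   Context: All graphs are finite, simple, undirected and connected. A unicyclic graph is a connected graph with exactly one cycle; its girth is the length of that cycle. For a graph $G$ with adjacency matrix $A(G)$ and diagonal degree matrix $D(G)$, put $L(G)=D(G)-A(G)$; the normalized Laplacian is $\mathcal L(G)=D(G)^{-1/2}L(G)D(G)^{-1/2}$. Its eigenvalues, counted with multiplicity, are ordered $0=\lambda_1(G)\le\lambda_2(G)\le\cdots\le\lambda_n(G)$. Given rooted trees $T_1,\dots,T_g$, the graph $C_g(T_1,\dots,T_g)$ is obtained from the cycle $C_g=v_1v_2\cdots v_gv_1$ by identifying $v_i$ with the root of $T_i$ for each $i=1,\dots,g$. Here $K_1$ is the one-vertex rooted tree and $K_{1,m}$ ($m\ge1$) is the star with $m$ leaves rooted at its center (for $m=1$, an edge rooted at one of its ends), so that attaching $K_{1,m}$ at $v_i$ means attaching $m$ pendent vertices to $v_i$. For positive integers $n_1,\dots,n_g$, $S_g(n_1,\dots,n_g)$ denotes $C_g(T_1,\dots,T_g)$ with each $T_i$ the star of order $n_i$ rooted at its center ($T_i=K_{1,n_i-1}$, or $K_1$ if $n_i=1$). For nonnegative integers $l_0,l_1,l_2$, $T(l_0,l_1,l_2)$ denotes the rooted tree whose root has exactly $l_0+l_1+l_2$ children, of which exactly $l_i$ have exactly $i$ children ($i=0,1,2$), and all grandchildren of the root are leaves; it has $1+l_0+2l_1+3l_2$ vertices. *)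

theory Defs
  imports
    "HOL-Analysis.Analysis"
    "HOL-Computational_Algebra.Polynomial"
    "Graph_Theory.Graph_Theory"
begin

text \<open>
  A simple graph is a \<^locale>\<open>pair_graph\<close>: a finite vertex set together with a finite,
  symmetric, loop-free set of ordered pairs. \<open>Digraph_Component.connected\<close> and
  \<^const>\<open>digraph_iso\<close> are connectedness and isomorphism of graphs.
\<close>

section \<open>Unicyclic graphs\<close>

text \<open>
  A cycle is identified with its set of undirected edges, so that different starting points and
  the two orientations of one closed walk give the same cycle. The bound on the length is needed
  because \<^const>\<open>pre_digraph.cycle\<close> also admits the back-and-forth closed walk along one edge.
\<close>

definition cycles :: "'a pair_pre_digraph \<Rightarrow> 'a set set set" where
  "cycles G = {(\<lambda>(u, v). {u, v}) ` set p | p.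
      pre_digraph.cycle (with_proj G) p \<and> 3 \<le> length p}"

definition unicyclic :: "'a pair_pre_digraph \<Rightarrow> bool" where
  "unicyclic G \<longleftrightarrow>
     pair_graph G \<and> Digraph_Component.connected (with_proj G) \<and> (\<exists>!C. C \<in> cycles G)"

definition unicyclic_girth :: "'a pair_pre_digraph \<Rightarrow> nat" where
  "unicyclic_girth G = card (THE C. C \<in> cycles G)"

section \<open>Normalized Laplacian\<close>

text \<open>
  The matrices are indexed by the vertex type, so they are the matrices of \<open>G\<close> only if
  \<open>pverts G = UNIV\<close>.
\<close>

definition adj_matrix :: "'v::finite pair_pre_digraph \<Rightarrow> real^'v^'v" where
  "adj_matrix G = (\<chi> u v. if (u, v) \<in> parcs G then 1 else 0)"

definition deg_matrix :: "'v::finite pair_pre_digraph \<Rightarrow> real^'v^'v" where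
  "deg_matrix G = (\<chi> u v. if u = v then real (out_degree (with_proj G) u) else 0)"

definition laplacian :: "'v::finite pair_pre_digraph \<Rightarrow> real^'v^'v" where
  "laplacian G = deg_matrix G - adj_matrix G"

definition deg_matrix_inv_sqrt :: "'v::finite pair_pre_digraph \<Rightarrow> real^'v^'v" where
  "deg_matrix_inv_sqrt G =
     (\<chi> u v. if u = v then 1 / sqrt (real (out_degree (with_proj G) u)) else 0)"

definition normalized_laplacian :: "'v::finite pair_pre_digraph \<Rightarrow> real^'v^'v" where
  "normalized_laplacian G = deg_matrix_inv_sqrt G ** laplacian G ** deg_matrix_inv_sqrt G"

definition charpoly :: "real^'v^'v \<Rightarrow> real poly" where
  "charpoly M = det (\<chi> i j. (if i = j then [:0, 1:] else 0) - [:M $ i $ j:])"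

text \<open>
  The \<open>k\<close>-th smallest eigenvalue, counted with multiplicity and starting from \<open>k = 1\<close>.
  The normalized Laplacian is symmetric, so its characteristic polynomial splits over the reals
  and the list below has one entry for each vertex.
\<close>

definition nl_eigenvalue :: "nat \<Rightarrow> 'v::finite pair_pre_digraph \<Rightarrow> real" where
  "nl_eigenvalue k G =
     sorted_list_of_multiset (proots (charpoly (normalized_laplacian G))) ! (k - 1)"

section \<open>Rooted trees attached to a cycle\<close>

text \<open>A rooted tree is given by the list of subtrees hanging from its root.\<close>

datatype rtree = Node "rtree list"

text \<open>
  A vertex of a rooted tree is addressed by the sequence of child indices on the path leading to
  it from the root; the root has address \<open>[]\<close>, and the children of \<open>p\<close> are the \<open>p @ [j]\<close>.
\<close>

primrec addrs :: "rtree \<Rightarrow> nat list set" where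
  "addrs (Node ts) = insert [] {i # p | i p. i < length ts \<and> p \<in> map addrs ts ! i}"

text \<open>
  \<open>C_graph [T1, \<dots>, Tg]\<close> is the graph $C_g(T_1,\dots,T_g)$, for $g \ge 3$: the pair \<open>(i, p)\<close> is the
  vertex \<open>p\<close> of the \<open>i\<close>-th tree (counted from 0), and \<open>(i, [])\<close> is both the root of that tree and a
  vertex of the cycle.
\<close>

definition C_graph :: "rtree list \<Rightarrow> (nat \<times> nat list) pair_pre_digraph" where
  "C_graph Ts =
     (let g = length Ts;
          R = {((i, []), ((i + 1) mod g, [])) | i. i < g} \<union>
              {((i, p), (i, p @ [j])) | i p j. i < g \<and> p @ [j] \<in> addrs (Ts ! i)}
      in \<lparr> pverts = {(i, p). i < g \<and> p \<in> addrs (Ts ! i)}, parcs = R \<union> R\<inverse> \<rparr>)"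

definition K1 :: rtree where
  "K1 = Node []"

text \<open>$K_{1,m}$, rooted at its center.\<close>

definition star :: "nat \<Rightarrow> rtree" where
  "star m = Node (replicate m K1)"

definition T_tree :: "nat \<Rightarrow> nat \<Rightarrow> nat \<Rightarrow> rtree" where
  "T_tree l0 l1 l2 =
     Node (replicate l0 K1 @ replicate l1 (Node [K1]) @ replicate l2 (Node [K1, K1]))"

text \<open>
  \<open>S_graph [n1, \<dots>, ng]\<close> is $S_g(n_1,\dots,n_g)$; the arguments are the (positive) orders of the
  stars, and \<open>star 0 = K1\<close>.
\<close>

definition S_graph :: "nat list \<Rightarrow> (nat \<times> nat list) pair_pre_digraph" where
  "S_graph ns = C_graph (map (\<lambda>m. star (m - 1)) ns)"

abbreviation graph_iso :: "'a pair_pre_digraph \<Rightarrow> 'b pair_pre_digraph \<Rightarrow> bool"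
    (infix "\<simeq>\<^sub>g" 50) where
  "G \<simeq>\<^sub>g H \<equiv> digraph_iso (with_proj G) (with_proj H)"

end

theory Submission
  imports Defs
begin

text \<open>
  Put $c = 1 - \sqrt 6/3$. Substituting $x = D^{1/2} h$ turns the form
  $x \cdot \mathcal L x - c\, x \cdot x$ into $E(h)/\sqrt 6$, where the energy
  $E(h) = \sum_{(u,v)} (h_u^2 + h_v^2 - \sqrt 6\, h_u h_v)$ runs over all arcs. By the variational
  principle for a symmetric matrix, a plane on which $E$ is negative definite forces
  $\lambda_2 < c$, and a hyperplane on which $E$ is nonnegative (positive) forces
  $\lambda_2 \ge c$ ($\lambda_2 > c$). So everything is about the signature of $E$, which is an
  isomorphism invariant and can be computed on $C_5(T_1,\dots,T_5)$
  (\<open>unicyclic_iso_C_graph\<close>, \<open>energy_C5\<close>).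

  The point of the number $c$ is the energy of a small branch hanging from a vertex with value $x$.
  Minimised over the branch, with every edge counted once, it is $-x^2/2$ for a pendant vertex and $-2x^2$ for a path with two
  vertices. For a star with two leaves attached at its center, the energy is linear in the value
  $a$ at the center once the leaves are optimal: it is $x^2 - \sqrt 6\,x a$. This branch has a null vector
  if $x = 0$ and energy unbounded below if $x \ne 0$. Eliminating the branches leaves
  a quadratic form in the values on the cycle,
  $\sum_i (4 - w_i) x_i^2 - 2\sqrt 6 \sum_i x_i x_{i+1}$, in which a tree $T(l_0,l_1,0)$ has the
  weight $w_i = l_0 + 4 l_1$ and a star with two leaves counts as an arbitrarily large weight.

  If $\lambda_2 \ge c$, there is no negative plane. A bridge that cuts off four or
  more vertices of a tree gives such a plane, spanned by the indicators of the two sides, because $n \ge 21$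
  (\<open>negative_plane_large_branch\<close>). A path with three vertices has a negative direction of its
  own, and the rest of the graph supplies a second one (\<open>negative_plane_P3\<close>). Only the three kinds
  of branches above remain, hence the trees $T(l_0,l_1,l_2)$, with total weight at least $16$.
  Twelve explicit weight vectors have a form that is negative definite on a plane; every vector of total weight at
  least $16$ whose first entry is the largest lies above one of them or the reflection of one,
  unless it is $(w,0,0,0,0)$, $(w,1,0,0,0)$ or its reflection with $w \le 29$, or
  $(w,1,0,0,1)$ with $w \le 17$ (\<open>not_core_negative_weights\<close>). Together with $n \ge 21$, these
  inequalities are the numerical conditions of the four families.

  Conversely, completing squares for the two extreme vectors shows that the form is positive
  on a hyperplane (\<open>core_1_29_pos\<close>, \<open>core_1_17_1_pos\<close>). In the last family the vectors
  vanishing at the root of the tree have nonnegative energy. Equality occurs exactly if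
  there are two stars with two leaves: their null vectors then span a plane of energy $0$
  (\<open>null_plane_T_tree\<close>), whereas with at most one such star a suitable hyperplane is positive
  (\<open>positive_hyperplane_T_tree_0\<close>, \<open>positive_hyperplane_T_tree_1\<close>).
\<close>

section \<open>Spectral theorem for real symmetric matrices\<close>

definition symmetric_matrix :: "real^'n^'n \<Rightarrow> bool" where
  "symmetric_matrix A \<longleftrightarrow> transpose A = A"

lemma symmetric_matrix_inner:
  fixes A :: "real^'n^'n"
  assumes "symmetric_matrix A"
  shows "(A *v x) \<bullet> y = x \<bullet> (A *v y)"
  using assms unfolding symmetric_matrix_def by (metis dot_lmul_matrix vector_transpose_matrix)

text \<open>The first-order condition at a maximum: for small $t$ the linear term dominates.\<close>

lemma quadratic_nonpos_imp_linear_zero: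
  fixes b c :: real
  assumes "\<And>t. 2 * t * b + t\<^sup>2 * c \<le> 0"
  shows "b = 0"
proof (rule ccontr)
  assume b: "b \<noteq> 0"
  \<comment> \<open>At $t = b/k$ the quadratic term is too small to cancel the linear one.\<close>
  define k where "k = \<bar>c\<bar> + 1"
  have k: "k > 0" "c > - k * 1" by (auto simp: k_def)
  have "2 * (b / k) * b + (b / k)\<^sup>2 * c = (b\<^sup>2 / k) * (2 + c / k)"
    using k by (simp add: power2_eq_square field_simps)
  moreover have "c / k > -1" using k by (simp add: field_simps)
  moreover have "b\<^sup>2 / k > 0" using b k by simp
  ultimately show False using assms[of "b / k"]
    by (smt (verit) mult_pos_pos)
qed

text \<open>The Rayleigh quotient attains its maximum on the unit sphere of the subspace, and a maximiser is
  an eigenvector: the derivative along any direction in the subspace vanishes, and the residual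
  $Ax - \mu x$ itself lies in the subspace.\<close>

lemma symmetric_matrix_eigenvector_in_invariant_subspace:
  fixes A :: "real^'n^'n"
  assumes sym: "symmetric_matrix A" and V: "subspace V"
    and inv: "\<And>x. x \<in> V \<Longrightarrow> A *v x \<in> V" and nontriv: "\<exists>x\<in>V. x \<noteq> 0"
  obtains x \<mu> where "x \<in> V" "norm x = 1" "A *v x = \<mu> *\<^sub>R x"
proof -
  let ?q = "\<lambda>x. x \<bullet> (A *v x)"
  let ?S = "V \<inter> sphere 0 1"
  have comp: "compact ?S"
    using closed_subspace[OF V] compact_sphere by (metis closed_Int_compact)
  obtain z where z: "z \<in> V" "z \<noteq> 0" using nontriv by blast
  have "(1 / norm z) *\<^sub>R z \<in> ?S" using z V by (simp add: subspace_scale)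
  then have ne: "?S \<noteq> {}" by blast
  have lin: "linear ((*v) A)" by (rule matrix_vector_mul_linear)
  have "continuous_on ?S ?q"
    by (intro continuous_intros linear_continuous_on_compose[OF _ lin])
  from continuous_attains_sup[OF comp ne this]
  obtain x where x: "x \<in> ?S" and max: "\<And>y. y \<in> ?S \<Longrightarrow> ?q y \<le> ?q x" by blast
  define \<mu> where "\<mu> = ?q x"
  have xV: "x \<in> V" and nx: "norm x = 1" using x by auto
  have bound: "?q y \<le> \<mu> * (y \<bullet> y)" if y: "y \<in> V" for y
  proof (cases "y = 0")
    case False
    have "(1 / norm y) *\<^sub>R y \<in> ?S" using y V False by (simp add: subspace_scale)
    from max[OF this] have "?q y / (norm y)\<^sup>2 \<le> \<mu>"
      by (simp add: \<mu>_def matrix_vector_mult_scaleR power2_eq_square)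
    then show ?thesis using False by (simp add: dot_square_norm field_simps)
  qed simp
  have orth: "z \<bullet> (A *v x - \<mu> *\<^sub>R x) = 0" if z: "z \<in> V" for z
  proof (rule quadratic_nonpos_imp_linear_zero)
    fix t :: real
    have "x + t *\<^sub>R z \<in> V" using xV z V by (simp add: subspace_add subspace_scale)
    from bound[OF this]
    have "?q x + 2 * t * (z \<bullet> (A *v x)) + t\<^sup>2 * ?q z \<le> \<mu> * (x \<bullet> x + 2 * t * (z \<bullet> x) + t\<^sup>2 * (z \<bullet> z))"
      using symmetric_matrix_inner[OF sym, of z x]
      by (simp add: matrix_vector_right_distrib matrix_vector_mult_scaleR algebra_simps
          inner_commute power2_eq_square)
    moreover have "x \<bullet> x = 1" using nx by (simp add: dot_square_norm)
    ultimately show "2 * t * (z \<bullet> (A *v x - \<mu> *\<^sub>R x)) + t\<^sup>2 * (?q z - \<mu> * (z \<bullet> z)) \<le> 0"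
      by (simp add: \<mu>_def algebra_simps)
  qed
  have "A *v x - \<mu> *\<^sub>R x \<in> V" using inv[OF xV] xV V by (simp add: subspace_diff subspace_scale)
  from orth[OF this] have "A *v x = \<mu> *\<^sub>R x" by simp
  with xV nx that show thesis by blast
qed

text \<open>Eigenvectors are collected one at a time, since the orthogonal complement of the ones already
  found is invariant.\<close>

lemma symmetric_matrix_orthonormal_eigenvectors:
  fixes A :: "real^'n^'n"
  assumes sym: "symmetric_matrix A" and "k \<le> CARD('n)"
  shows "\<exists>S. card S = k \<and> finite S \<and> pairwise orthogonal S \<and>
             (\<forall>x\<in>S. norm x = 1 \<and> (\<exists>\<mu>. A *v x = \<mu> *\<^sub>R x))"
  using assms(2)
proof (induction k)
  case 0
  then show ?case by (intro exI[of _ "{}"]) auto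
next
  case (Suc k)
  then obtain S where S: "card S = k" "finite S" "pairwise orthogonal S"
    and eig: "\<And>x. x \<in> S \<Longrightarrow> norm x = 1 \<and> (\<exists>\<mu>. A *v x = \<mu> *\<^sub>R x)" by auto
  define V where "V = {y. \<forall>x\<in>S. orthogonal x y}"
  have sub: "subspace V"
    unfolding V_def by (auto simp: subspace_def orthogonal_def inner_right_distrib)
  have inv: "A *v y \<in> V" if "y \<in> V" for y
    unfolding V_def
  proof (rule, rule)
    fix x assume x: "x \<in> S"
    then obtain \<mu> where "A *v x = \<mu> *\<^sub>R x" using eig by blast
    then have "x \<bullet> (A *v y) = \<mu> * (x \<bullet> y)"
      using symmetric_matrix_inner[OF sym, of x y] by simp
    then show "orthogonal x (A *v y)" using that x by (simp add: V_def orthogonal_def)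
  qed
  have "dim (span S) \<le> k" using dim_le_card[of S S] S by (simp add: span_superset)
  then have "span S \<noteq> UNIV"
    using Suc.prems by (metis DIM_cart DIM_real dim_UNIV mult.right_neutral not_less_eq_eq)
  then obtain y where y: "y \<noteq> 0" "\<And>x. x \<in> span S \<Longrightarrow> orthogonal y x"
    using orthogonal_to_subspace_exists_gen[of "span S" UNIV]
    by (metis dim_span psubsetI span_UNIV span_span subset_UNIV)
  then have "y \<in> V" by (auto simp: V_def orthogonal_commute span_base)
  with y have "\<exists>x\<in>V. x \<noteq> 0" by blast
  from symmetric_matrix_eigenvector_in_invariant_subspace[OF sym sub inv this]
  obtain x \<mu> where x: "x \<in> V" "norm x = 1" "A *v x = \<mu> *\<^sub>R x" by blast
  have "x \<notin> S" using x by (auto simp: V_def orthogonal_def)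
  then show ?case using S eig x
    by (intro exI[of _ "insert x S"]) (auto simp: V_def pairwise_insert orthogonal_commute)
qed

theorem symmetric_matrix_spectral:
  fixes A :: "real^'n^'n"
  assumes "symmetric_matrix A"
  obtains p :: "'n \<Rightarrow> real^'n" and d :: "'n \<Rightarrow> real"
  where "\<And>i j. p i \<bullet> p j = (if i = j then 1 else 0)" "\<And>i. A *v p i = d i *\<^sub>R p i"
proof -
  obtain S where S: "card S = CARD('n)" "finite S" "pairwise orthogonal S"
    and eig: "\<And>x. x \<in> S \<Longrightarrow> norm x = 1 \<and> (\<exists>\<mu>. A *v x = \<mu> *\<^sub>R x)"
    using symmetric_matrix_orthonormal_eigenvectors[OF assms order_refl] by blast
  obtain p where p: "bij_betw p (UNIV :: 'n set) S"
    using S by (metis finite finite_same_card_bij)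
  then have pS: "p i \<in> S" for i by (auto simp: bij_betw_def)
  have "\<forall>i. \<exists>\<mu>. A *v p i = \<mu> *\<^sub>R p i" using eig pS by blast
  then obtain d where d: "\<And>i. A *v p i = d i *\<^sub>R p i" using choice[of "\<lambda>i \<mu>. A *v p i = \<mu> *\<^sub>R p i"] by blast
  have "p i \<bullet> p j = (if i = j then 1 else 0)" for i j
  proof (cases "i = j")
    case True
    then show ?thesis using eig[OF pS[of i]] by (simp add: dot_square_norm)
  next
    case False
    then have "p i \<noteq> p j" using p by (auto simp: bij_betw_def inj_on_def)
    with S(3) pS have "orthogonal (p i) (p j)" unfolding pairwise_def by blast
    with False show ?thesis by (simp add: orthogonal_def)
  qed
  with d that show thesis by blast
qed

text \<open>Constant matrices embed into matrices of polynomials compatibly with multiplication, so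
  the factors \<open>P\<close> and \<open>transpose P\<close> can be pulled out of the determinant of $X - A$.\<close>

lemma charpoly_similar_diagonal:
  fixes A P :: "real^'n^'n"
  assumes P: "transpose P ** P = mat 1" and A: "A = P ** D ** transpose P"
    and D: "D = (\<chi> i j. if i = j then d i else 0)"
  shows "charpoly A = (\<Prod>i\<in>UNIV. [:- d i, 1:])"
proof -
  define C :: "real^'n^'n \<Rightarrow> real poly^'n^'n" where "C M = (\<chi> i j. [:M $ i $ j:])" for M
  define X :: "real poly^'n^'n" where "X = (\<chi> i j. if i = j then [:0, 1:] else 0)"
  have const_sum: "[:sum f S:] = (\<Sum>k\<in>S. [:f k:])" for f :: "'n \<Rightarrow> real" and S
  proof (induction S rule: infinite_finite_induct)
    case (insert x F)
    have "[:f x + sum f F:] = [:f x:] + [:sum f F:]" by simp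
    with insert show ?case by (simp only: sum.insert[OF insert.hyps])
  qed auto
  have C_mult: "C (M ** N) = C M ** C N" for M N
    unfolding C_def by (simp add: vec_eq_iff matrix_matrix_mult_def const_sum mult.commute)
  have C_one: "C (mat 1) = mat 1"
    unfolding C_def by (simp add: vec_eq_iff mat_def)
  have X_scalar: "X ** M = M ** X" for M
    unfolding X_def matrix_matrix_mult_def
    by (simp add: vec_eq_iff if_distrib if_distribR mult.commute cong: if_cong)
  have charpoly: "charpoly M = det (X - C M)" for M
    unfolding charpoly_def X_def C_def by (rule arg_cong[where f = det]) (simp add: vec_eq_iff)
  have "P ** transpose P = mat 1" using P by (metis matrix_left_right_inverse)
  then have CP: "C P ** C (transpose P) = mat 1" by (metis C_mult C_one)
  have diff_l: "L ** (M - N) = L ** M - L ** N" and diff_r: "(M - N) ** L = M ** L - N ** L"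
    for L M N :: "real poly^'n^'n"
    by (simp_all add: matrix_matrix_mult_def vec_eq_iff algebra_simps sum_subtractf)
  have "X - C A = C P ** (X - C D) ** C (transpose P)"
  proof -
    have "X = C P ** X ** C (transpose P)"
      by (metis CP X_scalar matrix_mul_assoc matrix_mul_rid)
    then show ?thesis by (simp add: A C_mult diff_l diff_r)
  qed
  then have "charpoly A = det (C P) * det (X - C D) * det (C (transpose P))"
    by (simp add: charpoly det_mul)
  also have "\<dots> = det (C P ** C (transpose P)) * det (X - C D)"
    by (simp add: det_mul)
  also have "\<dots> = det (X - C D)" by (simp add: CP)
  also have "\<dots> = (\<Prod>i\<in>UNIV. [:- d i, 1:])"
    by (subst det_diagonal) (auto simp: X_def C_def D)
  finally show ?thesis .
qed

lemma charpoly_orthonormal_eigenbasis: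
  fixes A :: "real^'n^'n" and p :: "'n \<Rightarrow> real^'n" and d :: "'n \<Rightarrow> real"
  assumes p: "\<And>i j. p i \<bullet> p j = (if i = j then 1 else 0)" and d: "\<And>i. A *v p i = d i *\<^sub>R p i"
  shows "charpoly A = (\<Prod>i\<in>UNIV. [:- d i, 1:])"
proof -
  define P :: "real^'n^'n" where "P = (\<chi> i j. p j $ i)"
  define D :: "real^'n^'n" where "D = (\<chi> i j. if i = j then d i else 0)"
  have PP: "transpose P ** P = mat 1"
    using p by (simp add: P_def transpose_def matrix_matrix_mult_def mat_def vec_eq_iff inner_vec_def)
  then have PP': "P ** transpose P = mat 1" by (metis matrix_left_right_inverse)
  have "(A ** P) $ i $ j = (P ** D) $ i $ j" for i j
  proof -
    have "(A ** P) $ i $ j = (A *v p j) $ i"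
      by (simp add: matrix_matrix_mult_def matrix_vector_mult_def P_def)
    also have "\<dots> = (P ** D) $ i $ j"
      by (simp add: d matrix_matrix_mult_def P_def D_def if_distrib cong: if_cong)
    finally show ?thesis .
  qed
  then have "A ** P = P ** D" by (simp add: vec_eq_iff)
  then have "A = P ** D ** transpose P"
    by (metis PP' matrix_mul_assoc matrix_mul_rid)
  from charpoly_similar_diagonal[OF PP this D_def] show ?thesis .
qed

subsection \<open>The second smallest eigenvalue\<close>

text \<open>Reduces statements on the second smallest entry of a list to counting entries.\<close>

lemma sorted_list_nth_1_less_iff:
  fixes M :: "'b::linorder multiset"
  assumes "2 \<le> size M" and down: "\<And>x y. P y \<Longrightarrow> x \<le> y \<Longrightarrow> P x"
  shows "P (sorted_list_of_multiset M ! 1) \<longleftrightarrow> 2 \<le> size (filter_mset P M)"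
proof -
  obtain xs where xs: "sorted_list_of_multiset M = xs" "mset xs = M" "sorted xs" by simp
  then obtain a b r where r: "xs = a # b # r"
    using assms(1) by (metis (no_types) Suc_le_length_iff numeral_2_eq_2 size_mset)
  have sz: "size (filter_mset P M) = length (filter P xs)"
    using xs by (metis mset_filter size_mset)
  show ?thesis
  proof (cases "P b")
    case True
    then have "P a" using xs r down by auto
    then show ?thesis using True xs r sz by simp
  next
    case False
    then have "filter P r = []" using xs r down by (auto simp: filter_empty_conv)
    then show ?thesis using False xs r sz by simp
  qed
qed

definition second_eigenvalue :: "real^'n^'n \<Rightarrow> real" where
  "second_eigenvalue A = sorted_list_of_multiset (proots (charpoly A)) ! 1"

lemma card_ge_2_iff:
  fixes S :: "'n::finite set"
  shows "2 \<le> card S \<longleftrightarrow> (\<exists>i\<in>S. \<exists>j\<in>S. i \<noteq> j)"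
  by (metis card_le_Suc0_iff_eq finite not_less_eq_eq numeral_2_eq_2)

lemma second_eigenvalue_eigenbasis:
  fixes A :: "real^'n^'n" and p :: "'n \<Rightarrow> real^'n" and d :: "'n \<Rightarrow> real"
  assumes p: "\<And>i j. p i \<bullet> p j = (if i = j then 1 else 0)" and d: "\<And>i. A *v p i = d i *\<^sub>R p i"
    and n: "2 \<le> CARD('n)" and down: "\<And>x y. P y \<Longrightarrow> x \<le> y \<Longrightarrow> P x"
  shows "P (second_eigenvalue A) \<longleftrightarrow> (\<exists>i j. i \<noteq> j \<and> P (d i) \<and> P (d j))"
proof -
  have "proots (charpoly A) = (\<Sum>i\<in>UNIV. proots [:- d i, 1:])"
    unfolding charpoly_orthonormal_eigenbasis[OF p d] by (rule proots_prod) auto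
  also have "\<dots> = image_mset d (mset_set UNIV)"
    by (simp add: sum_unfold_sum_mset)
  finally have roots: "proots (charpoly A) = image_mset d (mset_set UNIV)" .
  have "size (filter_mset P (image_mset d (mset_set UNIV))) = card {i. P (d i)}"
    by (simp add: filter_mset_image_mset)
  moreover have "2 \<le> size (proots (charpoly A))" using n by (simp add: roots)
  ultimately have "P (second_eigenvalue A) \<longleftrightarrow> 2 \<le> card {i. P (d i)}"
    unfolding second_eigenvalue_def using sorted_list_nth_1_less_iff[where P = P, OF _ down]
    by (simp add: roots)
  then show ?thesis unfolding card_ge_2_iff by blast
qed

text \<open>Parseval's identity in an orthonormal eigenbasis.\<close>

lemma eigenbasis_quadratic_form:
  fixes A :: "real^'n^'n" and p :: "'n \<Rightarrow> real^'n" and d :: "'n \<Rightarrow> real"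
  assumes p: "\<And>i j. p i \<bullet> p j = (if i = j then 1 else 0)" and d: "\<And>i. A *v p i = d i *\<^sub>R p i"
    and sym: "symmetric_matrix A"
  shows "x \<bullet> (A *v x) - c * (x \<bullet> x) = (\<Sum>i\<in>UNIV. (d i - c) * (p i \<bullet> x)\<^sup>2)"
    and "(\<And>i. p i \<bullet> x = 0) \<Longrightarrow> x = 0"
proof -
  define P :: "real^'n^'n" where "P = (\<chi> i j. p j $ i)"
  have PP: "transpose P ** P = mat 1"
    using p by (simp add: P_def transpose_def matrix_matrix_mult_def mat_def vec_eq_iff inner_vec_def)
  then have PP': "P ** transpose P = mat 1" by (metis matrix_left_right_inverse)
  have Px: "transpose P *v x = (\<chi> i. p i \<bullet> x)" for x
    by (simp add: P_def transpose_def matrix_vector_mult_def inner_vec_def vec_eq_iff)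
  have Pinner: "x \<bullet> y = (\<Sum>i\<in>UNIV. (p i \<bullet> x) * (p i \<bullet> y))" for x y
  proof -
    have "x \<bullet> y = x \<bullet> (P *v (transpose P *v y))"
      by (simp only: PP' matrix_vector_mul_assoc matrix_vector_mul_lid)
    also have "\<dots> = (transpose P *v x) \<bullet> (transpose P *v y)"
      by (metis dot_lmul_matrix vector_transpose_matrix transpose_transpose)
    finally show ?thesis unfolding Px by (simp add: inner_vec_def)
  qed
  have "p i \<bullet> (A *v x) = d i * (p i \<bullet> x)" for i
    using symmetric_matrix_inner[OF sym, of "p i" x] by (simp add: d)
  then show "x \<bullet> (A *v x) - c * (x \<bullet> x) = (\<Sum>i\<in>UNIV. (d i - c) * (p i \<bullet> x)\<^sup>2)"
    unfolding Pinner[of x]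
    by (simp add: sum_distrib_left power2_eq_square algebra_simps flip: sum_subtractf)
  show "x = 0" if "\<And>i. p i \<bullet> x = 0"
    using Pinner[of x x] that by simp
qed

text \<open>A plane meets every hyperplane in a nonzero vector; this is all the dimension theory that the
  variational principle for the second eigenvalue needs.\<close>

lemma combination_orthogonal:
  fixes a b :: real
  obtains \<alpha> \<beta> :: real where "(\<alpha>, \<beta>) \<noteq> (0, 0)" "\<alpha> * a + \<beta> * b = 0"
proof (cases "a = 0 \<and> b = 0")
  case True
  then show thesis using that[of 1 0] by simp
next
  case False
  then show thesis using that[of b "- a"] by (auto simp: mult.commute)
qed

text \<open>If at most one eigenvalue were below \<open>c\<close>, then the plane would contain a nonzero vector
  orthogonal to its eigenvector, and there the form is nonnegative.\<close>

lemma second_eigenvalue_less: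
  fixes A :: "real^'n^'n"
  assumes sym: "symmetric_matrix A" and n: "2 \<le> CARD('n)"
    and neg: "\<And>\<alpha> \<beta>. (\<alpha>, \<beta>) \<noteq> (0, 0) \<Longrightarrow>
      (let x = \<alpha> *\<^sub>R f + \<beta> *\<^sub>R g in x \<bullet> (A *v x) - c * (x \<bullet> x) < 0)"
  shows "second_eigenvalue A < c"
proof -
  obtain p :: "'n \<Rightarrow> real^'n" and d where p: "\<And>i j. p i \<bullet> p j = (if i = j then 1 else 0)"
    and d: "\<And>i. A *v p i = d i *\<^sub>R p i"
    using symmetric_matrix_spectral[OF sym] by blast
  note q = eigenbasis_quadratic_form[OF p d sym]
  show ?thesis
  proof (rule ccontr)
    assume "\<not> second_eigenvalue A < c"
    then obtain i0 where i0: "\<And>i. i \<noteq> i0 \<Longrightarrow> c \<le> d i"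
      using second_eigenvalue_eigenbasis[OF p d n, of "\<lambda>x. x < c"] by (metis not_le order_le_less_trans)
    obtain \<alpha> \<beta> where ab: "(\<alpha>, \<beta>) \<noteq> (0, 0)" "\<alpha> * (p i0 \<bullet> f) + \<beta> * (p i0 \<bullet> g) = 0"
      by (rule combination_orthogonal)
    define x where "x = \<alpha> *\<^sub>R f + \<beta> *\<^sub>R g"
    have "p i0 \<bullet> x = 0" using ab by (simp add: x_def inner_add_right)
    then have "0 \<le> (\<Sum>i\<in>UNIV. (d i - c) * (p i \<bullet> x)\<^sup>2)"
      using i0 by (intro sum_nonneg) (metis diff_ge_0_iff_ge mult_nonneg_nonneg mult_zero_right
          order_refl power_zero_numeral zero_le_power2)
    then show False using neg[OF ab(1)] q(1)[of x c] by (simp add: x_def Let_def)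
  qed
qed

text \<open>A form that is nonpositive on a plane becomes negative there when \<open>c\<close> is increased.\<close>

lemma second_eigenvalue_le:
  fixes A :: "real^'n^'n"
  assumes sym: "symmetric_matrix A" and n: "2 \<le> CARD('n)"
    and neg: "\<And>\<alpha> \<beta>. (\<alpha>, \<beta>) \<noteq> (0, 0) \<Longrightarrow>
      (let x = \<alpha> *\<^sub>R f + \<beta> *\<^sub>R g in x \<noteq> 0 \<and> x \<bullet> (A *v x) - c * (x \<bullet> x) \<le> 0)"
  shows "second_eigenvalue A \<le> c"
proof (rule dense_ge)
  fix c' assume "c < c'"
  show "second_eigenvalue A \<le> c'"
  proof (rule less_imp_le, rule second_eigenvalue_less[OF sym n])
    fix \<alpha> \<beta> :: real assume "(\<alpha>, \<beta>) \<noteq> (0, 0)"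
    from neg[OF this] \<open>c < c'\<close>
    show "let x = \<alpha> *\<^sub>R f + \<beta> *\<^sub>R g in x \<bullet> (A *v x) - c' * (x \<bullet> x) < 0"
      unfolding Let_def
      by (smt (verit, best) inner_gt_zero_iff mult_strict_right_mono)
  qed
qed

text \<open>Two eigenvectors for eigenvalues below \<open>c\<close> would span a plane that meets the hyperplane.\<close>

lemma second_eigenvalue_ge:
  fixes A :: "real^'n^'n"
  assumes sym: "symmetric_matrix A" and n: "2 \<le> CARD('n)"
    and nonneg: "\<And>x. w \<bullet> x = 0 \<Longrightarrow> 0 \<le> x \<bullet> (A *v x) - c * (x \<bullet> x)"
  shows "c \<le> second_eigenvalue A"
proof -
  obtain p :: "'n \<Rightarrow> real^'n" and d where p: "\<And>i j. p i \<bullet> p j = (if i = j then 1 else 0)"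
    and d: "\<And>i. A *v p i = d i *\<^sub>R p i"
    using symmetric_matrix_spectral[OF sym] by blast
  show ?thesis
  proof (rule ccontr)
    assume "\<not> c \<le> second_eigenvalue A"
    then obtain i j where ij: "i \<noteq> j" "d i < c" "d j < c"
      using second_eigenvalue_eigenbasis[OF p d n, of "\<lambda>x. x < c"] by auto
    obtain \<alpha> \<beta> where ab: "(\<alpha>, \<beta>) \<noteq> (0, 0)" "\<alpha> * (w \<bullet> p i) + \<beta> * (w \<bullet> p j) = 0"
      by (rule combination_orthogonal)
    define x where "x = \<alpha> *\<^sub>R p i + \<beta> *\<^sub>R p j"
    have "w \<bullet> x = 0" using ab by (simp add: x_def inner_add_right)
    moreover have "x \<bullet> (A *v x) - c * (x \<bullet> x) = \<alpha>\<^sup>2 * (d i - c) + \<beta>\<^sup>2 * (d j - c)"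
      using ij p by (simp add: x_def matrix_vector_right_distrib matrix_vector_mult_scaleR d
          inner_add_right inner_add_left power2_eq_square algebra_simps)
    moreover have "\<alpha>\<^sup>2 * (d i - c) + \<beta>\<^sup>2 * (d j - c) < 0"
      using ab(1) ij by (cases "\<alpha> = 0") (auto intro!: add_neg_nonpos mult_pos_neg mult_nonneg_nonpos)
    ultimately show False using nonneg[of x] by simp
  qed
qed

lemma second_eigenvalue_greater:
  fixes A :: "real^'n^'n"
  assumes sym: "symmetric_matrix A" and n: "2 \<le> CARD('n)"
    and pos: "\<And>x. w \<bullet> x = 0 \<Longrightarrow> x \<noteq> 0 \<Longrightarrow> 0 < x \<bullet> (A *v x) - c * (x \<bullet> x)"
  shows "c < second_eigenvalue A"
proof -
  obtain p :: "'n \<Rightarrow> real^'n" and d where p: "\<And>i j. p i \<bullet> p j = (if i = j then 1 else 0)"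
    and d: "\<And>i. A *v p i = d i *\<^sub>R p i"
    using symmetric_matrix_spectral[OF sym] by blast
  show ?thesis
  proof (rule ccontr)
    assume "\<not> c < second_eigenvalue A"
    then obtain i j where ij: "i \<noteq> j" "d i \<le> c" "d j \<le> c"
      using second_eigenvalue_eigenbasis[OF p d n, of "\<lambda>x. x \<le> c"] by auto
    obtain \<alpha> \<beta> where ab: "(\<alpha>, \<beta>) \<noteq> (0, 0)" "\<alpha> * (w \<bullet> p i) + \<beta> * (w \<bullet> p j) = 0"
      by (rule combination_orthogonal)
    define x where "x = \<alpha> *\<^sub>R p i + \<beta> *\<^sub>R p j"
    have "w \<bullet> x = 0" using ab by (simp add: x_def inner_add_right)
    moreover have "p i \<bullet> x = \<alpha>" "p j \<bullet> x = \<beta>"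
      using ij p by (auto simp: x_def inner_add_right)
    then have "x \<noteq> 0" using ab(1) by auto
    moreover have "x \<bullet> (A *v x) - c * (x \<bullet> x) = \<alpha>\<^sup>2 * (d i - c) + \<beta>\<^sup>2 * (d j - c)"
      using ij p by (simp add: x_def matrix_vector_right_distrib matrix_vector_mult_scaleR d
          inner_add_right inner_add_left power2_eq_square algebra_simps)
    moreover have "\<alpha>\<^sup>2 * (d i - c) + \<beta>\<^sup>2 * (d j - c) \<le> 0"
      using ij by (intro add_nonpos_nonpos mult_nonneg_nonpos) auto
    ultimately show False using pos[of x] by simp
  qed
qed


section \<open>The energy and the normalized Laplacian\<close>

definition edge_energy :: "real \<Rightarrow> real \<Rightarrow> real" where
  "edge_energy x y = x\<^sup>2 + y\<^sup>2 - sqrt 6 * x * y"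

text \<open>Every edge is counted twice, once for each of its arcs. The factor $\sqrt 6$ belongs to the
  threshold $c = 1 - \sqrt 6/3$: up to a scalar, the energy is $h \cdot L h - c\, h \cdot D h$.\<close>

definition energy :: "'a pair_pre_digraph \<Rightarrow> ('a \<Rightarrow> real) \<Rightarrow> real" where
  "energy G h = (\<Sum>(u, v)\<in>parcs G. edge_energy (h u) (h v))"

text \<open>Turns the diagonal form of the degree matrix into a sum over arcs.\<close>

lemma sum_arcs_tail:
  fixes G :: "'v::finite pair_pre_digraph"
  shows "(\<Sum>(u, v)\<in>parcs G. k u) = (\<Sum>u\<in>UNIV. real (out_degree (with_proj G) u) * k u)"
proof -
  have "(\<Sum>(u, v)\<in>parcs G. k u) = (\<Sum>e\<in>parcs G. k (fst e))" by (simp add: case_prod_unfold)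
  also have "\<dots> = (\<Sum>u\<in>UNIV. \<Sum>e\<in>{e \<in> parcs G. fst e = u}. k (fst e))"
    by (intro sum.group[symmetric]) auto
  also have "\<dots> = (\<Sum>u\<in>UNIV. real (out_degree (with_proj G) u) * k u)"
    by (intro sum.cong refl) (simp add: out_degree_def out_arcs_def)
  finally show ?thesis .
qed

locale spectral_graph =
  fixes G :: "'v::finite pair_pre_digraph"
  assumes sym: "\<And>u v. (u, v) \<in> parcs G \<Longrightarrow> (v, u) \<in> parcs G"
    and deg: "\<And>u. 0 < out_degree (with_proj G) u"
    and two: "2 \<le> CARD('v)"
begin

abbreviation dg :: "'v \<Rightarrow> real" where "dg u \<equiv> real (out_degree (with_proj G) u)"

lemma deg_nz: "out_degree (with_proj G) u \<noteq> 0"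
  using deg[of u] by simp

text \<open>The substitution $x = D^{1/2} h$, under which the square roots of degrees disappear from the form.\<close>

definition scaled :: "('v \<Rightarrow> real) \<Rightarrow> real^'v" where
  "scaled h = (\<chi> v. sqrt (dg v) * h v)"

lemma normalized_laplacian_entry:
  "normalized_laplacian G $ u $ v = (if u = v then 1 else 0) - (if (u, v) \<in> parcs G then 1 / (sqrt (dg u) * sqrt (dg v)) else 0)"
proof -
  have "normalized_laplacian G $ u $ v = (laplacian G $ u $ v) / (sqrt (dg u) * sqrt (dg v))"
    unfolding normalized_laplacian_def matrix_matrix_mult_def deg_matrix_inv_sqrt_def
    by (simp add: if_distrib if_distribR sum.delta sum.delta' cong: if_cong)
  then show ?thesis using deg[of u] by (auto simp: laplacian_def deg_matrix_def adj_matrix_def diff_divide_distrib)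
qed

lemma symmetric_normalized_laplacian: "symmetric_matrix (normalized_laplacian G)"
  unfolding symmetric_matrix_def
  by (auto simp: vec_eq_iff transpose_def normalized_laplacian_entry mult.commute dest: sym)

lemma arcs_swap: "(\<Sum>(u, v)\<in>parcs G. k v) = (\<Sum>(u, v)\<in>parcs G. k u)" for k :: "'v \<Rightarrow> real"
  by (rule sum.reindex_bij_witness[of _ prod.swap prod.swap]) (auto dest: sym)

text \<open>On arcs, the degree term of \<open>h\<close> splits evenly between the two ends; dividing by $\sqrt 6$ uses
  $2/\sqrt 6 = \sqrt 6/3$.\<close>

lemma energy_eq_quadratic_form:
  "scaled h \<bullet> (normalized_laplacian G *v scaled h) - (1 - sqrt 6 / 3) * (scaled h \<bullet> scaled h)
     = energy G h / sqrt 6"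
proof -
  have norm: "scaled h \<bullet> scaled h = (\<Sum>(u, v)\<in>parcs G. (h u)\<^sup>2)"
    by (subst sum_arcs_tail) (auto simp: scaled_def inner_vec_def power2_eq_square algebra_simps intro!: sum.cong)
  have "(normalized_laplacian G *v scaled h) $ u
      = sqrt (dg u) * h u - (\<Sum>v\<in>UNIV. if (u, v) \<in> parcs G then h v / sqrt (dg u) else 0)" for u
  proof -
    have "(normalized_laplacian G *v scaled h) $ u = (\<Sum>v\<in>UNIV. (if u = v then sqrt (dg v) * h v else 0)
       - (if (u, v) \<in> parcs G then h v / sqrt (dg u) else 0))"
      unfolding matrix_vector_mult_def
      by (auto simp: scaled_def normalized_laplacian_entry left_diff_distrib deg_nz intro!: sum.cong)
    then show ?thesis by (simp add: sum_subtractf)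
  qed
  then have "scaled h \<bullet> (normalized_laplacian G *v scaled h) = scaled h \<bullet> scaled h
     - (\<Sum>u\<in>UNIV. \<Sum>v\<in>UNIV. if (u, v) \<in> parcs G then h u * h v else 0)"
    by (simp add: inner_vec_def scaled_def right_diff_distrib sum_subtractf sum_distrib_left
        if_distrib[of "\<lambda>x. _ * x"] deg_nz cong: if_cong)
  also have "(\<Sum>u\<in>UNIV. \<Sum>v\<in>UNIV. if (u, v) \<in> parcs G then h u * h v else 0) = (\<Sum>(u, v)\<in>parcs G. h u * h v)"
    unfolding sum.cartesian_product by (rule sum.mono_neutral_cong_right) auto
  finally have quad: "scaled h \<bullet> (normalized_laplacian G *v scaled h) =
     scaled h \<bullet> scaled h - (\<Sum>(u, v)\<in>parcs G. h u * h v)" .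
  have "energy G h = 2 * (scaled h \<bullet> scaled h) - sqrt 6 * (\<Sum>(u, v)\<in>parcs G. h u * h v)"
    unfolding energy_def edge_energy_def norm using arcs_swap[of "\<lambda>u. (h u)\<^sup>2"]
    by (simp add: case_prod_unfold sum.distrib sum_subtractf sum_distrib_left mult.assoc)
  moreover have "(S - T - (1 - a / 3) * S) * a = S * (a * a) / 3 - a * T" for S T a :: real
    by (simp add: field_simps)
  ultimately show ?thesis unfolding quad by (simp add: eq_divide_eq)
qed

lemma scaled_surj: "\<exists>h. x = scaled h"
proof
  show "x = scaled (\<lambda>v. x $ v / sqrt (dg v))"
    by (simp add: scaled_def vec_eq_iff deg_nz)
qed

lemma scaled_linear: "scaled (\<lambda>v. \<alpha> * f v + \<beta> * g v) = \<alpha> *\<^sub>R scaled f + \<beta> *\<^sub>R scaled g"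
  by (simp add: scaled_def vec_eq_iff algebra_simps)

lemma scaled_eq_0_iff: "scaled h = 0 \<longleftrightarrow> (\<forall>v. h v = 0)"
  by (simp add: scaled_def vec_eq_iff deg_nz)

lemma second_eigenvalue_nl: "nl_eigenvalue 2 G = second_eigenvalue (normalized_laplacian G)"
  by (simp add: nl_eigenvalue_def second_eigenvalue_def)

lemma nl_eigenvalue_less:
  assumes "\<And>\<alpha> \<beta>. (\<alpha>, \<beta>) \<noteq> (0, 0) \<Longrightarrow> energy G (\<lambda>v. \<alpha> * f v + \<beta> * g v) < 0"
  shows "nl_eigenvalue 2 G < 1 - sqrt 6 / 3"
  unfolding second_eigenvalue_nl
proof (rule second_eigenvalue_less[OF symmetric_normalized_laplacian two])
  fix \<alpha> \<beta> :: real assume "(\<alpha>, \<beta>) \<noteq> (0, 0)"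
  from assms[OF this] show "let x = \<alpha> *\<^sub>R scaled f + \<beta> *\<^sub>R scaled g in
      x \<bullet> (normalized_laplacian G *v x) - (1 - sqrt 6 / 3) * (x \<bullet> x) < 0"
    unfolding Let_def scaled_linear[symmetric] energy_eq_quadratic_form
    by (simp add: divide_less_0_iff)
qed

lemma nl_eigenvalue_le:
  assumes "\<And>\<alpha> \<beta>. (\<alpha>, \<beta>) \<noteq> (0, 0) \<Longrightarrow> energy G (\<lambda>v. \<alpha> * f v + \<beta> * g v) \<le> 0 \<and> (\<exists>v. \<alpha> * f v + \<beta> * g v \<noteq> 0)"
  shows "nl_eigenvalue 2 G \<le> 1 - sqrt 6 / 3"
  unfolding second_eigenvalue_nl
proof (rule second_eigenvalue_le[OF symmetric_normalized_laplacian two])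
  fix \<alpha> \<beta> :: real assume "(\<alpha>, \<beta>) \<noteq> (0, 0)"
  from assms[OF this] show "let x = \<alpha> *\<^sub>R scaled f + \<beta> *\<^sub>R scaled g in
      x \<noteq> 0 \<and> x \<bullet> (normalized_laplacian G *v x) - (1 - sqrt 6 / 3) * (x \<bullet> x) \<le> 0"
    unfolding Let_def scaled_linear[symmetric] energy_eq_quadratic_form scaled_eq_0_iff
    by (simp add: divide_le_0_iff)
qed

lemma scaled_functional: "(\<chi> v. w v / sqrt (dg v)) \<bullet> scaled h = (\<Sum>v\<in>UNIV. w v * h v)"
  by (simp add: scaled_def inner_vec_def deg_nz)

lemma nl_eigenvalue_ge:
  assumes "\<And>h. (\<Sum>v\<in>UNIV. w v * h v) = 0 \<Longrightarrow> 0 \<le> energy G h"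
  shows "1 - sqrt 6 / 3 \<le> nl_eigenvalue 2 G"
  unfolding second_eigenvalue_nl
proof (rule second_eigenvalue_ge[OF symmetric_normalized_laplacian two])
  fix x assume x: "(\<chi> v. w v / sqrt (dg v)) \<bullet> x = 0"
  obtain h where h: "x = scaled h" using scaled_surj by blast
  show "0 \<le> x \<bullet> (normalized_laplacian G *v x) - (1 - sqrt 6 / 3) * (x \<bullet> x)"
    using assms[of h] x unfolding h scaled_functional energy_eq_quadratic_form by simp
qed

lemma nl_eigenvalue_greater:
  assumes "\<And>h. (\<Sum>v\<in>UNIV. w v * h v) = 0 \<Longrightarrow> \<exists>v. h v \<noteq> 0 \<Longrightarrow> 0 < energy G h"
  shows "1 - sqrt 6 / 3 < nl_eigenvalue 2 G"
  unfolding second_eigenvalue_nl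
proof (rule second_eigenvalue_greater[OF symmetric_normalized_laplacian two])
  fix x assume x: "(\<chi> v. w v / sqrt (dg v)) \<bullet> x = 0" "x \<noteq> 0"
  obtain h where h: "x = scaled h" using scaled_surj by blast
  show "0 < x \<bullet> (normalized_laplacian G *v x) - (1 - sqrt 6 / 3) * (x \<bullet> x)"
    using assms[of h] x unfolding h scaled_functional energy_eq_quadratic_form scaled_eq_0_iff by auto
qed

end

section \<open>Graph isomorphisms\<close>

text \<open>For graphs whose arcs are pairs of vertices, the arc map of an isomorphism is determined by the
  vertex map.\<close>

lemma graph_iso_iff:
  fixes G :: "'a pair_pre_digraph" and H :: "'b pair_pre_digraph"
  assumes G: "parcs G \<subseteq> pverts G \<times> pverts G"
  shows "G \<simeq>\<^sub>g H \<longleftrightarrow> (\<exists>\<phi>. bij_betw \<phi> (pverts G) (pverts H) \<and> parcs H = map_prod \<phi> \<phi> ` parcs G)"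
proof
  assume "G \<simeq>\<^sub>g H"
  then obtain f where f: "pre_digraph.digraph_isomorphism (with_proj G) f"
    and H: "with_proj H = app_iso f (with_proj G)"
    by (auto simp: digraph_iso_def)
  let ?\<phi> = "iso_verts f"
  from H have "pverts H = ?\<phi> ` pverts G" "parcs H = iso_arcs f ` parcs G"
    and fs: "fst = iso_tail f" "snd = iso_head f"
    by (auto simp: app_iso_def with_proj_def)
  moreover have "iso_arcs f a = map_prod ?\<phi> ?\<phi> a" if "a \<in> parcs G" for a
    using f that unfolding pre_digraph.digraph_isomorphism_def fs[symmetric]
    by (auto simp: prod_eq_iff)
  moreover have "inj_on ?\<phi> (pverts G)"
    using f by (simp add: pre_digraph.digraph_isomorphism_def)
  ultimately show "\<exists>\<phi>. bij_betw \<phi> (pverts G) (pverts H) \<and> parcs H = map_prod \<phi> \<phi> ` parcs G"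
    by (intro exI[of _ ?\<phi>]) (auto simp: bij_betw_def)
next
  assume "\<exists>\<phi>. bij_betw \<phi> (pverts G) (pverts H) \<and> parcs H = map_prod \<phi> \<phi> ` parcs G"
  then obtain \<phi> where \<phi>: "bij_betw \<phi> (pverts G) (pverts H)" "parcs H = map_prod \<phi> \<phi> ` parcs G" by blast
  define f where "f = \<lparr>iso_verts = \<phi>, iso_arcs = map_prod \<phi> \<phi>, iso_head = snd, iso_tail = fst\<rparr>"
  have "inj_on (map_prod \<phi> \<phi>) (parcs G)"
    using \<phi>(1) G by (intro inj_on_subset[OF map_prod_inj_on]) (auto simp: bij_betw_def)
  moreover have "wf_digraph (with_proj G)" using G by unfold_locales auto
  ultimately have "pre_digraph.digraph_isomorphism (with_proj G) f"
    using \<phi> by (auto simp: pre_digraph.digraph_isomorphism_def f_def bij_betw_def)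
  moreover have "with_proj H = app_iso f (with_proj G)"
    using \<phi> by (simp add: app_iso_def f_def with_proj_def bij_betw_def)
  ultimately show "G \<simeq>\<^sub>g H" by (auto simp: digraph_iso_def)
qed

lemma graph_isoI:
  assumes "parcs G \<subseteq> pverts G \<times> pverts G" "bij_betw \<phi> (pverts G) (pverts H)"
    "parcs H = map_prod \<phi> \<phi> ` parcs G"
  shows "G \<simeq>\<^sub>g H"
  by (rule graph_iso_iff[OF assms(1), THEN iffD2], rule exI[of _ \<phi>], rule conjI) (fact assms)+

lemma graph_isoE:
  assumes "parcs G \<subseteq> pverts G \<times> pverts G" "G \<simeq>\<^sub>g H"
  obtains \<phi> where "bij_betw \<phi> (pverts G) (pverts H)" "parcs H = map_prod \<phi> \<phi> ` parcs G"
  using graph_iso_iff[OF assms(1), THEN iffD1, OF assms(2)] by (elim exE conjE)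

lemma graph_iso_sym:
  assumes G: "parcs G \<subseteq> pverts G \<times> pverts G" and "G \<simeq>\<^sub>g H"
  shows "H \<simeq>\<^sub>g G"
proof -
  obtain \<phi> where \<phi>: "bij_betw \<phi> (pverts G) (pverts H)" "parcs H = map_prod \<phi> \<phi> ` parcs G"
    using assms by (rule graph_isoE)
  let ?\<psi> = "the_inv_into (pverts G) \<phi>"
  have inv: "?\<psi> (\<phi> v) = v" if "v \<in> pverts G" for v
    using \<phi>(1) that by (simp add: bij_betw_def the_inv_into_f_f)
  have "bij_betw ?\<psi> (pverts H) (pverts G)" using \<phi>(1) by (rule bij_betw_the_inv_into)
  moreover have "parcs G = map_prod ?\<psi> ?\<psi> ` parcs H"
  proof -
    have "map_prod ?\<psi> ?\<psi> (map_prod \<phi> \<phi> e) = e" if "e \<in> parcs G" for e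
      using that G inv by (cases e) auto
    then have "(\<lambda>e. map_prod ?\<psi> ?\<psi> (map_prod \<phi> \<phi> e)) ` parcs G = id ` parcs G"
      by (intro image_cong) auto
    then show ?thesis unfolding \<phi>(2) image_image by simp
  qed
  moreover have "parcs H \<subseteq> pverts H \<times> pverts H" using \<phi> G by (auto simp: bij_betw_def)
  ultimately show ?thesis by (intro graph_isoI[of H ?\<psi> G])
qed

lemma graph_iso_trans:
  assumes G: "parcs G \<subseteq> pverts G \<times> pverts G" and GH: "G \<simeq>\<^sub>g H" and HK: "H \<simeq>\<^sub>g K"
  shows "G \<simeq>\<^sub>g K"
proof -
  obtain \<phi> where \<phi>: "bij_betw \<phi> (pverts G) (pverts H)" "parcs H = map_prod \<phi> \<phi> ` parcs G"
    using G GH by (rule graph_isoE)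
  then have "parcs H \<subseteq> pverts H \<times> pverts H" using G by (auto simp: bij_betw_def)
  from this HK obtain \<psi> where \<psi>: "bij_betw \<psi> (pverts H) (pverts K)" "parcs K = map_prod \<psi> \<psi> ` parcs H"
    by (rule graph_isoE)
  have "bij_betw (\<psi> \<circ> \<phi>) (pverts G) (pverts K)" using \<phi> \<psi> bij_betw_trans by blast
  moreover have "parcs K = map_prod (\<psi> \<circ> \<phi>) (\<psi> \<circ> \<phi>) ` parcs G"
    unfolding \<psi>(2) \<phi>(2) by (simp add: image_comp prod.map_comp map_prod.comp)
  ultimately show ?thesis by (rule graph_isoI[OF G])
qed

lemma map_prod_image_converse: "map_prod f f ` R\<inverse> = (map_prod f f ` R)\<inverse>"
  by (auto intro: rev_image_eqI)

section \<open>The graphs $C_g(T_1,\dots,T_g)$\<close>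

definition tree_arcs :: "rtree \<Rightarrow> (nat list \<times> nat list) set" where
  "tree_arcs T = {(p, p @ [j]) | p j. p @ [j] \<in> addrs T}"

text \<open>One arc for each edge: along the cycle, and from parent to child inside the trees.\<close>

definition C_arcs :: "rtree list \<Rightarrow> ((nat \<times> nat list) \<times> (nat \<times> nat list)) set" where
  "C_arcs Ts = (\<lambda>i. ((i, []), (Suc i mod length Ts, []))) ` {..<length Ts} \<union>
     (\<Union>i<length Ts. map_prod (Pair i) (Pair i) ` tree_arcs (Ts ! i))"

lemma parcs_C_graph: "parcs (C_graph Ts) = C_arcs Ts \<union> (C_arcs Ts)\<inverse>"
proof -
  have "C_arcs Ts = {((i, []), ((i + 1) mod length Ts, [])) | i. i < length Ts} \<union>
      {((i, p), (i, p @ [j])) | i p j. i < length Ts \<and> p @ [j] \<in> addrs (Ts ! i)}"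
    by (fastforce simp: C_arcs_def tree_arcs_def)
  then show ?thesis by (simp add: C_graph_def Let_def)
qed

lemma pverts_C_graph: "pverts (C_graph Ts) = (SIGMA i:{..<length Ts}. addrs (Ts ! i))"
  by (auto simp: C_graph_def Let_def)

lemma addrs_Node: "addrs (Node ts) = insert [] (\<Union>i<length ts. Cons i ` addrs (ts ! i))"
  by auto

declare addrs.simps [simp del]

lemma Nil_in_addrs [simp]: "[] \<in> addrs T"
  by (cases T) (simp add: addrs_Node)

lemma addrs_prefix: "p @ [j] \<in> addrs T \<Longrightarrow> p \<in> addrs T"
proof (induction p arbitrary: T)
  case (Cons a p)
  obtain ts where "T = Node ts" by (cases T)
  with Cons show ?case by (auto simp: addrs_Node)
qed simp

lemma finite_addrs [simp]: "finite (addrs T)"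
  by (induction T) (simp add: addrs_Node)

lemma tree_arcs_subset: "tree_arcs T \<subseteq> addrs T \<times> addrs T"
  by (auto simp: tree_arcs_def dest: addrs_prefix)

lemma C_arcs_subset: "C_arcs Ts \<subseteq> pverts (C_graph Ts) \<times> pverts (C_graph Ts)"
proof -
  have "Suc i mod length Ts < length Ts" if "i < length Ts" for i
    using that by (intro mod_less_divisor) auto
  then show ?thesis using tree_arcs_subset by (fastforce simp: C_arcs_def pverts_C_graph)
qed

lemma parcs_C_graph_subset: "parcs (C_graph Ts) \<subseteq> pverts (C_graph Ts) \<times> pverts (C_graph Ts)"
  using C_arcs_subset by (auto simp: parcs_C_graph)

lemma finite_pverts_C_graph [simp]: "finite (pverts (C_graph Ts))"
  by (simp add: pverts_C_graph)

lemma finite_parcs_C_graph [simp]: "finite (parcs (C_graph Ts))"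
  using parcs_C_graph_subset by (rule finite_subset) simp

text \<open>The two alternatives for \<open>\<sigma>\<close> are the rotations and the reflections of the cycle. The trees are
  carried along, so the isomorphism is \<open>\<sigma>\<close> on the first component of each vertex.\<close>

lemma graph_iso_C_graph_permI:
  fixes \<sigma> :: "nat \<Rightarrow> nat"
  assumes len: "length Us = length Ts" and \<sigma>: "bij_betw \<sigma> {..<length Ts} {..<length Ts}"
    and trees: "\<And>i. i < length Ts \<Longrightarrow> Us ! \<sigma> i = Ts ! i"
    and cyc: "(\<forall>i < length Ts. \<sigma> (Suc i mod length Ts) = Suc (\<sigma> i) mod length Ts) \<or>
              (\<forall>i < length Ts. \<sigma> i = Suc (\<sigma> (Suc i mod length Ts)) mod length Ts)"
  shows "C_graph Ts \<simeq>\<^sub>g C_graph Us"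
proof -
  let ?\<phi> = "map_prod \<sigma> id :: nat \<times> nat list \<Rightarrow> _" and ?n = "length Ts"
  have \<sigma>n: "\<sigma> i < ?n" if "i < ?n" for i using \<sigma> that by (auto simp: bij_betw_def)
  have \<sigma>surj: "\<exists>i<?n. k = \<sigma> i" if "k < ?n" for k using \<sigma> that by (auto simp: bij_betw_def)
  have "inj_on ?\<phi> (pverts (C_graph Ts))"
    using \<sigma> by (auto simp: pverts_C_graph bij_betw_def inj_on_def)
  moreover have "?\<phi> ` pverts (C_graph Ts) = pverts (C_graph Us)"
  proof -
    have "x \<in> pverts (C_graph Us)" if "x \<in> ?\<phi> ` pverts (C_graph Ts)" for x
      using that by (auto simp: pverts_C_graph len trees \<sigma>n)
    moreover have "(k, p) \<in> ?\<phi> ` pverts (C_graph Ts)" if "(k, p) \<in> pverts (C_graph Us)" for k p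
    proof -
      have "k < ?n" using that by (simp add: pverts_C_graph len)
      then obtain i where "i < ?n" "k = \<sigma> i" using \<sigma>surj by blast
      then show ?thesis using that trees by (force simp: pverts_C_graph)
    qed
    ultimately show ?thesis by auto
  qed
  moreover
  have arcs: "map_prod ?\<phi> ?\<phi> ` (C_arcs Ts \<union> (C_arcs Ts)\<inverse>) = C_arcs Us \<union> (C_arcs Us)\<inverse>"
  proof -
    define cyc where "cyc n = (\<lambda>i. ((i, [] :: nat list), (Suc i mod n, [] :: nat list))) ` {..<n}" for n
    have img: "map_prod ?\<phi> ?\<phi> ` cyc ?n = (\<lambda>i. ((\<sigma> i, []), (\<sigma> (Suc i mod ?n), []))) ` {..<?n}"
      by (simp add: cyc_def image_image)
    have 1: "map_prod ?\<phi> ?\<phi> ` (cyc ?n \<union> (cyc ?n)\<inverse>) = cyc ?n \<union> (cyc ?n)\<inverse>"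
      using cyc
    proof
      assume c: "\<forall>i < ?n. \<sigma> (Suc i mod ?n) = Suc (\<sigma> i) mod ?n"
      have "map_prod ?\<phi> ?\<phi> ` cyc ?n = (\<lambda>i. ((i, []), (Suc i mod ?n, []))) ` (\<sigma> ` {..<?n})"
        unfolding img image_image using c by (intro image_cong) auto
      then have e: "map_prod ?\<phi> ?\<phi> ` cyc ?n = cyc ?n" using \<sigma> by (simp add: bij_betw_def cyc_def)
      show ?thesis by (simp only: image_Un map_prod_image_converse e)
    next
      assume c: "\<forall>i < ?n. \<sigma> i = Suc (\<sigma> (Suc i mod ?n)) mod ?n"
      have s: "(\<lambda>i. Suc i mod ?n) ` {..<?n} = {..<?n}"
      proof
        show "{..<?n} \<subseteq> (\<lambda>i. Suc i mod ?n) ` {..<?n}"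
        proof
          fix k assume k: "k \<in> {..<?n}"
          show "k \<in> (\<lambda>i. Suc i mod ?n) ` {..<?n}"
            by (rule image_eqI[of _ _ "if k = 0 then ?n - 1 else k - 1"]) (use k in auto)
        qed
      qed (auto intro: mod_less_divisor)
      have "(map_prod ?\<phi> ?\<phi> ` cyc ?n) = (\<lambda>i. ((Suc i mod ?n, []), (i, []))) ` (\<sigma> ` (\<lambda>i. Suc i mod ?n) ` {..<?n})"
        unfolding img image_image using c by (intro image_cong) auto
      also have "\<dots> = (cyc ?n)\<inverse>" using \<sigma> unfolding s by (auto simp: bij_betw_def cyc_def)
      finally have e: "map_prod ?\<phi> ?\<phi> ` cyc ?n = (cyc ?n)\<inverse>" .
      show ?thesis by (simp only: image_Un map_prod_image_converse e converse_converse Un_commute)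
    qed
    have 2: "map_prod ?\<phi> ?\<phi> ` (\<Union>i<?n. map_prod (Pair i) (Pair i) ` tree_arcs (Ts ! i))
        = (\<Union>i<?n. map_prod (Pair i) (Pair i) ` tree_arcs (Us ! i))" (is "_ ` ?L = ?R")
    proof -
      have "map_prod ?\<phi> ?\<phi> ` ?L = (\<Union>i<?n. map_prod (Pair (\<sigma> i)) (Pair (\<sigma> i)) ` tree_arcs (Us ! \<sigma> i))"
        by (simp add: image_UN image_image map_prod_def case_prod_unfold trees)
      also have "\<dots> = (\<Union>i\<in>\<sigma> ` {..<?n}. map_prod (Pair i) (Pair i) ` tree_arcs (Us ! i))" by simp
      also have "\<dots> = ?R" using \<sigma> by (simp add: bij_betw_def)
      finally show ?thesis .
    qed
    let ?L = "\<Union>i<?n. map_prod (Pair i) (Pair i) ` tree_arcs (Ts ! i)"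
    let ?R = "\<Union>i<?n. map_prod (Pair i) (Pair i) ` tree_arcs (Us ! i)"
    have "map_prod ?\<phi> ?\<phi> ` (C_arcs Ts \<union> (C_arcs Ts)\<inverse>)
        = map_prod ?\<phi> ?\<phi> ` (cyc ?n \<union> (cyc ?n)\<inverse>) \<union> (map_prod ?\<phi> ?\<phi> ` ?L \<union> (map_prod ?\<phi> ?\<phi> ` ?L)\<inverse>)"
      by (simp add: C_arcs_def cyc_def converse_Un image_Un map_prod_image_converse Un_ac)
    also have "\<dots> = (cyc ?n \<union> (cyc ?n)\<inverse>) \<union> (?R \<union> ?R\<inverse>)" by (simp only: 1 2)
    also have "\<dots> = C_arcs Us \<union> (C_arcs Us)\<inverse>"
      by (simp add: C_arcs_def cyc_def converse_Un Un_ac len)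
    finally show ?thesis .
  qed
  ultimately show ?thesis
    by (intro graph_isoI[OF parcs_C_graph_subset, where \<phi> = ?\<phi>]) (simp_all only: bij_betw_def parcs_C_graph)
qed

lemma less_5_iff: "i < 5 \<longleftrightarrow> i = 0 \<or> i = 1 \<or> i = 2 \<or> i = 3 \<or> i = 4" for i :: nat
  by auto

lemma lessThan_5: "{..<5 :: nat} = {0, 1, 2, 3, 4}"
  by auto

lemma C_graph_rotate: "C_graph [a, b, c, d, e] \<simeq>\<^sub>g C_graph [b, c, d, e, a]"
proof (rule graph_iso_C_graph_permI[where \<sigma> = "\<lambda>i. (i + 4) mod 5"])
  show "bij_betw (\<lambda>i. (i + 4) mod 5) {..<length [a, b, c, d, e]} {..<length [a, b, c, d, e]}"
    unfolding bij_betw_def inj_on_def by (simp add: lessThan_Suc) (auto simp: insert_commute)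
qed (auto simp: less_Suc_eq)

lemma C_graph_reflect: "C_graph [a, b, c, d, e] \<simeq>\<^sub>g C_graph [a, e, d, c, b]"
proof (rule graph_iso_C_graph_permI[where \<sigma> = "\<lambda>i. (5 - i) mod 5"])
  show "bij_betw (\<lambda>i. (5 - i) mod 5) {..<length [a, b, c, d, e]} {..<length [a, b, c, d, e]}"
    unfolding bij_betw_def inj_on_def by (simp add: lessThan_Suc) (auto simp: insert_commute)
qed (auto simp: less_Suc_eq)

lemma tree_arcs_Node:
  "tree_arcs (Node ts) = (\<lambda>j. ([], [j])) ` {..<length ts} \<union>
     (\<Union>i<length ts. map_prod (Cons i) (Cons i) ` tree_arcs (ts ! i))" (is "?L = ?R")
proof (intro set_eqI iffI)
  fix x assume "x \<in> ?L"
  then obtain p j where x: "x = (p, p @ [j])" and p: "p @ [j] \<in> addrs (Node ts)"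
    by (auto simp: tree_arcs_def)
  show "x \<in> ?R"
  proof (cases p)
    case Nil
    then show ?thesis using x p by (auto simp: addrs_Node)
  next
    case (Cons i q)
    then have "i < length ts" "q @ [j] \<in> addrs (ts ! i)" using p by (auto simp: addrs_Node)
    then have "(q, q @ [j]) \<in> tree_arcs (ts ! i)" by (auto simp: tree_arcs_def)
    then have "map_prod (Cons i) (Cons i) (q, q @ [j]) \<in> ?R" using \<open>i < length ts\<close> by blast
    then show ?thesis by (simp add: x Cons)
  qed
next
  fix x assume "x \<in> ?R"
  then consider j where "x = ([], [j])" "j < length ts"
    | i p j where "i < length ts" "x = (i # p, i # p @ [j])" "p @ [j] \<in> addrs (ts ! i)"
    by (auto simp: tree_arcs_def)
  then show "x \<in> ?L"
  proof cases
    case 1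
    then have "[] @ [j] \<in> addrs (Node ts)" by (auto simp: addrs_Node intro!: bexI[of _ j])
    with 1 show ?thesis unfolding tree_arcs_def by blast
  next
    case 2
    then have "(i # p) @ [j] \<in> addrs (Node ts)" by (auto simp: addrs_Node intro!: bexI[of _ i])
    with 2 show ?thesis unfolding tree_arcs_def by auto
  qed
qed

section \<open>Structure of unicyclic graphs\<close>

definition cyclic_list :: "'a pair_pre_digraph \<Rightarrow> 'a list \<Rightarrow> bool" where
  "cyclic_list G vs \<longleftrightarrow> distinct vs \<and> 3 \<le> length vs \<and>
     (\<forall>i<length vs. (vs ! i, vs ! (Suc i mod length vs)) \<in> parcs G)"

definition cycle_edges :: "'a list \<Rightarrow> 'a set set" where
  "cycle_edges vs = (\<lambda>i. {vs ! i, vs ! (Suc i mod length vs)}) ` {..<length vs}"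

text \<open>On two vertices the edges from \<open>i\<close> to \<open>i + 1\<close> and back would coincide, which is where the
  length bound enters.\<close>

lemma card_cycle_edges:
  assumes "distinct vs" "3 \<le> length vs"
  shows "card (cycle_edges vs) = length vs"
proof -
  let ?n = "length vs"
  have "inj_on (\<lambda>i. {vs ! i, vs ! (Suc i mod ?n)}) {..<?n}"
  proof (rule inj_onI)
    fix i j assume ij: "i \<in> {..<?n}" "j \<in> {..<?n}"
      and eq: "{vs ! i, vs ! (Suc i mod ?n)} = {vs ! j, vs ! (Suc j mod ?n)}"
    have lt: "Suc i mod ?n < ?n" "Suc j mod ?n < ?n" using assms(2) by (auto intro!: mod_less_divisor)
    have "i = j \<or> (i = Suc j mod ?n \<and> Suc i mod ?n = j)"
      using eq ij lt assms(1) by (auto simp: doubleton_eq_iff nth_eq_iff_index_eq)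
    moreover have "\<not> (i = Suc j mod ?n \<and> Suc i mod ?n = j)"
      using assms(2) ij by (auto simp: mod_Suc)
    ultimately show "i = j" by blast
  qed
  then show ?thesis unfolding cycle_edges_def by (simp add: card_image)
qed

lemma cycle_imp_cyclic_list:
  assumes cyc: "pre_digraph.cycle (with_proj G) p" and len: "3 \<le> length p"
  shows "cyclic_list G (map fst p)"
    and "(\<lambda>(u, v). {u, v}) ` set p = cycle_edges (map fst p)"
proof -
  obtain u where u: "pre_digraph.awalk (with_proj G) u p u"
    and dist: "distinct (tl (pre_digraph.awalk_verts (with_proj G) u p))"
    using cyc by (auto simp: pre_digraph.cycle_def)
  have arcs: "set p \<subseteq> parcs G" and cas: "pcas u p u"
    using u by (auto simp: pre_digraph.awalk_def cas_with_proj_eq)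
  have pv: "pawalk_verts u p = map fst p @ [v]" if "pcas u p v" for u v
    using that by (induction p arbitrary: u) auto
  have hd: "fst (hd p) = u" using cas len by (cases p) auto
  have d: "distinct (map fst p)"
  proof -
    have "map fst p @ [u] = u # tl (map fst p) @ [u]" using len hd by (cases p) auto
    moreover have "distinct (tl (map fst p @ [u]))"
      using dist by (simp add: awalk_verts_with_proj_eq pv[OF cas])
    ultimately show ?thesis by (metis distinct.simps(2) distinct1_rotate list.sel(3) rotate1.simps(2) append_same_eq append_Cons)
  qed
  have step: "snd (p ! i) = (if Suc i < length p then fst (p ! Suc i) else v)"
    if "pcas u p v" "i < length p" for u v i
    using that
  proof (induction p arbitrary: u i)
    case (Cons a q)
    show ?case
    proof (cases i)
      case 0
      with Cons show ?thesis by (cases q) auto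
    next
      case (Suc j)
      with Cons show ?thesis by auto
    qed
  qed simp
  have nx: "snd (p ! i) = fst (p ! (Suc i mod length p))" if "i < length p" for i
  proof (cases "Suc i < length p")
    case True
    then show ?thesis using step[OF cas that] by simp
  next
    case False
    then have "Suc i = length p" using that by simp
    moreover have "fst (p ! 0) = u" using hd len by (cases p) auto
    ultimately show ?thesis using step[OF cas that] that by simp
  qed
  have lt: "Suc i mod length p < length p" for i using len by (intro mod_less_divisor) linarith
  have "(fst (p ! i), fst (p ! (Suc i mod length p))) \<in> parcs G" if "i < length p" for i
    using arcs that nx[OF that] by (metis nth_mem prod.collapse subsetD)
  then show "cyclic_list G (map fst p)"
    unfolding cyclic_list_def using d len lt by simp
  have "set p = (\<lambda>i. p ! i) ` {..<length p}" by (auto simp: set_conv_nth)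
  then have "(\<lambda>(u, v). {u, v}) ` set p = (\<lambda>i. {fst (p ! i), snd (p ! i)}) ` {..<length p}"
    by (simp only: image_image case_prod_unfold)
  also have "\<dots> = cycle_edges (map fst p)"
    unfolding cycle_edges_def length_map by (intro image_cong refl) (simp add: nx lt)
  finally show "(\<lambda>(u, v). {u, v}) ` set p = cycle_edges (map fst p)" .
qed

text \<open>A shortest detour around an edge closes up with that edge to a cycle. In a unicyclic graph all
  edges outside the cycle are therefore bridges.\<close>

lemma reachable_avoiding_edge_imp_cycle:
  assumes G: "pair_graph G" and e: "(x, y) \<in> parcs G"
    and R: "R \<subseteq> parcs G" "(x, y) \<notin> R" and path: "(x, y) \<in> R\<^sup>*"
  shows "\<exists>C\<in>cycles G. {x, y} \<in> C"
proof -
  interpret pair_graph G by (rule G)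
  have xy: "x \<in> pverts G" "y \<in> pverts G" "(y, x) \<in> parcs G" "x \<noteq> y"
    using e wellformed' pair_no_loops[OF e] pair_sym_arcs by (auto simp: symmetric_def sym_def)
  have "\<exists>q. awalk x q y \<and> set q \<subseteq> R"
    using path
  proof (induction rule: converse_rtrancl_induct)
    case base
    show ?case using xy by (intro exI[of _ "[]"]) (simp add: awalk_Nil_iff)
  next
    case (step a b)
    then obtain q where "awalk b q y" "set q \<subseteq> R" by blast
    with step R show ?case by (intro exI[of _ "(a, b) # q"]) (auto simp: awalk_Cons_iff)
  qed
  then obtain q where q: "awalk x q y" "set q \<subseteq> R" by blast
  define r where "r = awalk_to_apath q"
  have r: "apath x r y" "set r \<subseteq> R"
    using apath_awalk_to_apath[OF q(1)] awalk_to_apath_subset[OF q(1)] q(2) unfolding r_def by blast+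
  then have aw: "awalk x r y" and dist: "distinct (pawalk_verts x r)" unfolding apath_def by blast+
  have "length r \<noteq> 0" using aw xy by (auto simp: awalk_Nil_iff)
  moreover have "length r \<noteq> 1"
    using aw r R by (auto simp: length_Suc_conv awalk_Cons_iff awalk_Nil_iff)
  ultimately have "3 \<le> length ((y, x) # r)" by (cases r; cases "tl r") auto
  moreover have "cycle ((y, x) # r)"
    using aw dist xy by (auto simp: cycle_def awalk_Cons_iff)
  ultimately have "(\<lambda>(u, v). {u, v}) ` set ((y, x) # r) \<in> cycles G"
    unfolding cycles_def by (intro CollectI exI[of _ "(y, x) # r"] conjI refl)
  moreover have "{x, y} \<in> (\<lambda>(u, v). {u, v}) ` set ((y, x) # r)" by auto
  ultimately show ?thesis by (rule bexI[rotated])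
qed

text \<open>What the construction below uses of a unicyclic graph: connectedness, a cyclic list of vertices,
  and that every other edge is a bridge. The trees are found by layering the graph by the distance
  from the cycle.\<close>

locale unicyclic_at =
  fixes G :: "'a pair_pre_digraph" and vs :: "'a list"
  assumes G: "pair_graph G"
    and connected: "\<And>u v. u \<in> pverts G \<Longrightarrow> v \<in> pverts G \<Longrightarrow> (u, v) \<in> (parcs G)\<^sup>*"
    and cyc: "cyclic_list G vs"
    and bridge: "\<And>x y R. (x, y) \<in> parcs G \<Longrightarrow> {x, y} \<notin> cycle_edges vs \<Longrightarrow> R \<subseteq> parcs G \<Longrightarrow>
       (x, y) \<notin> R \<Longrightarrow> (x, y) \<notin> R\<^sup>*"
begin

abbreviation "n \<equiv> length vs"

lemma arc_verts: "(u, v) \<in> parcs G \<Longrightarrow> u \<in> pverts G \<and> v \<in> pverts G"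
  using G unfolding pair_graph_def pair_digraph_def pair_fin_digraph_def pair_wf_digraph_def by force

lemma arc_sym: "(u, v) \<in> parcs G \<Longrightarrow> (v, u) \<in> parcs G"
  using pair_sym_digraph.pair_sym_arcs[of G] G
  by (auto simp: pair_graph_def pair_pseudo_graph_def symmetric_def sym_def)

lemma finite_verts: "finite (pverts G)"
  using G unfolding pair_graph_def pair_digraph_def pair_fin_digraph_def pair_fin_digraph_axioms_def by blast

lemma n3: "3 \<le> n" and distinct_vs: "distinct vs"
  using cyc by (auto simp: cyclic_list_def)

lemma Suc_mod_less: "Suc i mod n < n"
  using n3 by (intro mod_less_divisor) linarith

text \<open>The arcs of the cycle in the direction of the list.\<close>

definition fwd :: "('a \<times> 'a) set" where
  "fwd = (\<lambda>i. (vs ! i, vs ! (Suc i mod n))) ` {..<n}"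

lemma fwd_arcs: "fwd \<subseteq> parcs G"
  using cyc by (auto simp: fwd_def cyclic_list_def)

definition cyc_arcs :: "('a \<times> 'a) set" where
  "cyc_arcs = fwd \<union> fwd\<inverse>"

lemma cyc_arcs: "cyc_arcs \<subseteq> parcs G"
  using fwd_arcs arc_sym by (auto simp: cyc_arcs_def)

lemma cyc_arcs_iff: "(x, y) \<in> cyc_arcs \<longleftrightarrow> {x, y} \<in> cycle_edges vs"
  by (auto simp: cyc_arcs_def fwd_def cycle_edges_def doubleton_eq_iff)

lemma vs_verts: "set vs \<subseteq> pverts G"
  using fwd_arcs arc_verts by (force simp: fwd_def set_conv_nth)

lemma cyc_arcs_verts: "(x, y) \<in> cyc_arcs \<Longrightarrow> x \<in> set vs \<and> y \<in> set vs"
  using Suc_mod_less by (auto simp: cyc_arcs_def fwd_def)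

lemma cyc_connected: "v \<in> set vs \<Longrightarrow> (vs ! 0, v) \<in> cyc_arcs\<^sup>*"
proof -
  have "(vs ! 0, vs ! i) \<in> cyc_arcs\<^sup>*" if "i < n" for i
    using that
  proof (induction i)
    case (Suc i)
    then have "(vs ! i, vs ! (Suc i mod n)) \<in> fwd" unfolding fwd_def by (intro imageI) simp
    then have "(vs ! i, vs ! Suc i) \<in> cyc_arcs" using Suc.prems by (simp add: cyc_arcs_def)
    moreover have "(vs ! 0, vs ! i) \<in> cyc_arcs\<^sup>*" using Suc by simp
    ultimately show ?case by (rule rtrancl_into_rtrancl[rotated])
  qed simp
  then show "v \<in> set vs \<Longrightarrow> (vs ! 0, v) \<in> cyc_arcs\<^sup>*" by (auto simp: set_conv_nth)
qed

definition depth :: "'a \<Rightarrow> nat" where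
  "depth u = (LEAST k. \<exists>v\<in>set vs. (v, u) \<in> parcs G ^^ k)"

lemma depth_witness:
  assumes "u \<in> pverts G"
  shows "\<exists>v\<in>set vs. (v, u) \<in> parcs G ^^ depth u"
proof -
  have "vs ! 0 \<in> set vs" using n3 by (intro nth_mem) linarith
  then have "(vs ! 0, u) \<in> (parcs G)\<^sup>*" using connected vs_verts assms by blast
  then obtain k where "(vs ! 0, u) \<in> parcs G ^^ k" using rtrancl_imp_relpow by metis
  then have "\<exists>k. \<exists>v\<in>set vs. (v, u) \<in> parcs G ^^ k" using \<open>vs ! 0 \<in> set vs\<close> by (intro exI bexI)
  then show ?thesis unfolding depth_def by (rule LeastI_ex)
qed

lemma depth_le: "v \<in> set vs \<Longrightarrow> (v, u) \<in> parcs G ^^ k \<Longrightarrow> depth u \<le> k"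
  unfolding depth_def by (rule Least_le, rule bexI)

lemma depth_0_iff: "u \<in> pverts G \<Longrightarrow> depth u = 0 \<longleftrightarrow> u \<in> set vs"
  using depth_witness[of u] depth_le[of u u 0] by auto

lemma depth_arc: "(u, w) \<in> parcs G \<Longrightarrow> depth w \<le> Suc (depth u)"
  using depth_witness[of u] arc_verts[of u w] depth_le[of _ w "Suc (depth u)"] by auto

lemma depth_parent:
  assumes "u \<in> pverts G" "depth u = Suc k"
  obtains w where "(w, u) \<in> parcs G" "depth w = k"
proof -
  obtain v where v: "v \<in> set vs" "(v, u) \<in> parcs G ^^ Suc k" using depth_witness assms by metis
  then obtain w where w: "(v, w) \<in> parcs G ^^ k" "(w, u) \<in> parcs G" by auto
  have "depth w \<le> k" using depth_le v w by blast
  moreover have "Suc k \<le> Suc (depth w)" using depth_arc[OF w(2)] assms by simp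
  ultimately show thesis using that w by simp
qed

text \<open>The edges that suffice to walk from any vertex of depth at most \<open>k\<close> to the cycle and around it.
  They never join two vertices of the same positive depth and stay away from greater depths, so
  they give detours around any other edge inside a layer and around a second edge to a parent.\<close>

definition lower :: "nat \<Rightarrow> ('a \<times> 'a) set" where
  "lower k = cyc_arcs \<union> {(a, b) \<in> parcs G. depth a \<noteq> depth b \<and> depth a \<le> k \<and> depth b \<le> k}"

lemma lower_arcs: "lower k \<subseteq> parcs G"
  using cyc_arcs by (auto simp: lower_def)

lemma lower_connected:
  assumes "x \<in> pverts G" "y \<in> pverts G" "depth x \<le> k" "depth y \<le> k"
  shows "(x, y) \<in> (lower k)\<^sup>*"
proof -
  have from0: "(vs ! 0, u) \<in> (lower k)\<^sup>*" if "u \<in> pverts G" "depth u \<le> k" for u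
    using that
  proof (induction "depth u" arbitrary: u)
    case 0
    then have "(vs ! 0, u) \<in> cyc_arcs\<^sup>*" using depth_0_iff cyc_connected by metis
    then show ?case unfolding lower_def by (rule rtrancl_mono[THEN subsetD, rotated]) blast
  next
    case (Suc j)
    then obtain w where w: "(w, u) \<in> parcs G" "depth w = j" using depth_parent by metis
    then have "(vs ! 0, w) \<in> (lower k)\<^sup>*" using Suc arc_verts by simp
    moreover have "(w, u) \<in> lower k" using w Suc by (auto simp: lower_def)
    ultimately show ?case by (rule rtrancl_into_rtrancl)
  qed
  have "sym (lower k)" by (auto simp: lower_def cyc_arcs_def sym_def intro: arc_sym)
  then have "(x, vs ! 0) \<in> (lower k)\<^sup>*" using from0[of x] assms by (meson sym_rtrancl symD)
  then show ?thesis using from0[of y] assms by (meson rtrancl_trans)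
qed

text \<open>Both ends of an edge within one layer are joined by descending to the cycle and ascending again,
  which avoids the edge.\<close>

lemma arc_cases:
  assumes "(x, y) \<in> parcs G"
  shows "(x, y) \<in> cyc_arcs \<or> depth y = Suc (depth x) \<or> depth x = Suc (depth y)"
proof (rule ccontr)
  assume *: "\<not> ?thesis"
  then have "depth x = depth y" using depth_arc[OF assms] depth_arc[OF arc_sym[OF assms]] by linarith
  then have "(x, y) \<in> (lower (depth x))\<^sup>*" "(x, y) \<notin> lower (depth x)"
    using lower_connected arc_verts[OF assms] * by (auto simp: lower_def)
  then show False using bridge[OF assms _ lower_arcs] * cyc_arcs_iff by blast
qed

definition child :: "('a \<times> 'a) set" where
  "child = {(a, b) \<in> parcs G. depth b = Suc (depth a)}"

text \<open>If a vertex had two parents, the edge to the first could be bypassed through the second: the two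
  parents are joined without going beyond their own depth.\<close>

lemma child_unique:
  assumes "(x, u) \<in> child" "(y, u) \<in> child"
  shows "x = y"
proof (rule ccontr)
  assume "x \<noteq> y"
  define k where "k = depth x"
  have x: "(x, u) \<in> parcs G" "depth u = Suc k" and y: "(y, u) \<in> parcs G" "depth y = k"
    using assms by (auto simp: child_def k_def)
  let ?R = "insert (y, u) (lower k)"
  have "u \<notin> set vs" using x arc_verts depth_0_iff by fastforce
  then have nc: "(x, u) \<notin> cyc_arcs" using cyc_arcs_verts by blast
  then have "(x, u) \<notin> ?R" using \<open>x \<noteq> y\<close> x by (auto simp: lower_def)
  moreover have "(x, y) \<in> (lower k)\<^sup>*" using lower_connected x y arc_verts by (simp add: k_def)
  then have "(x, y) \<in> ?R\<^sup>*" by (rule rtrancl_mono[THEN subsetD, rotated]) blast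
  then have "(x, u) \<in> ?R\<^sup>*" by (rule rtrancl_into_rtrancl) blast
  ultimately show False using bridge[OF x(1), of ?R] nc lower_arcs[of k] y(1) cyc_arcs_iff by blast
qed

lemma child_rtrancl_depth: "(a, b) \<in> child\<^sup>* \<Longrightarrow> a = b \<or> depth a < depth b"
  by (induction rule: rtrancl_induct) (auto simp: child_def)

text \<open>Trees hanging from different vertices of the same depth are disjoint.\<close>

lemma child_rtrancl_unique:
  assumes "(a, w) \<in> child\<^sup>*" "(b, w) \<in> child\<^sup>*" "depth a = depth b"
  shows "a = b"
  using assms
proof (induction rule: rtrancl_induct)
  case base
  then show ?case using child_rtrancl_depth by fastforce
next
  case (step v w)
  have "b \<noteq> w" using child_rtrancl_depth[OF step(1)] step by (auto simp: child_def)
  then obtain v' where "(b, v') \<in> child\<^sup>*" "(v', w) \<in> child" using step(4) by (meson rtranclE)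
  then show ?case using step child_unique by metis
qed

definition desc :: "'a \<Rightarrow> 'a set" where
  "desc u = {w. (u, w) \<in> child\<^sup>*}"

lemma desc_unfold: "desc u = insert u (\<Union>c\<in>child `` {u}. desc c)"
  unfolding desc_def by (auto elim: converse_rtranclE intro: converse_rtrancl_into_rtrancl)

lemma self_desc: "u \<in> desc u"
  by (simp add: desc_def)

lemma desc_verts:
  assumes "u \<in> pverts G" shows "desc u \<subseteq> pverts G"
proof -
  have "w \<in> pverts G" if "(u, w) \<in> child\<^sup>*" for w
    using that assms by (induction rule: rtrancl_induct) (auto simp: child_def dest: arc_verts)
  then show ?thesis by (auto simp: desc_def)
qed

lemma desc_disjoint: "depth a = depth b \<Longrightarrow> w \<in> desc a \<Longrightarrow> w \<in> desc b \<Longrightarrow> a = b"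
  unfolding desc_def using child_rtrancl_unique by blast

lemma parent_notin_desc_child: "(u, c) \<in> child \<Longrightarrow> u \<notin> desc c"
  unfolding desc_def using child_rtrancl_depth[of c u] by (auto simp: child_def)

text \<open>\<open>\<phi>\<close> identifies the addresses of \<open>T\<close> with the descendants of \<open>u\<close>. The subtrees are listed by
  increasing size because the order of subtrees is irrelevant for a graph but matters for the
  datatype: sorting makes the trees $T(l_0,l_1,l_2)$ literally equal to their defining terms.\<close>

definition tree_at :: "'a \<Rightarrow> rtree \<Rightarrow> (nat list \<Rightarrow> 'a) \<Rightarrow> bool" where
  "tree_at u T \<phi> \<longleftrightarrow> \<phi> [] = u \<and> inj_on \<phi> (addrs T) \<and> \<phi> ` addrs T = desc u \<and>
     map_prod \<phi> \<phi> ` tree_arcs T = {(a, b) \<in> child. a \<in> desc u} \<and>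
     (\<forall>ts. T = Node ts \<longrightarrow> sorted (map (card \<circ> addrs) ts))"

text \<open>By induction on the number of descendants; the representations of the children are
  sorted by size and glued below \<open>u\<close>.\<close>

lemma tree_at_exists:
  assumes "u \<in> pverts G"
  shows "\<exists>T \<phi>. tree_at u T \<phi>"
  using assms
proof (induction "card (desc u)" arbitrary: u rule: less_induct)
  case less
  let ?C = "child `` {u}"
  have CV: "?C \<subseteq> pverts G" using arc_verts by (auto simp: child_def)
  have "\<exists>T \<phi>. tree_at c T \<phi>" if "c \<in> ?C" for c
  proof (rule less.hyps)
    have "desc c \<subseteq> desc u" using that by (subst (2) desc_unfold) blast
    moreover have "u \<in> desc u" "u \<notin> desc c" using parent_notin_desc_child self_desc that by auto
    ultimately have "desc c \<subset> desc u" by blast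
    then show "card (desc c) < card (desc u)"
      using desc_verts[OF less.prems] finite_verts by (meson finite_subset psubset_card_mono)
    show "c \<in> pverts G" using that CV by blast
  qed
  then obtain T \<phi> where T: "\<And>c. c \<in> ?C \<Longrightarrow> tree_at c (T c) (\<phi> c)" by metis
  obtain cs0 where cs0: "set cs0 = ?C" "distinct cs0"
    using finite_distinct_list CV finite_verts by (metis finite_subset)
  define cs where "cs = sort_key (card \<circ> addrs \<circ> T) cs0"
  have cs: "set cs = ?C" "distinct cs" "sorted (map (card \<circ> addrs \<circ> T) cs)"
    by (auto simp: cs_def cs0)
  have csC: "cs ! i \<in> ?C" if "i < length cs" for i using cs that nth_mem by blast
  have depth_eq: "depth (cs ! i) = depth (cs ! j)" if "i < length cs" "j < length cs" for i j
    using csC[OF that(1)] csC[OF that(2)] by (simp add: child_def)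
  define ts where "ts = map T cs"
  have len: "length ts = length cs" by (simp add: ts_def)
  define \<psi> where "\<psi> p = (case p of [] \<Rightarrow> u | i # q \<Rightarrow> \<phi> (cs ! i) q)" for p
  have \<psi>_simps: "\<psi> [] = u" "\<psi> (i # q) = \<phi> (cs ! i) q" for i q by (simp_all add: \<psi>_def)
  have TC: "\<phi> (cs ! i) [] = cs ! i" "inj_on (\<phi> (cs ! i)) (addrs (ts ! i))"
    "\<phi> (cs ! i) ` addrs (ts ! i) = desc (cs ! i)"
    "map_prod (\<phi> (cs ! i)) (\<phi> (cs ! i)) ` tree_arcs (ts ! i) = {(a, b) \<in> child. a \<in> desc (cs ! i)}"
    if "i < length cs" for i
    using T[OF csC[OF that]] that by (auto simp: tree_at_def ts_def)
  have "inj_on \<psi> (addrs (Node ts))"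
  proof (rule inj_onI)
    fix p q assume p: "p \<in> addrs (Node ts)" and q: "q \<in> addrs (Node ts)" and eq: "\<psi> p = \<psi> q"
    have not_root: "\<psi> (i # r) \<noteq> u" if "i # r \<in> addrs (Node ts)" for i r
    proof -
      have "i < length cs" "r \<in> addrs (ts ! i)" using that by (auto simp: addrs_Node len)
      then have "\<psi> (i # r) \<in> desc (cs ! i)" using TC(3) by (auto simp: \<psi>_simps)
      then show ?thesis using parent_notin_desc_child csC[OF \<open>i < length cs\<close>] by auto
    qed
    show "p = q"
    proof (cases p)
      case Nil
      then show ?thesis using eq q not_root by (cases q) (auto simp: \<psi>_simps)
    next
      case p': (Cons i p')
      show ?thesis
      proof (cases q)
        case Nil
        then show ?thesis using eq p not_root p' by (auto simp: \<psi>_simps)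
      next
        case q': (Cons j q')
        have i: "i < length cs" "p' \<in> addrs (ts ! i)" and j: "j < length cs" "q' \<in> addrs (ts ! j)"
          using p q p' q' by (auto simp: addrs_Node len)
        have "\<psi> p \<in> desc (cs ! i)" "\<psi> q \<in> desc (cs ! j)"
          using TC(3) i j by (auto simp: p' q' \<psi>_simps)
        then have "cs ! i = cs ! j" using eq desc_disjoint depth_eq[OF i(1) j(1)] by metis
        then have "i = j" using cs(2) i j by (simp add: nth_eq_iff_index_eq)
        then have "p' = q'" using eq TC(2)[OF i(1)] i j by (auto simp: p' q' \<psi>_simps inj_on_def)
        then show ?thesis using \<open>i = j\<close> by (simp add: p' q')
      qed
    qed
  qed
  moreover have "\<psi> ` addrs (Node ts) = desc u"
  proof -
    have "\<psi> ` addrs (Node ts) = insert u (\<Union>i<length cs. \<phi> (cs ! i) ` addrs (ts ! i))"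
      by (simp add: addrs_Node image_UN image_image \<psi>_simps len)
    also have "\<dots> = insert u (\<Union>i<length cs. desc (cs ! i))" using TC(3) by simp
    also have "(\<Union>i<length cs. desc (cs ! i)) = (\<Union>c\<in>set cs. desc c)"
      by (auto simp: set_conv_nth)
    finally show ?thesis using desc_unfold[of u] cs(1) by simp
  qed
  moreover have "map_prod \<psi> \<psi> ` tree_arcs (Node ts) = {(a, b) \<in> child. a \<in> desc u}"
  proof -
    have "map_prod \<psi> \<psi> ` tree_arcs (Node ts) = (\<lambda>j. (u, \<phi> (cs ! j) [])) ` {..<length cs} \<union>
        (\<Union>i<length cs. map_prod (\<phi> (cs ! i)) (\<phi> (cs ! i)) ` tree_arcs (ts ! i))"
      by (simp add: tree_arcs_Node image_Un image_UN image_image map_prod_def case_prod_unfold \<psi>_simps len)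
    also have "\<dots> = (\<lambda>j. (u, cs ! j)) ` {..<length cs} \<union> (\<Union>i<length cs. {(a, b) \<in> child. a \<in> desc (cs ! i)})"
      using TC(1,4) by simp
    also have "(\<lambda>j. (u, cs ! j)) ` {..<length cs} = Pair u ` set cs" by (auto simp: set_conv_nth)
    also have "(\<Union>i<length cs. {(a, b) \<in> child. a \<in> desc (cs ! i)}) = {(a, b) \<in> child. a \<in> (\<Union>c\<in>set cs. desc c)}"
      by (auto simp: set_conv_nth)
    finally show ?thesis unfolding cs(1) by (subst desc_unfold) auto
  qed
  moreover have "sorted (map (card \<circ> addrs) ts)" using cs(3) by (simp add: ts_def o_assoc)
  ultimately have "tree_at u (Node ts) \<psi>" by (simp add: tree_at_def \<psi>_simps)
  then show ?case by blast
qed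

lemma verts_eq_Union_desc: "pverts G = (\<Union>v\<in>set vs. desc v)"
proof
  show "(\<Union>v\<in>set vs. desc v) \<subseteq> pverts G" using desc_verts vs_verts by blast
  have "\<exists>v\<in>set vs. (v, u) \<in> child\<^sup>*" if "u \<in> pverts G" for u
    using that
  proof (induction "depth u" arbitrary: u)
    case 0
    then show ?case using depth_0_iff by force
  next
    case (Suc k)
    then obtain w where w: "(w, u) \<in> parcs G" "depth w = k" using depth_parent by metis
    then have "(w, u) \<in> child" using Suc by (simp add: child_def)
    moreover have "\<exists>v\<in>set vs. (v, w) \<in> child\<^sup>*" using Suc w arc_verts by simp
    ultimately show ?case by (meson rtrancl_into_rtrancl)
  qed
  then show "pverts G \<subseteq> (\<Union>v\<in>set vs. desc v)" by (auto simp: desc_def)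
qed

lemma arcs_eq: "parcs G = (fwd \<union> child) \<union> (fwd \<union> child)\<inverse>"
proof
  show "parcs G \<subseteq> (fwd \<union> child) \<union> (fwd \<union> child)\<inverse>"
    using arc_cases arc_sym by (fastforce simp: cyc_arcs_def child_def)
  show "(fwd \<union> child) \<union> (fwd \<union> child)\<inverse> \<subseteq> parcs G"
    using fwd_arcs arc_sym by (auto simp: child_def)
qed

theorem iso_C_graph:
  obtains Ts where "length Ts = n" "G \<simeq>\<^sub>g C_graph Ts"
    "\<And>ts. Node ts \<in> set Ts \<Longrightarrow> sorted (map (card \<circ> addrs) ts)"
proof -
  have "\<forall>v\<in>set vs. \<exists>T \<phi>. tree_at v T \<phi>" using tree_at_exists vs_verts by blast
  then obtain T \<phi> where T: "\<And>v. v \<in> set vs \<Longrightarrow> tree_at v (T v) (\<phi> v)" by metis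
  define Ts where "Ts = map T vs"
  define \<Phi> where "\<Phi> = (\<lambda>(i, p). \<phi> (vs ! i) p)"
  have TC: "\<phi> (vs ! i) [] = vs ! i" "inj_on (\<phi> (vs ! i)) (addrs (Ts ! i))"
    "\<phi> (vs ! i) ` addrs (Ts ! i) = desc (vs ! i)"
    "map_prod (\<phi> (vs ! i)) (\<phi> (vs ! i)) ` tree_arcs (Ts ! i) = {(a, b) \<in> child. a \<in> desc (vs ! i)}"
    if "i < n" for i
    using T[OF nth_mem[OF that]] that by (auto simp: tree_at_def Ts_def)
  have len: "length Ts = n" by (simp add: Ts_def)
  have "inj_on \<Phi> (pverts (C_graph Ts))"
  proof (rule inj_onI, clarify)
    fix i p j q
    assume "(i, p) \<in> pverts (C_graph Ts)" "(j, q) \<in> pverts (C_graph Ts)" and eq: "\<Phi> (i, p) = \<Phi> (j, q)"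
    then have i: "i < n" "p \<in> addrs (Ts ! i)" and j: "j < n" "q \<in> addrs (Ts ! j)"
      by (auto simp: pverts_C_graph len)
    have "\<Phi> (i, p) \<in> desc (vs ! i)" "\<Phi> (j, q) \<in> desc (vs ! j)" using TC(3) i j by (auto simp: \<Phi>_def)
    moreover have "depth (vs ! i) = depth (vs ! j)"
      using depth_0_iff vs_verts i j by (metis nth_mem subsetD)
    ultimately have "vs ! i = vs ! j" using eq desc_disjoint by metis
    then have "i = j" using distinct_vs i j by (simp add: nth_eq_iff_index_eq)
    then show "i = j \<and> p = q" using eq TC(2)[OF i(1)] i j by (auto simp: \<Phi>_def inj_on_def)
  qed
  moreover have "\<Phi> ` pverts (C_graph Ts) = pverts G"
  proof -
    have "\<Phi> ` pverts (C_graph Ts) = (\<Union>i<n. \<phi> (vs ! i) ` addrs (Ts ! i))"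
      by (force simp: pverts_C_graph \<Phi>_def len)
    also have "\<dots> = (\<Union>i<n. desc (vs ! i))" using TC(3) by simp
    also have "\<dots> = pverts G" unfolding verts_eq_Union_desc by (auto simp: set_conv_nth)
    finally show ?thesis .
  qed
  moreover have "map_prod \<Phi> \<Phi> ` C_arcs Ts = fwd \<union> child"
  proof -
    have "map_prod \<Phi> \<Phi> ` C_arcs Ts = (\<lambda>i. (\<phi> (vs ! i) [], \<phi> (vs ! (Suc i mod n)) [])) ` {..<n} \<union>
       (\<Union>i<n. map_prod (\<phi> (vs ! i)) (\<phi> (vs ! i)) ` tree_arcs (Ts ! i))"
      by (simp add: C_arcs_def image_Un image_UN image_image map_prod_def case_prod_unfold \<Phi>_def len)
    also have "\<dots> = fwd \<union> (\<Union>i<n. {(a, b) \<in> child. a \<in> desc (vs ! i)})"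
      using TC(1,4) Suc_mod_less by (simp add: fwd_def)
    also have "(\<Union>i<n. {(a, b) \<in> child. a \<in> desc (vs ! i)}) = {(a, b) \<in> child. a \<in> pverts G}"
      unfolding verts_eq_Union_desc by (auto simp: set_conv_nth)
    also have "\<dots> = child" using arc_verts by (auto simp: child_def)
    finally show ?thesis .
  qed
  then have "parcs G = map_prod \<Phi> \<Phi> ` parcs (C_graph Ts)"
    unfolding parcs_C_graph image_Un map_prod_image_converse arcs_eq by (simp only:)
  ultimately have "C_graph Ts \<simeq>\<^sub>g G"
    by (intro graph_isoI[OF parcs_C_graph_subset, of \<Phi>]) (auto simp: bij_betw_def)
  then have "G \<simeq>\<^sub>g C_graph Ts" by (rule graph_iso_sym[OF parcs_C_graph_subset])
  moreover have "sorted (map (card \<circ> addrs) ts)" if ts: "Node ts \<in> set Ts" for ts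
  proof -
    obtain v where "v \<in> set vs" "Node ts = T v" using ts by (auto simp: Ts_def)
    then show ?thesis using T[of v] by (auto simp: tree_at_def)
  qed
  ultimately show thesis using len that by blast
qed

end

lemma unicyclic_arcs:
  assumes "unicyclic G"
  shows "(u, v) \<in> parcs G \<Longrightarrow> u \<in> pverts G \<and> v \<in> pverts G"
    and "(u, v) \<in> parcs G \<Longrightarrow> (v, u) \<in> parcs G"
    and "u \<in> pverts G \<Longrightarrow> v \<in> pverts G \<Longrightarrow> (u, v) \<in> (parcs G)\<^sup>*"
proof -
  have G: "pair_graph G" and con: "Digraph_Component.connected (with_proj G)"
    using assms by (auto simp: unicyclic_def)
  show "u \<in> pverts G \<and> v \<in> pverts G" if "(u, v) \<in> parcs G"
    using G that unfolding pair_graph_def pair_digraph_def pair_fin_digraph_def pair_wf_digraph_def by force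
  have sym: "(v, u) \<in> parcs G" if "(u, v) \<in> parcs G" for u v
    using pair_sym_digraph.pair_sym_arcs[of G] G that
    by (auto simp: pair_graph_def pair_pseudo_graph_def symmetric_def sym_def)
  then show "(u, v) \<in> parcs G \<Longrightarrow> (v, u) \<in> parcs G" .
  have ms: "parcs (mk_symmetric (with_proj G)) = parcs G" "pverts (mk_symmetric (with_proj G)) = pverts G"
    using sym by (auto simp: mk_symmetric_def)
  assume "u \<in> pverts G" "v \<in> pverts G"
  then have "(u, v) \<in> rtrancl_on (pverts G) (parcs G)"
    using con by (simp add: connected_def strongly_connected_def reachable_def ms)
  then show "(u, v) \<in> (parcs G)\<^sup>*"
    by (induction rule: rtrancl_on_induct) auto
qed

text \<open>The trees at the vertices of the unique cycle partition the vertex set, and every edge either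
  belongs to the cycle or joins a parent to a child.\<close>

theorem unicyclic_iso_C_graph:
  assumes U: "unicyclic G"
  obtains Ts where "length Ts = unicyclic_girth G" "G \<simeq>\<^sub>g C_graph Ts"
    "\<forall>ts. Node ts \<in> set Ts \<longrightarrow> sorted (map (card \<circ> addrs) ts)"
proof -
  have G: "pair_graph G" and ex1: "\<exists>!C. C \<in> cycles G" using U by (auto simp: unicyclic_def)
  define C where "C = (THE C. C \<in> cycles G)"
  have C: "C \<in> cycles G" unfolding C_def using ex1 by (rule theI')
  then obtain p where p: "pre_digraph.cycle (with_proj G) p" "3 \<le> length p"
    and Cp: "C = (\<lambda>(u, v). {u, v}) ` set p" by (auto simp: cycles_def)
  define vs where "vs = map fst p"
  have cyc: "cyclic_list G vs" and CE: "C = cycle_edges vs"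
    using cycle_imp_cyclic_list[OF p] by (simp_all add: Cp vs_def)
  have "unicyclic_girth G = length vs"
    using card_cycle_edges[of vs] cyc unfolding unicyclic_girth_def C_def[symmetric] CE
    by (simp add: cyclic_list_def)
  moreover have "unicyclic_at G vs"
  proof (rule unicyclic_at.intro)
    show "pair_graph G" by (rule G)
    show "cyclic_list G vs" by (rule cyc)
    show "(x, y) \<notin> R\<^sup>*" if "(x, y) \<in> parcs G" "{x, y} \<notin> cycle_edges vs" "R \<subseteq> parcs G" "(x, y) \<notin> R" for x y R
    proof
      assume "(x, y) \<in> R\<^sup>*"
      from reachable_avoiding_edge_imp_cycle[OF G that(1,3,4) this]
      obtain C' where C': "C' \<in> cycles G" "{x, y} \<in> C'" by (elim bexE)
      then have "C' = C" using ex1 C by (elim ex1E) metis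
      then show False using C'(2) that(2) CE by simp
    qed
    show "(u, v) \<in> (parcs G)\<^sup>*" if "u \<in> pverts G" "v \<in> pverts G" for u v
      using unicyclic_arcs(3)[OF U that] .
  qed
  ultimately show thesis using unicyclic_at.iso_C_graph[of G vs] that by metis
qed

section \<open>The energy of $C_g(T_1,\dots,T_g)$\<close>

primrec tree_energy :: "rtree \<Rightarrow> (nat list \<Rightarrow> real) \<Rightarrow> real" where
  "tree_energy (Node ts) = (\<lambda>h. \<Sum>i<length ts.
     edge_energy (h []) (h [i]) + (map tree_energy ts ! i) (\<lambda>p. h (i # p)))"

declare tree_energy.simps [simp del]

text \<open>The energy of a branch together with the edge that attaches it to a vertex with value \<open>x\<close>.\<close>

definition branch_energy :: "real \<Rightarrow> rtree \<Rightarrow> (nat list \<Rightarrow> real) \<Rightarrow> real" where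
  "branch_energy x B k = edge_energy x (k []) + tree_energy B k"

lemma tree_energy_Node:
  "tree_energy (Node ts) h = (\<Sum>i<length ts. branch_energy (h []) (ts ! i) (\<lambda>p. h (i # p)))"
  by (simp add: tree_energy.simps branch_energy_def)

lemma edge_energy_commute: "edge_energy x y = edge_energy y x"
  by (simp add: edge_energy_def)

lemma finite_tree_arcs [simp]: "finite (tree_arcs T)"
  using tree_arcs_subset by (rule finite_subset) simp

lemma sum_tree_arcs: "(\<Sum>(p, q)\<in>tree_arcs T. edge_energy (h p) (h q)) = tree_energy T h"
proof (induction T arbitrary: h)
  case (Node ts)
  let ?e = "\<lambda>(p, q). edge_energy (h p) (h q)"
  let ?A = "(\<lambda>j. ([], [j])) ` {..<length ts}" and ?B = "\<lambda>i. map_prod (Cons i) (Cons i) ` tree_arcs (ts ! i)"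
  have "sum ?e (tree_arcs (Node ts)) = sum ?e ?A + sum ?e (\<Union>i<length ts. ?B i)"
    unfolding tree_arcs_Node by (intro sum.union_disjoint) auto
  also have "sum ?e ?A = (\<Sum>i<length ts. edge_energy (h []) (h [i]))"
    by (subst sum.reindex) (auto simp: inj_on_def)
  also have "sum ?e (\<Union>i<length ts. ?B i) = (\<Sum>i<length ts. sum ?e (?B i))"
    by (intro sum.UNION_disjoint) auto
  also have "\<dots> = (\<Sum>i<length ts. tree_energy (ts ! i) (\<lambda>p. h (i # p)))"
  proof (intro sum.cong refl)
    fix i assume "i \<in> {..<length ts}"
    then have IH: "(\<Sum>(p, q)\<in>tree_arcs (ts ! i). edge_energy (h (i # p)) (h (i # q))) = tree_energy (ts ! i) (\<lambda>p. h (i # p))"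
      using Node.IH[of "ts ! i" "\<lambda>p. h (i # p)"] by simp
    have "inj_on (map_prod (Cons i) (Cons i)) (tree_arcs (ts ! i))" by (auto simp: inj_on_def)
    then have "sum ?e (?B i) = (\<Sum>(p, q)\<in>tree_arcs (ts ! i). edge_energy (h (i # p)) (h (i # q)))"
      by (subst sum.reindex) (auto simp: o_def case_prod_unfold)
    then show "sum ?e (?B i) = tree_energy (ts ! i) (\<lambda>p. h (i # p))" using IH by simp
  qed
  finally show ?case by (simp add: tree_energy_Node branch_energy_def sum.distrib)
qed

lemma finite_C_arcs [simp]: "finite (C_arcs Ts)"
  by (simp add: C_arcs_def)

lemma energy_C_graph:
  assumes n: "3 \<le> length Ts"
  shows "energy (C_graph Ts) h = 2 * (\<Sum>i<length Ts. edge_energy (h (i, [])) (h (Suc i mod length Ts, []))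
     + tree_energy (Ts ! i) (\<lambda>p. h (i, p)))"
proof -
  let ?n = "length Ts"
  let ?e = "\<lambda>(u, v). edge_energy (h u) (h v)"
  let ?A = "(\<lambda>i. ((i, []), (Suc i mod ?n, []))) ` {..<?n} :: ((nat \<times> nat list) \<times> (nat \<times> nat list)) set"
  let ?B = "\<lambda>i. map_prod (Pair i) (Pair i) ` tree_arcs (Ts ! i)"
  have "i \<noteq> Suc (Suc i mod ?n) mod ?n" if "i < ?n" for i
    using that n by (auto simp: mod_Suc)
  then have disj: "C_arcs Ts \<inter> (C_arcs Ts)\<inverse> = {}"
    by (auto simp: C_arcs_def tree_arcs_def)
  have "energy (C_graph Ts) h = sum ?e (C_arcs Ts) + sum ?e ((C_arcs Ts)\<inverse>)"
    unfolding energy_def parcs_C_graph using disj by (intro sum.union_disjoint) auto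
  also have "sum ?e ((C_arcs Ts)\<inverse>) = sum ?e (C_arcs Ts)"
    by (rule sum.reindex_bij_witness[of _ prod.swap prod.swap]) (auto simp: edge_energy_commute)
  also have "sum ?e (C_arcs Ts) = sum ?e ?A + sum ?e (\<Union>i<?n. ?B i)"
  proof -
    have "?A \<inter> (\<Union>i<?n. ?B i) = {}" by (auto simp: tree_arcs_def)
    then show ?thesis unfolding C_arcs_def by (intro sum.union_disjoint) simp_all
  qed
  also have "sum ?e ?A = (\<Sum>i<?n. edge_energy (h (i, [])) (h (Suc i mod ?n, [])))"
    by (subst sum.reindex) (auto simp: inj_on_def)
  also have "sum ?e (\<Union>i<?n. ?B i) = (\<Sum>i<?n. sum ?e (?B i))"
    by (intro sum.UNION_disjoint) auto
  also have "\<dots> = (\<Sum>i<?n. tree_energy (Ts ! i) (\<lambda>p. h (i, p)))"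
  proof (intro sum.cong refl)
    fix i
    have "inj_on (map_prod (Pair i) (Pair i)) (tree_arcs (Ts ! i))" by (auto simp: inj_on_def)
    then have "sum ?e (?B i) = (\<Sum>(p, q)\<in>tree_arcs (Ts ! i). edge_energy (h (i, p)) (h (i, q)))"
      by (subst sum.reindex) (auto simp: o_def case_prod_unfold)
    then show "sum ?e (?B i) = tree_energy (Ts ! i) (\<lambda>p. h (i, p))"
      using sum_tree_arcs[of "\<lambda>p. h (i, p)"] by simp
  qed
  finally show ?thesis by (simp add: sum.distrib)
qed

lemma energy_C5:
  "energy (C_graph [T0, T1, T2, T3, T4]) h =
     4 * ((h (0, []))\<^sup>2 + (h (1, []))\<^sup>2 + (h (2, []))\<^sup>2 + (h (3, []))\<^sup>2 + (h (4, []))\<^sup>2)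
     - 2 * sqrt 6 * (h (0, []) * h (1, []) + h (1, []) * h (2, []) + h (2, []) * h (3, [])
         + h (3, []) * h (4, []) + h (4, []) * h (0, []))
     + 2 * (tree_energy T0 (\<lambda>p. h (0, p)) + tree_energy T1 (\<lambda>p. h (1, p)) + tree_energy T2 (\<lambda>p. h (2, p))
         + tree_energy T3 (\<lambda>p. h (3, p)) + tree_energy T4 (\<lambda>p. h (4, p)))"
proof -
  have L: "{..<length [T0, T1, T2, T3, T4]} = {0, 1, 2, 3, 4}" by auto
  show ?thesis
    unfolding energy_C_graph[of "[T0, T1, T2, T3, T4]", simplified L, simplified]
    by (simp add: edge_energy_def numeral_2_eq_2 algebra_simps)
qed

lemma energy_iso:
  assumes "inj_on \<phi> (pverts G)" "parcs G \<subseteq> pverts G \<times> pverts G" "parcs H = map_prod \<phi> \<phi> ` parcs G"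
  shows "energy H h = energy G (h \<circ> \<phi>)"
proof -
  have "inj_on (map_prod \<phi> \<phi>) (parcs G)"
    using assms by (intro inj_on_subset[OF map_prod_inj_on])
  then show ?thesis
    unfolding energy_def assms(3) by (subst sum.reindex) (auto simp: o_def case_prod_unfold)
qed

lemma energy_cong:
  assumes "parcs G \<subseteq> pverts G \<times> pverts G" "\<And>v. v \<in> pverts G \<Longrightarrow> f v = g v"
  shows "energy G f = energy G g"
  unfolding energy_def using assms by (intro sum.cong) auto

section \<open>Planes and hyperplanes on which the energy has a sign\<close>

definition negative_plane :: "'a pair_pre_digraph \<Rightarrow> bool" where
  "negative_plane G \<longleftrightarrow>
     (\<exists>f g. \<forall>\<alpha> \<beta>. (\<alpha>, \<beta>) \<noteq> (0, 0) \<longrightarrow> energy G (\<lambda>v. \<alpha> * f v + \<beta> * g v) < 0)"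

definition null_plane :: "'a pair_pre_digraph \<Rightarrow> bool" where
  "null_plane G \<longleftrightarrow>
     (\<exists>f g. \<forall>\<alpha> \<beta>. (\<alpha>, \<beta>) \<noteq> (0, 0) \<longrightarrow>
        energy G (\<lambda>v. \<alpha> * f v + \<beta> * g v) \<le> 0 \<and> (\<exists>v\<in>pverts G. \<alpha> * f v + \<beta> * g v \<noteq> 0))"

definition nonneg_hyperplane :: "'a pair_pre_digraph \<Rightarrow> bool" where
  "nonneg_hyperplane G \<longleftrightarrow>
     (\<exists>w. \<forall>h. (\<Sum>v\<in>pverts G. w v * h v) = 0 \<longrightarrow> 0 \<le> energy G h)"

definition positive_hyperplane :: "'a pair_pre_digraph \<Rightarrow> bool" where
  "positive_hyperplane G \<longleftrightarrow>
     (\<exists>w. \<forall>h. (\<Sum>v\<in>pverts G. w v * h v) = 0 \<longrightarrow> (\<exists>v\<in>pverts G. h v \<noteq> 0) \<longrightarrow> 0 < energy G h)"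

text \<open>Vectors and functionals are transported along the vertex bijection, under which the energy is
  invariant.\<close>

lemma planes_iso:
  assumes G: "parcs G \<subseteq> pverts G \<times> pverts G" and iso: "G \<simeq>\<^sub>g H"
  shows "negative_plane H \<Longrightarrow> negative_plane G" and "null_plane H \<Longrightarrow> null_plane G"
    and "nonneg_hyperplane H \<Longrightarrow> nonneg_hyperplane G"
    and "positive_hyperplane H \<Longrightarrow> positive_hyperplane G"
proof -
  obtain \<phi> where bij: "bij_betw \<phi> (pverts G) (pverts H)" and arcs: "parcs H = map_prod \<phi> \<phi> ` parcs G"
    using G iso by (rule graph_isoE)
  have inj: "inj_on \<phi> (pverts G)" and im: "\<phi> ` pverts G = pverts H" using bij by (auto simp: bij_betw_def)
  note E = energy_iso[OF inj G arcs]
  show "negative_plane G" if "negative_plane H"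
  proof -
    from that obtain f g where
      fg: "\<And>\<alpha> \<beta>. (\<alpha>, \<beta>) \<noteq> (0, 0) \<Longrightarrow> energy H (\<lambda>v. \<alpha> * f v + \<beta> * g v) < 0"
      unfolding negative_plane_def by metis
    show ?thesis unfolding negative_plane_def
      by (intro exI[of _ "\<lambda>v. f (\<phi> v)"] exI[of _ "\<lambda>v. g (\<phi> v)"] allI impI)
        (drule fg, simp add: E o_def)
  qed
  show "null_plane G" if "null_plane H"
  proof -
    from that obtain f g where
      fg: "\<And>\<alpha> \<beta>. (\<alpha>, \<beta>) \<noteq> (0, 0) \<Longrightarrow> energy H (\<lambda>v. \<alpha> * f v + \<beta> * g v) \<le> 0 \<and>
         (\<exists>v\<in>pverts H. \<alpha> * f v + \<beta> * g v \<noteq> 0)"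
      unfolding null_plane_def by metis
    show ?thesis unfolding null_plane_def
      by (intro exI[of _ "\<lambda>v. f (\<phi> v)"] exI[of _ "\<lambda>v. g (\<phi> v)"] allI impI)
        (drule fg, simp add: E o_def flip: im)
  qed
  define \<psi> where "\<psi> = the_inv_into (pverts G) \<phi>"
  have \<psi>: "\<psi> (\<phi> v) = v" if "v \<in> pverts G" for v
    using inj that by (simp add: \<psi>_def the_inv_into_f_f)
  have EG: "energy H (h \<circ> \<psi>) = energy G h" for h
    unfolding E using G by (rule energy_cong) (simp add: \<psi>)
  have S: "(\<Sum>v\<in>pverts H. w v * (h \<circ> \<psi>) v) = (\<Sum>v\<in>pverts G. w (\<phi> v) * h v)" for w h
    unfolding im[symmetric] using inj by (subst sum.reindex) (auto simp: \<psi>)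
  show "nonneg_hyperplane G" if "nonneg_hyperplane H"
  proof -
    from that obtain w where w: "\<And>h. (\<Sum>v\<in>pverts H. w v * h v) = 0 \<Longrightarrow> 0 \<le> energy H h"
      unfolding nonneg_hyperplane_def by metis
    have "0 \<le> energy G h" if "(\<Sum>v\<in>pverts G. w (\<phi> v) * h v) = 0" for h
      using w[of "h \<circ> \<psi>"] that unfolding S EG by simp
    then show ?thesis unfolding nonneg_hyperplane_def by (intro exI[of _ "\<lambda>v. w (\<phi> v)"] allI impI)
  qed
  show "positive_hyperplane G" if "positive_hyperplane H"
  proof -
    from that obtain w where
      w: "\<And>h. (\<Sum>v\<in>pverts H. w v * h v) = 0 \<Longrightarrow> \<exists>v\<in>pverts H. h v \<noteq> 0 \<Longrightarrow> 0 < energy H h"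
      unfolding positive_hyperplane_def by metis
    have "0 < energy G h" if "(\<Sum>v\<in>pverts G. w (\<phi> v) * h v) = 0" "v \<in> pverts G" "h v \<noteq> 0" for h v
    proof -
      have "\<exists>v\<in>pverts H. (h \<circ> \<psi>) v \<noteq> 0"
        using that \<psi> im by (intro bexI[of _ "\<phi> v"]) auto
      then show ?thesis using w[of "h \<circ> \<psi>"] that(1) unfolding S EG by simp
    qed
    then show ?thesis unfolding positive_hyperplane_def
      by (intro exI[of _ "\<lambda>v. w (\<phi> v)"] allI impI) (elim bexE)
  qed
qed

text \<open>The hyperplanes used below are kernels of functionals that involve only two vertices.\<close>

lemma sum_two_point:
  fixes a b :: real
  assumes "finite V" "u \<in> V" "v \<in> V"
  shows "(\<Sum>x\<in>V. ((if x = u then a else 0) + (if x = v then b else 0)) * h x) = a * h u + b * h v"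
  using assms by (simp add: distrib_right sum.distrib if_distrib[of "\<lambda>y. y * _"] cong: if_cong)

lemma nonneg_hyperplane_two_point:
  assumes "finite (pverts G)" "u \<in> pverts G" "v \<in> pverts G"
    and "\<And>h. a * h u + b * h v = 0 \<Longrightarrow> 0 \<le> energy G h"
  shows "nonneg_hyperplane G"
  unfolding nonneg_hyperplane_def
  by (intro exI[of _ "\<lambda>x. (if x = u then a else 0) + (if x = v then b else 0)"])
    (simp add: sum_two_point[OF assms(1-3)] assms(4))

lemma positive_hyperplane_two_point:
  assumes "finite (pverts G)" "u \<in> pverts G" "v \<in> pverts G"
    and "\<And>h x. a * h u + b * h v = 0 \<Longrightarrow> x \<in> pverts G \<Longrightarrow> h x \<noteq> 0 \<Longrightarrow> 0 < energy G h"
  shows "positive_hyperplane G"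
  unfolding positive_hyperplane_def
  by (intro exI[of _ "\<lambda>x. (if x = u then a else 0) + (if x = v then b else 0)"])
    (auto simp: sum_two_point[OF assms(1-3)] intro: assms(4))

section \<open>Branches with at most three vertices\<close>

lemma sqrt6_mult: "sqrt 6 * sqrt 6 = (6 :: real)" "sqrt 6 * (sqrt 6 * x) = 6 * (x :: real)"
  by (simp_all flip: mult.assoc)

lemma sqrt6_bounds: "2449489 / 1000000 < sqrt 6" "sqrt 6 < 244949 / 100000"
proof -
  show "2449489 / 1000000 < sqrt 6" by (rule real_less_rsqrt) (simp add: power2_eq_square)
  show "sqrt 6 < 244949 / 100000" by (rule real_less_lsqrt) (simp_all add: power2_eq_square)
qed

lemma addrs_nonempty [simp]: "addrs T \<noteq> {}"
  using Nil_in_addrs by blast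

lemma card_addrs_pos: "0 < card (addrs T)"
  by (simp add: card_gt_0_iff)

lemma sum_card_addrs_eq_0_iff: "(\<Sum>i<length ts. card (addrs (ts ! i))) = 0 \<longleftrightarrow> ts = []"
  by auto

lemma card_addrs_Node: "card (addrs (Node ts)) = Suc (\<Sum>i<length ts. card (addrs (ts ! i)))"
proof -
  have "card (\<Union>i<length ts. Cons i ` addrs (ts ! i)) = (\<Sum>i<length ts. card (Cons i ` addrs (ts ! i)))"
    by (intro card_UN_disjoint) auto
  also have "\<dots> = (\<Sum>i<length ts. card (addrs (ts ! i)))"
    by (intro sum.cong refl card_image) (auto simp: inj_on_def)
  finally show ?thesis by (simp add: addrs_Node card_insert_if image_iff)
qed

lemma card_addrs_K1: "card (addrs K1) = 1"
  by (simp add: K1_def card_addrs_Node)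

lemma K1_iff: "T = K1 \<longleftrightarrow> card (addrs T) = 1"
proof
  assume "card (addrs T) = 1"
  obtain ts where T: "T = Node ts" by (cases T)
  with \<open>card (addrs T) = 1\<close> have "\<forall>i<length ts. card (addrs (ts ! i)) = 0" by (simp add: card_addrs_Node)
  then have "ts = []" using card_addrs_pos by (metis length_greater_0_conv less_numeral_extra(3))
  then show "T = K1" by (simp add: T K1_def)
qed (simp add: card_addrs_K1)

text \<open>Rooted trees as they occur as branches: paths rooted at an end, and the star with two leaves
  rooted at its center.\<close>

definition P2 :: rtree where "P2 = Node [K1]"
definition P3 :: rtree where "P3 = Node [P2]"
definition K12 :: rtree where "K12 = Node [K1, K1]"

lemma card_addrs_P2: "card (addrs P2) = 2" and card_addrs_P3: "card (addrs P3) = 3"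
  and card_addrs_K12: "card (addrs K12) = 3"
  by (simp_all add: P2_def P3_def K12_def card_addrs_Node card_addrs_K1 lessThan_Suc)

lemma P2_iff: "T = P2 \<longleftrightarrow> card (addrs T) = 2"
proof
  assume c: "card (addrs T) = 2"
  obtain ts where T: "T = Node ts" by (cases T)
  then have s: "(\<Sum>i<length ts. card (addrs (ts ! i))) = 1" using c by (simp add: card_addrs_Node)
  show "T = P2"
  proof (cases ts)
    case (Cons a ts')
    then have "card (addrs a) + (\<Sum>i<length ts'. card (addrs (ts' ! i))) = 1"
      using s by (simp add: sum.lessThan_Suc_shift del: sum.lessThan_Suc)
    moreover have "ts' = [] \<or> 0 < (\<Sum>i<length ts'. card (addrs (ts' ! i)))"
      using card_addrs_pos by (cases ts') (auto simp: sum.lessThan_Suc_shift simp del: sum.lessThan_Suc)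
    ultimately show ?thesis using card_addrs_pos[of a] K1_iff[of a] by (auto simp: T Cons P2_def)
  qed (use s in simp)
qed (simp add: card_addrs_P2)

lemma small_branch_cases [consumes 1, case_names K1 P2 K12 P3]:
  assumes c: "card (addrs B) \<le> 3"
  obtains "B = K1" | "B = P2" | "B = K12" | "B = P3"
proof (cases "card (addrs B) \<le> 2")
  case True
  then show thesis using that K1_iff P2_iff card_addrs_pos[of B] by (metis One_nat_def Suc_leI le_SucE le_antisym numeral_2_eq_2)
next
  case False
  with c have c: "card (addrs B) = 3" by simp
  obtain ts where B: "B = Node ts" by (cases B)
  then have s: "(\<Sum>i<length ts. card (addrs (ts ! i))) = 2" using c by (simp add: card_addrs_Node)
  obtain a ts' where ts: "ts = a # ts'" using s by (cases ts) auto
  have s1: "card (addrs a) + (\<Sum>i<length ts'. card (addrs (ts' ! i))) = 2"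
    using s by (simp add: ts sum.lessThan_Suc_shift del: sum.lessThan_Suc)
  show thesis
  proof (cases ts')
    case Nil
    then have "a = P2" using s1 P2_iff by simp
    then show thesis using that by (simp add: B ts Nil P3_def)
  next
    case (Cons b r)
    have s2: "card (addrs a) + card (addrs b) + (\<Sum>i<length r. card (addrs (r ! i))) = 2"
      using s1 by (simp add: Cons sum.lessThan_Suc_shift del: sum.lessThan_Suc)
    then have z: "(\<Sum>i<length r. card (addrs (r ! i))) = 0" and "card (addrs a) = 1" "card (addrs b) = 1"
      using card_addrs_pos[of a] card_addrs_pos[of b] by linarith+
    moreover have "r = []" using z unfolding sum_card_addrs_eq_0_iff .
    ultimately show thesis using that K1_iff[of a] K1_iff[of b] by (simp add: B ts Cons K12_def)
  qed
qed

lemma tree_energy_P2: "tree_energy P2 h = branch_energy (h []) K1 (\<lambda>p. h (0 # p))"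
  and tree_energy_P3: "tree_energy P3 h = branch_energy (h []) P2 (\<lambda>p. h (0 # p))"
  and tree_energy_K12: "tree_energy K12 h =
    branch_energy (h []) K1 (\<lambda>p. h (0 # p)) + branch_energy (h []) K1 (\<lambda>p. h (1 # p))"
  by (simp_all add: P2_def P3_def K12_def tree_energy_Node)

text \<open>The next four identities complete squares from the leaves upwards. They show the minimal energy
  $-x^2/2$ and $-2x^2$ of the first two branches, the term linear in \<open>k []\<close> of \<open>K12\<close>, and the
  negative square of \<open>P3\<close>, a direction of negative energy that exists even if $x = 0$.\<close>

lemma branch_energy_K1: "branch_energy x K1 k = (k [] - sqrt 6 / 2 * x)\<^sup>2 - x\<^sup>2 / 2"
  by (simp add: branch_energy_def K1_def tree_energy_Node edge_energy_def power2_eq_square add_divide_distrib diff_divide_distrib algebra_simps sqrt6_mult)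

lemma branch_energy_P2:
  "branch_energy x P2 k = (k [0] - sqrt 6 / 2 * k [])\<^sup>2 + (k [] - sqrt 6 * x)\<^sup>2 / 2 - 2 * x\<^sup>2"
  by (simp add: branch_energy_def[of _ P2] tree_energy_P2 branch_energy_K1 edge_energy_def
      power2_eq_square add_divide_distrib diff_divide_distrib algebra_simps sqrt6_mult)

lemma branch_energy_K12:
  "branch_energy x K12 k = (k [0] - sqrt 6 / 2 * k [])\<^sup>2 + (k [1] - sqrt 6 / 2 * k [])\<^sup>2
     + x\<^sup>2 - sqrt 6 * x * k []"
  by (simp add: branch_energy_def[of _ K12] tree_energy_K12 branch_energy_K1 edge_energy_def lessThan_Suc
      power2_eq_square add_divide_distrib diff_divide_distrib algebra_simps sqrt6_mult)

lemma branch_energy_P3: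
  "branch_energy x P3 k = (k [0, 0] - sqrt 6 / 2 * k [0])\<^sup>2 + (k [0] - sqrt 6 * k [])\<^sup>2 / 2
     + 5 / 2 * x\<^sup>2 - (k [] + sqrt 6 / 2 * x)\<^sup>2"
  by (simp add: branch_energy_def[of _ P3] tree_energy_P3 branch_energy_P2 edge_energy_def lessThan_Suc
      power2_eq_square add_divide_distrib diff_divide_distrib algebra_simps sqrt6_mult)

text \<open>Twice the negated minimal energy of a branch at $x = 1$. For \<open>K12\<close> and \<open>P3\<close> there is no minimum and any
  value could be taken; $30$ is the least that exceeds every weight occurring in the listed families
  with pendant vertices at a neighbouring vertex of the cycle.\<close>

definition branch_weight :: "rtree \<Rightarrow> nat" where
  "branch_weight B = (if B = K1 then 1 else if B = P2 then 4 else 30)"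

primrec tree_weight :: "rtree \<Rightarrow> nat" where
  "tree_weight (Node ts) = (\<Sum>B\<leftarrow>ts. branch_weight B)"

declare tree_weight.simps [simp del]

text \<open>The values on a branch, for value $1$ at its vertex of attachment, that realise the weight. They
  make the squares with positive coefficient vanish; for \<open>K12\<close> and \<open>P3\<close> the values $7$ and $3$ next to the attachment are
  large enough to push the energy below $-15$.\<close>

definition extension :: "rtree \<Rightarrow> nat list \<Rightarrow> real" where
  "extension B = (if B = K1 then (\<lambda>_. sqrt 6 / 2)
     else if B = P2 then (\<lambda>p. if p = [] then sqrt 6 else 3)
     else if B = K12 then (\<lambda>p. if p = [] then 7 else 7 * (sqrt 6 / 2))
     else (\<lambda>p. if p = [] then 3 else if p = [0] then 3 * sqrt 6 else 9))"

lemma branch_distinct: "K1 \<noteq> P2" "K1 \<noteq> K12" "K1 \<noteq> P3" "P2 \<noteq> K12" "P2 \<noteq> P3" "K12 \<noteq> P3"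
  by (simp_all add: K1_def P2_def P3_def K12_def)

lemma branch_energy_extension:
  assumes "card (addrs B) \<le> 3"
  shows "branch_energy x B (\<lambda>p. x * extension B p) \<le> - (branch_weight B / 2) * x\<^sup>2"
  using assms
proof (cases rule: small_branch_cases)
  case K1
  then show ?thesis by (simp add: branch_energy_K1 extension_def branch_weight_def)
next
  case P2
  then show ?thesis using branch_distinct
    by (simp add: branch_energy_P2 extension_def branch_weight_def power2_eq_square add_divide_distrib diff_divide_distrib algebra_simps sqrt6_mult)
next
  case K12
  have "x\<^sup>2 * (7 * sqrt 6) \<ge> x\<^sup>2 * 16" using sqrt6_bounds by (intro mult_left_mono) auto
  then show ?thesis using branch_distinct K12
    by (simp add: branch_energy_K12 extension_def branch_weight_def power2_eq_square algebra_simps)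
next
  case P3
  have "x\<^sup>2 * (3 * sqrt 6) \<ge> x\<^sup>2 * 7" using sqrt6_bounds by (intro mult_left_mono) auto
  then show ?thesis using branch_distinct P3
    by (simp add: branch_energy_P3 extension_def branch_weight_def power2_eq_square add_divide_distrib diff_divide_distrib algebra_simps sqrt6_mult)
qed

lemma tree_weight_sum: "tree_weight (Node ts) = (\<Sum>i<length ts. branch_weight (ts ! i))"
  by (simp add: tree_weight.simps sum_list_sum_nth atLeast0LessThan)

definition tree_extension :: "rtree list \<Rightarrow> nat list \<Rightarrow> real" where
  "tree_extension ts p = (case p of [] \<Rightarrow> 1 | i # q \<Rightarrow> extension (ts ! i) q)"

lemma tree_energy_extension:
  assumes "\<And>B. B \<in> set ts \<Longrightarrow> card (addrs B) \<le> 3"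
  shows "tree_energy (Node ts) (\<lambda>p. x * tree_extension ts p) \<le> - (tree_weight (Node ts) / 2) * x\<^sup>2"
proof -
  have "tree_energy (Node ts) (\<lambda>p. x * tree_extension ts p)
      = (\<Sum>i<length ts. branch_energy x (ts ! i) (\<lambda>p. x * extension (ts ! i) p))"
    by (simp add: tree_energy_Node tree_extension_def)
  also have "\<dots> \<le> (\<Sum>i<length ts. - (branch_weight (ts ! i) / 2) * x\<^sup>2)"
    using assms by (intro sum_mono branch_energy_extension) simp
  also have "\<dots> = - (tree_weight (Node ts) / 2) * x\<^sup>2"
    by (simp add: tree_weight_sum sum_divide_distrib sum_distrib_right flip: sum_negf)
  finally show ?thesis .
qed

text \<open>A factor $x$ at the root multiplies the whole extension, so that vectors on the cycle extend
  linearly to the trees.\<close>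

lemma tree_energy_scaling_exists:
  assumes "\<And>ts B. T = Node ts \<Longrightarrow> B \<in> set ts \<Longrightarrow> card (addrs B) \<le> 3"
  obtains z where "z [] = 1" "\<And>x. tree_energy T (\<lambda>p. x * z p) \<le> - (tree_weight T / 2) * x\<^sup>2"
proof -
  obtain ts where T: "T = Node ts" by (cases T)
  show thesis
    using that[of "tree_extension ts"] tree_energy_extension[of ts] assms T by (auto simp: tree_extension_def)
qed

lemma tree_energy_const: "tree_energy T (\<lambda>_. c) = (real (card (addrs T)) - 1) * ((2 - sqrt 6) * c\<^sup>2)"
proof (induction T)
  case (Node ts)
  have "tree_energy (Node ts) (\<lambda>_. c) = (\<Sum>i<length ts. real (card (addrs (ts ! i))) * ((2 - sqrt 6) * c\<^sup>2))"
    unfolding tree_energy_Node branch_energy_def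
    by (intro sum.cong refl) (simp add: Node edge_energy_def power2_eq_square algebra_simps)
  then show ?case by (simp add: card_addrs_Node sum_distrib_right)
qed

section \<open>Graphs with a negative plane\<close>

text \<open>Sylvester's criterion for binary forms.\<close>

lemma negative_binary_form:
  fixes A B C \<alpha> \<beta> :: real
  assumes "A < 0" "B\<^sup>2 < A * C" "(\<alpha>, \<beta>) \<noteq> (0, 0)"
  shows "A * \<alpha>\<^sup>2 + 2 * B * \<alpha> * \<beta> + C * \<beta>\<^sup>2 < 0"
proof -
  have "A * (A * \<alpha>\<^sup>2 + 2 * B * \<alpha> * \<beta> + C * \<beta>\<^sup>2) = (A * \<alpha> + B * \<beta>)\<^sup>2 + (A * C - B\<^sup>2) * \<beta>\<^sup>2"
    by (simp add: power2_eq_square algebra_simps)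
  also have "\<dots> > 0"
  proof (cases "\<beta> = 0")
    case True
    then show ?thesis using assms by simp
  next
    case False
    then have "0 < (A * C - B\<^sup>2) * \<beta>\<^sup>2" using assms by simp
    then show ?thesis by (simp add: add_nonneg_pos)
  qed
  finally show ?thesis using assms(1) by (simp add: zero_less_mult_iff)
qed

text \<open>The form on the cycle that is left after the trees have been eliminated; the arguments \<open>a\<close> to \<open>e\<close>
  are the weights of the trees.\<close>

definition core :: "real \<Rightarrow> real \<Rightarrow> real \<Rightarrow> real \<Rightarrow> real \<Rightarrow> (nat \<Rightarrow> real) \<Rightarrow> real" where
  "core a b c d e x = (4 - a) * (x 0)\<^sup>2 + (4 - b) * (x 1)\<^sup>2 + (4 - c) * (x 2)\<^sup>2 + (4 - d) * (x 3)\<^sup>2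
     + (4 - e) * (x 4)\<^sup>2 - 2 * sqrt 6 * (x 0 * x 1 + x 1 * x 2 + x 2 * x 3 + x 3 * x 4 + x 4 * x 0)"

definition core_negative :: "real \<Rightarrow> real \<Rightarrow> real \<Rightarrow> real \<Rightarrow> real \<Rightarrow> bool" where
  "core_negative a b c d e \<longleftrightarrow>
     (\<exists>u v. \<forall>\<alpha> \<beta>. (\<alpha>, \<beta>) \<noteq> (0, 0) \<longrightarrow> core a b c d e (\<lambda>i. \<alpha> * u i + \<beta> * v i) < 0)"

lemma core_antimono:
  assumes "a \<le> a'" "b \<le> b'" "c \<le> c'" "d \<le> d'" "e \<le> e'"
  shows "core a' b' c' d' e' x \<le> core a b c d e x"
  unfolding core_def using assms by (intro diff_right_mono add_mono mult_right_mono) auto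

lemma core_negative_mono:
  assumes "core_negative a b c d e" "a \<le> a'" "b \<le> b'" "c \<le> c'" "d \<le> d'" "e \<le> e'"
  shows "core_negative a' b' c' d' e'"
proof -
  obtain u v where uv: "\<And>\<alpha> \<beta>. (\<alpha>, \<beta>) \<noteq> (0, 0) \<Longrightarrow> core a b c d e (\<lambda>i. \<alpha> * u i + \<beta> * v i) < 0"
    using assms(1) unfolding core_negative_def by metis
  show ?thesis unfolding core_negative_def
    by (intro exI[of _ u] exI[of _ v] allI impI)
      (rule le_less_trans[OF core_antimono[OF assms(2-6)]], rule uv)
qed

lemma core_negative_reflect:
  assumes "core_negative a b c d e" shows "core_negative a e d c b"
proof -
  obtain u v where uv: "\<And>\<alpha> \<beta>. (\<alpha>, \<beta>) \<noteq> (0, 0) \<Longrightarrow> core a b c d e (\<lambda>i. \<alpha> * u i + \<beta> * v i) < 0"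
    using assms(1) unfolding core_negative_def by metis
  define r :: "nat \<Rightarrow> nat" where "r i = (if i = 0 then 0 else 5 - i)" for i
  have "core a e d c b (\<lambda>i. x (r i)) = core a b c d e x" for x
    by (simp add: core_def r_def algebra_simps)
  from this[of "\<lambda>i. _ * u i + _ * v i"] show ?thesis unfolding core_negative_def
    by (intro exI[of _ "\<lambda>i. u (r i)"] exI[of _ "\<lambda>i. v (r i)"] allI impI) (simp add: uv)
qed

definition core_bilinear ::
    "real \<Rightarrow> real \<Rightarrow> real \<Rightarrow> real \<Rightarrow> real \<Rightarrow> (nat \<Rightarrow> real) \<Rightarrow> (nat \<Rightarrow> real) \<Rightarrow> real" where
  "core_bilinear a b c d e x y = (4 - a) * (x 0 * y 0) + (4 - b) * (x 1 * y 1) + (4 - c) * (x 2 * y 2)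
     + (4 - d) * (x 3 * y 3) + (4 - e) * (x 4 * y 4)
     - sqrt 6 * (x 0 * y 1 + x 1 * y 2 + x 2 * y 3 + x 3 * y 4 + x 4 * y 0
         + y 0 * x 1 + y 1 * x 2 + y 2 * x 3 + y 3 * x 4 + y 4 * x 0)"

lemma core_negativeI:
  assumes "core a b c d e u < 0" "(core_bilinear a b c d e u v)\<^sup>2 < core a b c d e u * core a b c d e v"
  shows "core_negative a b c d e"
  unfolding core_negative_def
proof (rule exI[of _ u], rule exI[of _ v], intro allI impI)
  fix \<alpha> \<beta> :: real assume "(\<alpha>, \<beta>) \<noteq> (0, 0)"
  have "core a b c d e (\<lambda>i. \<alpha> * u i + \<beta> * v i)
      = core a b c d e u * \<alpha>\<^sup>2 + 2 * core_bilinear a b c d e u v * \<alpha> * \<beta> + core a b c d e v * \<beta>\<^sup>2"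
    unfolding core_def core_bilinear_def by algebra
  also have "\<dots> < 0" using assms \<open>(\<alpha>, \<beta>) \<noteq> (0, 0)\<close> by (rule negative_binary_form)
  finally show "core a b c d e (\<lambda>i. \<alpha> * u i + \<beta> * v i) < 0" .
qed

lemmas core_eval = core_def core_bilinear_def nth_Cons_numeral nth_Cons_0 nth_Cons_Suc power2_eq_square
  algebra_simps sqrt6_mult

text \<open>Minimal weight vectors with a negative plane. The vectors \<open>u\<close> and \<open>v\<close> approximate, by small
  integers, a basis of the space spanned by the two eigenvectors with negative eigenvalue. The last two vectors are
  responsible for the bounds $17$ and $29$.\<close>

lemma core_negative_4_0_2_1_0: "core_negative 4 0 2 1 0"
  using sqrt6_bounds
  by (intro core_negativeI[where u = "\<lambda>i. [4, 1, 0, 0, 2] ! i" and v = "\<lambda>i. [0, 1, 3, 2, 1] ! i"])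
    (simp_all add: core_eval)

lemma core_negative_4_0_3_0_0: "core_negative 4 0 3 0 0"
  using sqrt6_bounds
  by (intro core_negativeI[where u = "\<lambda>i. [2, 1, 0, 0, 1] ! i" and v = "\<lambda>i. [0, 1, 2, 1, 0] ! i"])
    (simp_all add: core_eval)

lemma core_negative_5_0_2_0_0: "core_negative 5 0 2 0 0"
  using sqrt6_bounds
  by (intro core_negativeI[where u = "\<lambda>i. [3, 1, 0, 0, 1] ! i" and v = "\<lambda>i. [0, 1, 3, 2, 1] ! i"])
    (simp_all add: core_eval)

lemma core_negative_5_5_0_0_0: "core_negative 5 5 0 0 0"
  using sqrt6_bounds
  by (intro core_negativeI[where u = "\<lambda>i. [3, 0, 0, 0, 1] ! i" and v = "\<lambda>i. [0, 4, 2, 0, -1] ! i"])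
    (simp_all add: core_eval)

lemma core_negative_6_0_1_1_0: "core_negative 6 0 1 1 0"
  using sqrt6_bounds
  by (intro core_negativeI[where u = "\<lambda>i. [1, 0, -1, -1, 0] ! i" and v = "\<lambda>i. [0, 1, 2, 2, 1] ! i"])
    (simp_all add: core_eval)

lemma core_negative_7_4_0_0_0: "core_negative 7 4 0 0 0"
  using sqrt6_bounds
  by (intro core_negativeI[where u = "\<lambda>i. [2, 1, 0, 0, 1] ! i" and v = "\<lambda>i. [0, 2, 1, 0, 0] ! i"])
    (simp_all add: core_eval)

lemma core_negative_9_3_0_0_0: "core_negative 9 3 0 0 0"
  using sqrt6_bounds
  by (intro core_negativeI[where u = "\<lambda>i. [1, 0, 0, 0, 0] ! i" and v = "\<lambda>i. [0, 2, 2, 1, 0] ! i"])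
    (simp_all add: core_eval)

lemma core_negative_10_0_1_0_0: "core_negative 10 0 1 0 0"
  using sqrt6_bounds
  by (intro core_negativeI[where u = "\<lambda>i. [4, 0, -2, -1, 0] ! i" and v = "\<lambda>i. [0, 3, 6, 5, 2] ! i"])
    (simp_all add: core_eval)

lemma core_negative_12_2_0_0_1: "core_negative 12 2 0 0 1"
  using sqrt6_bounds
  by (intro core_negativeI[where u = "\<lambda>i. [1, 0, 0, 0, 0] ! i" and v = "\<lambda>i. [0, 4, 5, 4, 2] ! i"])
    (simp_all add: core_eval)

lemma core_negative_13_2_0_0_0: "core_negative 13 2 0 0 0"
  using sqrt6_bounds
  by (intro core_negativeI[where u = "\<lambda>i. [1, 0, 0, 0, 0] ! i" and v = "\<lambda>i. [0, 5, 6, 5, 2] ! i"])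
    (simp_all add: core_eval)

lemma core_negative_18_1_0_0_1: "core_negative 18 1 0 0 1"
  using sqrt6_bounds
  by (intro core_negativeI[where u = "\<lambda>i. [1, 0, 0, 0, 0] ! i" and v = "\<lambda>i. [0, 2, 3, 3, 2] ! i"])
    (simp_all add: core_eval)

lemma core_negative_30_1_0_0_0: "core_negative 30 1 0 0 0"
  using sqrt6_bounds
  by (intro core_negativeI[where u = "\<lambda>i. [1, 0, 0, 0, 0] ! i" and v = "\<lambda>i. [0, 7, 10, 9, 5] ! i"])
    (simp_all add: core_eval)

text \<open>Monotonicity excludes everything above the vectors just listed or their reflections. Using them
  one after the other, the weights away from the heaviest vertex are forced down and the heaviest
  one up, until only the stated vectors are left.\<close>

lemma not_core_negative_weights:
  fixes a b c d e :: nat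
  assumes nc: "\<not> core_negative a b c d e" and max: "b \<le> a" "c \<le> a" "d \<le> a" "e \<le> a"
    and sum: "16 \<le> a + b + c + d + e"
  shows "c = 0 \<and> d = 0 \<and> (b = 0 \<and> e = 0 \<or> b = 1 \<and> e = 0 \<and> a \<le> 29 \<or> b = 0 \<and> e = 1 \<and> a \<le> 29
    \<or> b = 1 \<and> e = 1 \<and> a \<le> 17)"
proof -
  have l: "\<not> (a' \<le> a \<and> b' \<le> b \<and> c' \<le> c \<and> d' \<le> d \<and> e' \<le> e)"
    "\<not> (a' \<le> a \<and> b' \<le> e \<and> c' \<le> d \<and> d' \<le> c \<and> e' \<le> b)"
    if "core_negative (real a') (real b') (real c') (real d') (real e')" for a' b' c' d' e' :: nat
    using core_negative_mono[OF that, of a b c d e] core_negative_mono[OF core_negative_reflect[OF that], of a b c d e] nc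
    by auto
  note w = l[of 4 0 2 1 0, simplified, OF core_negative_4_0_2_1_0]
    l[of 4 0 3 0 0, simplified, OF core_negative_4_0_3_0_0]
    l[of 5 0 2 0 0, simplified, OF core_negative_5_0_2_0_0]
    l[of 5 5 0 0 0, simplified, OF core_negative_5_5_0_0_0]
    l[of 6 0 1 1 0, simplified, OF core_negative_6_0_1_1_0]
    l[of 7 4 0 0 0, simplified, OF core_negative_7_4_0_0_0]
    l[of 9 3 0 0 0, simplified, OF core_negative_9_3_0_0_0]
    l[of 10 0 1 0 0, simplified, OF core_negative_10_0_1_0_0]
    l[of 12 2 0 0 1, simplified, OF core_negative_12_2_0_0_1]
    l[of 13 2 0 0 0, simplified, OF core_negative_13_2_0_0_0]
    l[of 18 1 0 0 1, simplified, OF core_negative_18_1_0_0_1]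
    l[of 30 1 0 0 0, simplified, OF core_negative_30_1_0_0_0]
  have a4: "4 \<le> a" using max sum by presburger
  have a5: "5 \<le> a" using w(1-4) a4 max sum by presburger
  have bcde: "b \<le> 4" "c \<le> 1" "d \<le> 1" "e \<le> 4" using w(5-8) a5 by presburger+
  have a6: "6 \<le> a" using bcde sum by presburger
  have "c + d \<le> 1" using w(9-10) a6 bcde by presburger
  moreover have a7: "7 \<le> a" using bcde sum \<open>c + d \<le> 1\<close> by presburger
  ultimately have "b \<le> 3" "e \<le> 3" using w(11-12) by presburger+
  then have a9: "9 \<le> a" using \<open>c + d \<le> 1\<close> sum by presburger
  then have be: "b \<le> 2" "e \<le> 2" using w(13-14) by presburger+
  then have a11: "11 \<le> a" using \<open>c + d \<le> 1\<close> sum by presburger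
  then have cd: "c = 0" "d = 0" using w(15-16) by presburger+
  then have a12: "12 \<le> a" using be sum by presburger
  have "b \<le> 1 \<and> e \<le> 1" using w(17-20) cd a12 be sum by presburger
  then show ?thesis using cd w(21-24) by presburger
qed

subsection \<open>Planes in the whole graph\<close>

definition small_branches :: "rtree \<Rightarrow> bool" where
  "small_branches T \<longleftrightarrow> (\<forall>ts. T = Node ts \<longrightarrow> (\<forall>B\<in>set ts. card (addrs B) \<le> 3))"

text \<open>Extending the values on the cycle by the minimising values on the branches bounds the energy by
  the form on the cycle.\<close>

lemma negative_plane_core:
  assumes small: "small_branches T0" "small_branches T1" "small_branches T2" "small_branches T3" "small_branches T4"
    and neg: "core_negative (tree_weight T0) (tree_weight T1) (tree_weight T2) (tree_weight T3) (tree_weight T4)"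
  shows "negative_plane (C_graph [T0, T1, T2, T3, T4])"
proof -
  let ?Ts = "[T0, T1, T2, T3, T4]"
  have "\<exists>z. z [] = 1 \<and> (\<forall>x. tree_energy T (\<lambda>p. x * z p) \<le> - (tree_weight T / 2) * x\<^sup>2)"
    if "small_branches T" for T
    using tree_energy_scaling_exists[of T] that unfolding small_branches_def by metis
  then obtain z where z: "\<And>T. small_branches T \<Longrightarrow> z T [] = 1"
      "\<And>T x. small_branches T \<Longrightarrow> tree_energy T (\<lambda>p. x * z T p) \<le> - (tree_weight T / 2) * x\<^sup>2"
    by metis
  define h where "h x = (\<lambda>(i, p). x i * z (?Ts ! i) p)" for x :: "nat \<Rightarrow> real"
  have bound: "energy (C_graph ?Ts) (h x) \<le>
      core (tree_weight T0) (tree_weight T1) (tree_weight T2) (tree_weight T3) (tree_weight T4) x" for x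
    using z(2)[OF small(1), of "x 0"] z(2)[OF small(2), of "x 1"] z(2)[OF small(3), of "x 2"]
      z(2)[OF small(4), of "x 3"] z(2)[OF small(5), of "x 4"]
    unfolding energy_C5 core_def h_def by (simp add: z(1) small algebra_simps)
  obtain u v where uv: "\<And>\<alpha> \<beta>. (\<alpha>, \<beta>) \<noteq> (0, 0) \<Longrightarrow>
      core (tree_weight T0) (tree_weight T1) (tree_weight T2) (tree_weight T3) (tree_weight T4) (\<lambda>i. \<alpha> * u i + \<beta> * v i) < 0"
    using neg unfolding core_negative_def by metis
  have lin: "(\<lambda>w. \<alpha> * h u w + \<beta> * h v w) = h (\<lambda>i. \<alpha> * u i + \<beta> * v i)" for \<alpha> \<beta>
    by (auto simp: h_def algebra_simps)
  show ?thesis unfolding negative_plane_def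
    by (intro exI[of _ "h u"] exI[of _ "h v"] allI impI) (simp only: lin, rule le_less_trans[OF bound uv])
qed

lemma sum_remove_lessThan:
  fixes f :: "nat \<Rightarrow> 'b::ab_group_add"
  assumes "j < n"
  shows "(\<Sum>i<n. f i) = f j + (\<Sum>i\<in>{..<n} - {j}. f i)"
  using assms by (simp add: sum.remove[of _ j])

text \<open>The plane is spanned by the indicators of the branch and of its complement. An edge with
  value $1$ at both ends contributes $2 - \sqrt 6 < 0$, and the single edge between the sides contributes $1$ to
  each. With $x \ge 3$ edges on one side and $y \ge 5$ on the other, negative
  definiteness amounts to $(\kappa x - 1)(\kappa y - 1) > 3/2$ for $\kappa = \sqrt 6 - 2$, which $x + y \ge 20$
  ensures.\<close>

lemma negative_plane_large_branch:
  assumes B: "B \<in> set ts" "4 \<le> card (addrs B)"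
    and n: "21 \<le> card (addrs (Node ts)) + card (addrs T1) + card (addrs T2) + card (addrs T3) + card (addrs T4)"
  shows "negative_plane (C_graph [Node ts, T1, T2, T3, T4])"
proof -
  obtain j where j: "j < length ts" "ts ! j = B" using B by (auto simp: in_set_conv_nth)
  let ?Ts = "[Node ts, T1, T2, T3, T4]"
  define K where "K = 2 - sqrt 6"
  define k where "k = card (addrs B)"
  define r where "r = (\<Sum>i\<in>{..<length ts} - {j}. card (addrs (ts ! i)))"
  have cardT0: "card (addrs (Node ts)) = Suc (k + r)"
    using j by (simp add: card_addrs_Node k_def r_def sum.remove[of _ j])
  \<comment> \<open>the addresses of the vertices of the branch\<close>
  define in_B where "in_B = (\<lambda>(i, p). i = (0::nat) \<and> (\<exists>q. p = j # q))"
  define f where "f v = (if in_B v then 1 else 0 :: real)" for v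
  define g where "g v = (if in_B v then 0 else 1 :: real)" for v
  let ?h = "\<lambda>\<alpha> \<beta> v. \<alpha> * f v + \<beta> * g v"
  define N where "N = real (card (addrs (Node ts))) + card (addrs T1) + card (addrs T2) + card (addrs T3) + card (addrs T4)"
  have E: "energy (C_graph ?Ts) (?h \<alpha> \<beta>) =
     2 * ((1 + (real k - 1) * K) * \<alpha>\<^sup>2 + 2 * (- sqrt 6 / 2) * \<alpha> * \<beta> + (1 + (N - k) * K) * \<beta>\<^sup>2)" for \<alpha> \<beta>
  proof -
    have T: "tree_energy T (\<lambda>p. ?h \<alpha> \<beta> (i, p)) = (real (card (addrs T)) - 1) * (K * \<beta>\<^sup>2)" if "i \<noteq> 0" for T i
      using that tree_energy_const[of T \<beta>] by (simp add: f_def g_def in_B_def K_def)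
    have root: "?h \<alpha> \<beta> (i, []) = \<beta>" for i by (simp add: f_def g_def in_B_def)
    have br: "(\<lambda>p. ?h \<alpha> \<beta> (0, i # p)) = (\<lambda>_. if i = j then \<alpha> else \<beta>)" for i
      by (auto simp: f_def g_def in_B_def)
    have be: "branch_energy \<beta> T (\<lambda>_. c) = edge_energy \<beta> c + (real (card (addrs T)) - 1) * (K * c\<^sup>2)" for T c
      by (simp add: branch_energy_def tree_energy_const K_def)
    have "tree_energy (Node ts) (\<lambda>p. ?h \<alpha> \<beta> (0, p)) = edge_energy \<beta> \<alpha> + (real k - 1) * (K * \<alpha>\<^sup>2)
        + (\<Sum>i\<in>{..<length ts} - {j}. branch_energy \<beta> (ts ! i) (\<lambda>_. \<beta>))"
      unfolding tree_energy_Node root br using j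
      by (subst sum_remove_lessThan[of j]) (auto simp: be k_def intro!: sum.cong)
    also have "(\<Sum>i\<in>{..<length ts} - {j}. branch_energy \<beta> (ts ! i) (\<lambda>_. \<beta>)) = real r * (K * \<beta>\<^sup>2)"
      unfolding be r_def of_nat_sum sum_distrib_right
      by (intro sum.cong refl) (simp add: edge_energy_def K_def power2_eq_square algebra_simps)
    finally have T0: "tree_energy (Node ts) (\<lambda>p. ?h \<alpha> \<beta> (0, p)) =
        edge_energy \<beta> \<alpha> + (real k - 1) * (K * \<alpha>\<^sup>2) + real r * (K * \<beta>\<^sup>2)" .
    show ?thesis
      unfolding energy_C5 root T0 N_def cardT0
      by (simp add: T edge_energy_def K_def power2_eq_square algebra_simps)
  qed
  define \<kappa> where "\<kappa> = sqrt 6 - 2"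
  have \<kappa>: "449 / 1000 < \<kappa>" using sqrt6_bounds by (simp add: \<kappa>_def)
  define x where "x = real k - 1"
  define y where "y = N - real k"
  have x: "3 \<le> x" using B by (simp add: x_def k_def)
  have "5 \<le> y"
    using card_addrs_pos[of T1] card_addrs_pos[of T2] card_addrs_pos[of T3] card_addrs_pos[of T4]
    by (simp add: y_def N_def cardT0)
  have "20 \<le> x + y" using n by (simp add: x_def y_def N_def)
  \<comment> \<open>This bounds $xy$ below by a linear expression, after which the estimate is linear.\<close>
  have "0 \<le> (x - 3) * (y - 5)" using x \<open>5 \<le> y\<close> by simp
  then have xy: "5 * x + 3 * y - 15 \<le> x * y" by (simp add: algebra_simps)
  have kx: "449 / 1000 * x \<le> \<kappa> * x" and ky: "449 / 1000 * y \<le> \<kappa> * y"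
    using \<kappa> x \<open>5 \<le> y\<close> by (auto intro: mult_right_mono)
  have "3 / 2 < (449 / 1000 * x - 1) * (449 / 1000 * y - 1)"
    using xy x \<open>20 \<le> x + y\<close> \<open>5 \<le> y\<close> by (simp add: algebra_simps)
  also have "\<dots> \<le> (\<kappa> * x - 1) * (\<kappa> * y - 1)"
  proof (rule mult_mono)
    show "449 / 1000 * x - 1 \<le> \<kappa> * x - 1" "449 / 1000 * y - 1 \<le> \<kappa> * y - 1"
      "0 \<le> \<kappa> * x - 1" "0 \<le> 449 / 1000 * y - 1"
      using kx ky x \<open>5 \<le> y\<close> by linarith+
  qed
  also have "\<dots> = (1 + x * K) * (1 + y * K)" by (simp add: K_def \<kappa>_def algebra_simps)
  finally have det: "(- sqrt 6 / 2)\<^sup>2 < (1 + x * K) * (1 + y * K)"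
    by (simp add: power_divide)
  have "x * K = - (\<kappa> * x)" by (simp add: K_def \<kappa>_def algebra_simps)
  then have neg: "1 + x * K < 0" using kx x by linarith
  show ?thesis
    unfolding negative_plane_def
  proof (rule exI[of _ f], rule exI[of _ g], intro allI impI)
    fix \<alpha> \<beta> :: real assume "(\<alpha>, \<beta>) \<noteq> (0, 0)"
    from negative_binary_form[OF neg det this] show "energy (C_graph ?Ts) (?h \<alpha> \<beta>) < 0"
      unfolding E by (simp add: x_def y_def)
  qed
qed

text \<open>One vector is the negative direction of the path, supported on the path alone. The other has the value
  $1$ on the cycle; on the path it is chosen orthogonal to the first vector with respect to the energy, which costs
  $5/2$, and on the other branches it is the minimising extension. On the bare cycle it has energy
  $20 - 10\sqrt 6$ and the path adds $2 \cdot 5/2$, so one more unit of weight makes it negative: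
  $24 - 10\sqrt 6 < 0$.\<close>

lemma negative_plane_P3:
  assumes P3: "P3 \<in> set ts"
    and small: "small_branches (Node ts)" "small_branches T1" "small_branches T2" "small_branches T3" "small_branches T4"
    and w: "31 \<le> tree_weight (Node ts) + tree_weight T1 + tree_weight T2 + tree_weight T3 + tree_weight T4"
  shows "negative_plane (C_graph [Node ts, T1, T2, T3, T4])"
proof -
  obtain j where j: "j < length ts" "ts ! j = P3" using P3 by (auto simp: in_set_conv_nth)
  let ?Ts = "[Node ts, T1, T2, T3, T4]"
  have "\<exists>z. z [] = 1 \<and> (\<forall>x. tree_energy T (\<lambda>p. x * z p) \<le> - (tree_weight T / 2) * x\<^sup>2)"
    if "small_branches T" for T
    using tree_energy_scaling_exists[of T] that unfolding small_branches_def by metis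
  then obtain z where z: "\<And>T. small_branches T \<Longrightarrow> z T [] = 1"
      "\<And>T x. small_branches T \<Longrightarrow> tree_energy T (\<lambda>p. x * z T p) \<le> - (tree_weight T / 2) * x\<^sup>2"
    by metis
  define y :: "nat list \<Rightarrow> real" where "y p = (if p = [] then 1 else if p = [0] then sqrt 6 else 3)" for p
  define z0 where "z0 p = (case p of [] \<Rightarrow> 1 | i # q \<Rightarrow> if i = j then - (sqrt 6 / 2) * y q else extension (ts ! i) q)" for p
  define y0 where "y0 p = (case p of [] \<Rightarrow> 0 | i # q \<Rightarrow> if i = j then y q else 0)" for p
  define r where "r = (\<Sum>i\<in>{..<length ts} - {j}. branch_weight (ts ! i))"
  have w0: "tree_weight (Node ts) = 30 + r"
    using j branch_distinct by (simp add: tree_weight_sum r_def sum.remove[of _ j] branch_weight_def)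
  have T0: "tree_energy (Node ts) (\<lambda>p. \<alpha> * y0 p + \<beta> * z0 p) \<le> 5 / 2 * \<beta>\<^sup>2 - \<alpha>\<^sup>2 - real r / 2 * \<beta>\<^sup>2" for \<alpha> \<beta>
  proof -
    let ?b = "\<lambda>i. branch_energy \<beta> (ts ! i) (\<lambda>p. \<alpha> * y0 (i # p) + \<beta> * z0 (i # p))"
    have "?b j = 5 / 2 * \<beta>\<^sup>2 - \<alpha>\<^sup>2"
      unfolding j branch_energy_P3 by (simp add: y0_def z0_def y_def power2_eq_square algebra_simps sqrt6_mult)
    moreover have "(\<Sum>i\<in>{..<length ts} - {j}. ?b i) \<le> (\<Sum>i\<in>{..<length ts} - {j}. - (branch_weight (ts ! i) / 2) * \<beta>\<^sup>2)"
    proof (rule sum_mono)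
      fix i assume i: "i \<in> {..<length ts} - {j}"
      then have "card (addrs (ts ! i)) \<le> 3" using small(1) by (simp add: small_branches_def)
      from branch_energy_extension[OF this, of \<beta>] show "?b i \<le> - (branch_weight (ts ! i) / 2) * \<beta>\<^sup>2"
        using i by (simp add: y0_def z0_def)
    qed
    moreover have "(\<Sum>i\<in>{..<length ts} - {j}. - (branch_weight (ts ! i) / 2) * \<beta>\<^sup>2) = - (real r / 2 * \<beta>\<^sup>2)"
      by (simp add: r_def sum_divide_distrib sum_distrib_right flip: sum_negf)
    moreover have "tree_energy (Node ts) (\<lambda>p. \<alpha> * y0 p + \<beta> * z0 p) = (\<Sum>i<length ts. ?b i)"
      by (simp add: tree_energy_Node y0_def z0_def)
    ultimately show ?thesis using sum_remove_lessThan[OF j(1), of ?b] by linarith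
  qed
  define f where "f = (\<lambda>(i :: nat, p). if i = 0 then y0 p else 0 :: real)"
  define g where "g = (\<lambda>(i :: nat, p). if i = 0 then z0 p else z (?Ts ! i) p)"
  show ?thesis
    unfolding negative_plane_def
  proof (rule exI[of _ f], rule exI[of _ g], intro allI impI)
    fix \<alpha> \<beta> :: real assume nz: "(\<alpha>, \<beta>) \<noteq> (0, 0)"
    let ?h = "\<lambda>v :: nat \<times> nat list. \<alpha> * f v + \<beta> * g v"
    define W where "W = real (tree_weight (Node ts) + tree_weight T1 + tree_weight T2 + tree_weight T3 + tree_weight T4)"
    have "energy (C_graph ?Ts) ?h \<le> 20 * \<beta>\<^sup>2 - 10 * sqrt 6 * \<beta>\<^sup>2 + 5 * \<beta>\<^sup>2 - 2 * \<alpha>\<^sup>2 - (W - 30) * \<beta>\<^sup>2"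
      using T0[of \<alpha> \<beta>] z(2)[OF small(2), of \<beta>] z(2)[OF small(3), of \<beta>]
        z(2)[OF small(4), of \<beta>] z(2)[OF small(5), of \<beta>]
      unfolding energy_C5
      by (simp add: f_def g_def y0_def[of "[]"] z0_def[of "[]"] z(1) small W_def w0 power2_eq_square algebra_simps)
    also have "\<dots> \<le> (24 - 10 * sqrt 6) * \<beta>\<^sup>2 - 2 * \<alpha>\<^sup>2"
    proof -
      have "1 * \<beta>\<^sup>2 \<le> (W - 30) * \<beta>\<^sup>2" using w by (intro mult_right_mono) (auto simp: W_def)
      then show ?thesis by (simp add: algebra_simps)
    qed
    also have "\<dots> < 0"
    proof (cases "\<beta> = 0")
      case True
      then show ?thesis using nz by simp
    next
      case False
      then have "(24 - 10 * sqrt 6) * \<beta>\<^sup>2 < 0" using sqrt6_bounds by (intro mult_neg_pos) auto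
      then show ?thesis by (smt (verit) zero_le_power2)
    qed
    finally show "energy (C_graph ?Ts) ?h < 0" .
  qed
qed

section \<open>Graphs without a negative plane\<close>

lemma card_addrs_le_branch_weight:
  "card (addrs B) \<le> 3 \<Longrightarrow> card (addrs B) \<le> branch_weight B"
  by (auto simp: branch_weight_def card_addrs_K1 card_addrs_P2)

lemma tree_weight_ge:
  assumes "small_branches (Node ts)"
  shows "card (addrs (Node ts)) \<le> Suc (tree_weight (Node ts))"
  using assms unfolding card_addrs_Node tree_weight_sum
  by (auto simp: small_branches_def intro!: sum_mono card_addrs_le_branch_weight)

lemma tree_weight_ge': "small_branches T \<Longrightarrow> card (addrs T) \<le> Suc (tree_weight T)"
  using tree_weight_ge by (cases T) auto

lemma branch_weight_pos: "0 < branch_weight B"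
  by (simp add: branch_weight_def)

lemma tree_weight_Cons: "tree_weight (Node (B # r)) = branch_weight B + tree_weight (Node r)"
  by (simp add: tree_weight.simps)

lemma tree_weight_eq_0_iff: "tree_weight T = 0 \<longleftrightarrow> T = K1"
proof -
  obtain ts where T: "T = Node ts" by (cases T)
  show ?thesis
    using branch_weight_pos[of "hd ts"]
    by (cases ts) (auto simp: T K1_def tree_weight_Cons tree_weight.simps(1)[of "[]"])
qed

lemma tree_weight_eq_1: "tree_weight T = 1 \<Longrightarrow> T = star 1"
proof -
  assume w: "tree_weight T = 1"
  obtain ts where T: "T = Node ts" by (cases T)
  obtain B r where ts: "ts = B # r" using w by (cases ts) (auto simp: T tree_weight.simps)
  have "branch_weight B = 1" "tree_weight (Node r) = 0"
    using w branch_weight_pos[of B] unfolding T ts tree_weight_Cons by linarith+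
  then have "B = K1" "Node r = K1"
    unfolding tree_weight_eq_0_iff by (auto simp: branch_weight_def split: if_splits)
  then show ?thesis by (simp add: T ts star_def K1_def)
qed

lemma T_tree_conv: "T_tree l0 l1 l2 = Node (replicate l0 K1 @ replicate l1 P2 @ replicate l2 K12)"
  by (simp add: T_tree_def P2_def K12_def)

text \<open>The three kinds of branches have $1$, $2$ and $3$ vertices, so sorting by size groups them as in
  \<open>T_tree\<close>.\<close>

lemma sorted_branches_T_tree:
  assumes "sorted (map (card \<circ> addrs) ts)" "\<And>B. B \<in> set ts \<Longrightarrow> B = K1 \<or> B = P2 \<or> B = K12"
  shows "\<exists>l0 l1 l2. Node ts = T_tree l0 l1 l2"
  using assms
proof (induction ts)
  case Nil
  then show ?case by (intro exI[of _ 0]) (simp add: T_tree_conv)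
next
  case (Cons B ts)
  then obtain l0 l1 l2 where IH: "ts = replicate l0 K1 @ replicate l1 P2 @ replicate l2 K12"
    by (auto simp: T_tree_conv)
  have ge: "card (addrs B) \<le> card (addrs B')" if "B' \<in> set ts" for B' using Cons.prems that by auto
  have B: "B = K1 \<or> B = P2 \<or> B = K12" using Cons.prems(2)[of B] by simp
  have z0: "l0 = 0" if "B \<noteq> K1"
  proof (rule ccontr)
    assume "l0 \<noteq> 0"
    then have "card (addrs B) \<le> card (addrs K1)" by (intro ge) (simp add: IH)
    then show False using that B card_addrs_K1 card_addrs_P2 card_addrs_K12 by auto
  qed
  have z1: "l1 = 0" if "B = K12"
  proof (rule ccontr)
    assume "l1 \<noteq> 0"
    then have "card (addrs B) \<le> card (addrs P2)" by (intro ge) (simp add: IH)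
    then show False using that card_addrs_P2 card_addrs_K12 by auto
  qed
  from B consider "B = K1" | "B = P2" | "B = K12" by blast
  then show ?case
  proof cases
    case 1
    then show ?thesis by (intro exI[of _ "Suc l0"] exI[of _ l1] exI[of _ l2]) (simp add: T_tree_conv IH)
  next
    case 2
    then show ?thesis using z0 branch_distinct
      by (intro exI[of _ 0] exI[of _ "Suc l1"] exI[of _ l2]) (simp add: T_tree_conv IH)
  next
    case 3
    then show ?thesis using z0 z1 branch_distinct
      by (intro exI[of _ 0] exI[of _ "Suc l2"]) (simp add: T_tree_conv IH)
  qed
qed

lemma tree_weight_T_tree: "tree_weight (T_tree l0 l1 l2) = l0 + 4 * l1 + 30 * l2"
  using branch_distinct
  by (simp add: T_tree_conv tree_weight.simps sum_list_replicate branch_weight_def)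

lemma card_addrs_T_tree: "card (addrs (T_tree l0 l1 l2)) = Suc (l0 + 2 * l1 + 3 * l2)"
proof -
  have "card (addrs (Node ts)) = Suc (\<Sum>B\<leftarrow>ts. card (addrs B))" for ts
    by (simp add: card_addrs_Node sum_list_sum_nth atLeast0LessThan)
  then show ?thesis
    by (simp add: T_tree_conv sum_list_replicate card_addrs_K1 card_addrs_P2 card_addrs_K12)
qed

lemma card_addrs_star_1: "card (addrs (star 1)) = 2"
  by (simp add: star_def card_addrs_Node card_addrs_K1)

lemma card_pverts_C5: "card (pverts (C_graph [T0, T1, T2, T3, T4])) =
   card (addrs T0) + card (addrs T1) + card (addrs T2) + card (addrs T3) + card (addrs T4)"
proof -
  have "{..<length [T0, T1, T2, T3, T4]} = {0, 1, 2, 3, 4}" by auto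
  then show ?thesis by (simp add: pverts_C_graph card_SigmaI)
qed

lemma normal_tree_obtain:
  assumes "P3 \<notin> set ts" "sorted (map (card \<circ> addrs) ts)" "small_branches (Node ts)"
  obtains l0 l1 l2 where "Node ts = T_tree l0 l1 l2"
proof -
  have branch: "B = K1 \<or> B = P2 \<or> B = K12" if "B \<in> set ts" for B
  proof -
    have "card (addrs B) \<le> 3" using assms(3) that by (simp add: small_branches_def)
    then show ?thesis using assms(1) that by (cases rule: small_branch_cases) auto
  qed
  have "\<exists>l0 l1 l2. Node ts = T_tree l0 l1 l2"
    using assms(2) by (rule sorted_branches_T_tree) (rule branch)
  then show thesis using that by (elim exE)
qed

text \<open>A graph without a negative plane is studied through all its presentations as
  $C_5(T_0,\dots,T_4)$ at once; rotations and reflections of the cycle allow any tree to be first.\<close>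

locale C5_graph =
  fixes U :: "'a pair_pre_digraph"
  assumes arcs: "parcs U \<subseteq> pverts U \<times> pverts U"
    and no_negative_plane: "\<not> negative_plane U"
    and order: "21 \<le> card (pverts U)"
begin

definition shape :: "rtree \<Rightarrow> rtree \<Rightarrow> rtree \<Rightarrow> rtree \<Rightarrow> rtree \<Rightarrow> bool" where
  "shape T0 T1 T2 T3 T4 \<longleftrightarrow> U \<simeq>\<^sub>g C_graph [T0, T1, T2, T3, T4] \<and>
     (\<forall>T ts. T \<in> {T0, T1, T2, T3, T4} \<longrightarrow> T = Node ts \<longrightarrow> sorted (map (card \<circ> addrs) ts))"

lemma shape_rotate: "shape T0 T1 T2 T3 T4 \<Longrightarrow> shape T1 T2 T3 T4 T0"
  unfolding shape_def using graph_iso_trans[OF arcs _ C_graph_rotate] by blast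

lemma shape_reflect: "shape T0 T1 T2 T3 T4 \<Longrightarrow> shape T0 T4 T3 T2 T1"
  unfolding shape_def using graph_iso_trans[OF arcs _ C_graph_reflect] by blast

lemma shape_card:
  assumes "shape T0 T1 T2 T3 T4"
  shows "card (pverts U) = card (addrs T0) + card (addrs T1) + card (addrs T2) + card (addrs T3) + card (addrs T4)"
proof -
  obtain \<phi> where "bij_betw \<phi> (pverts U) (pverts (C_graph [T0, T1, T2, T3, T4]))"
    using assms unfolding shape_def by (blast elim: graph_isoE[OF arcs])
  then show ?thesis using bij_betw_same_card card_pverts_C5 by metis
qed

lemma shape_no_negative_plane:
  "shape T0 T1 T2 T3 T4 \<Longrightarrow> \<not> negative_plane (C_graph [T0, T1, T2, T3, T4])"
  unfolding shape_def using planes_iso(1)[OF arcs] no_negative_plane by blast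

lemma shape_small_branches_first:
  assumes "shape T0 T1 T2 T3 T4" shows "small_branches T0"
  unfolding small_branches_def
proof (intro allI impI ballI)
  fix ts B assume T0: "T0 = Node ts" and B: "B \<in> set ts"
  show "card (addrs B) \<le> 3"
  proof (rule ccontr)
    assume "\<not> card (addrs B) \<le> 3"
    then have "negative_plane (C_graph [Node ts, T1, T2, T3, T4])"
      using shape_card[OF assms] order by (intro negative_plane_large_branch[OF B]) (auto simp: T0)
    then show False using shape_no_negative_plane[OF assms] T0 by simp
  qed
qed

lemma shape_small_branches:
  assumes "shape T0 T1 T2 T3 T4"
  shows "small_branches T0" "small_branches T1" "small_branches T2" "small_branches T3" "small_branches T4"
proof -
  note r = shape_rotate
  show "small_branches T0" by (rule shape_small_branches_first[OF assms])
  show "small_branches T1" by (rule shape_small_branches_first[OF r[OF assms]])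
  show "small_branches T2" by (rule shape_small_branches_first[OF r[OF r[OF assms]]])
  show "small_branches T3" by (rule shape_small_branches_first[OF r[OF r[OF r[OF assms]]]])
  show "small_branches T4" by (rule shape_small_branches_first[OF r[OF r[OF r[OF r[OF assms]]]]])
qed

text \<open>A branch with at most three vertices has at least its order as weight, and the $n - 5 \ge 16$
  vertices off the cycle all belong to branches.\<close>

lemma shape_weight:
  assumes "shape T0 T1 T2 T3 T4"
  shows "16 \<le> tree_weight T0 + tree_weight T1 + tree_weight T2 + tree_weight T3 + tree_weight T4"
  using shape_small_branches[OF assms, THEN tree_weight_ge'] shape_card[OF assms] order by linarith

lemma shape_first_T_tree:
  assumes sh: "shape T0 T1 T2 T3 T4"
  obtains l0 l1 l2 where "T0 = T_tree l0 l1 l2"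
proof -
  obtain ts where T0: "T0 = Node ts" by (cases T0)
  note small = shape_small_branches[OF sh]
  have "P3 \<notin> set ts"
  proof
    assume P3: "P3 \<in> set ts"
    then obtain j where j: "j < length ts" "ts ! j = P3" by (auto simp: in_set_conv_nth)
    define R where "R = {..<length ts} - {j}"
    have le: "card (addrs (ts ! i)) \<le> branch_weight (ts ! i)" if "i \<in> R" for i
      using small(1) that by (intro card_addrs_le_branch_weight) (simp add: T0 R_def small_branches_def)
    have "tree_weight T0 = 30 + (\<Sum>i\<in>R. branch_weight (ts ! i))"
      using j branch_distinct by (simp add: T0 tree_weight_sum R_def sum.remove[of _ j] branch_weight_def)
    moreover have "card (addrs T0) = 4 + (\<Sum>i\<in>R. card (addrs (ts ! i)))"
      using j by (simp add: T0 card_addrs_Node R_def sum.remove[of _ j] card_addrs_P3)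
    moreover have "(\<Sum>i\<in>R. card (addrs (ts ! i))) \<le> (\<Sum>i\<in>R. branch_weight (ts ! i))"
      by (rule sum_mono) (rule le)
    ultimately have "31 \<le> tree_weight T0 + tree_weight T1 + tree_weight T2 + tree_weight T3 + tree_weight T4"
      using small(2-5)[THEN tree_weight_ge'] shape_card[OF sh] order by linarith
    then have "negative_plane (C_graph [T0, T1, T2, T3, T4])"
      using negative_plane_P3[OF P3, of T1 T2 T3 T4] small by (simp add: T0)
    then show False using shape_no_negative_plane[OF sh] by simp
  qed
  moreover have "sorted (map (card \<circ> addrs) ts)" using sh T0 by (simp add: shape_def)
  moreover have "small_branches (Node ts)" using small(1) T0 by simp
  ultimately obtain l0 l1 l2 where "Node ts = T_tree l0 l1 l2" by (rule normal_tree_obtain)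
  then show thesis using that T0 by simp
qed

lemma shape_heaviest_first:
  assumes "shape T0 T1 T2 T3 T4"
  shows "\<exists>S0 S1 S2 S3 S4. shape S0 S1 S2 S3 S4 \<and> tree_weight S1 \<le> tree_weight S0 \<and>
    tree_weight S2 \<le> tree_weight S0 \<and> tree_weight S3 \<le> tree_weight S0 \<and> tree_weight S4 \<le> tree_weight S0"
proof -
  let ?w = tree_weight
  note s1 = shape_rotate[OF assms]
  note s2 = shape_rotate[OF s1]
  note s3 = shape_rotate[OF s2]
  note s4 = shape_rotate[OF s3]
  consider "?w T1 \<le> ?w T0 \<and> ?w T2 \<le> ?w T0 \<and> ?w T3 \<le> ?w T0 \<and> ?w T4 \<le> ?w T0"
    | "?w T2 \<le> ?w T1 \<and> ?w T3 \<le> ?w T1 \<and> ?w T4 \<le> ?w T1 \<and> ?w T0 \<le> ?w T1"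
    | "?w T3 \<le> ?w T2 \<and> ?w T4 \<le> ?w T2 \<and> ?w T0 \<le> ?w T2 \<and> ?w T1 \<le> ?w T2"
    | "?w T4 \<le> ?w T3 \<and> ?w T0 \<le> ?w T3 \<and> ?w T1 \<le> ?w T3 \<and> ?w T2 \<le> ?w T3"
    | "?w T0 \<le> ?w T4 \<and> ?w T1 \<le> ?w T4 \<and> ?w T2 \<le> ?w T4 \<and> ?w T3 \<le> ?w T4"
    by linarith
  then show ?thesis
  proof cases
    case 1 with assms show ?thesis by blast
  next
    case 2 with s1 show ?thesis by blast
  next
    case 3 with s2 show ?thesis by blast
  next
    case 4 with s3 show ?thesis by blast
  next
    case 5 with s4 show ?thesis by blast
  qed
qed

text \<open>With the heaviest tree first, its neighbours on the cycle have weight $0$ or $1$, which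
  determines them, and the other two trees are trivial. The bounds on the weight of the first tree
  exclude stars with two leaves as soon as a neighbour is nontrivial, because they weigh $30$.\<close>

theorem shape_classification:
  assumes "shape T0 T1 T2 T3 T4"
  shows "\<exists>l0 l1 l2.
    shape (T_tree l0 l1 l2) K1 K1 K1 K1 \<or>
    (l2 = 0 \<and> l0 + 4 * l1 \<le> 29 \<and> shape (T_tree l0 l1 0) (star 1) K1 K1 K1) \<or>
    (l2 = 0 \<and> l0 + 4 * l1 \<le> 17 \<and> shape (T_tree l0 l1 0) (star 1) K1 K1 (star 1))"
proof -
  obtain S0 S1 S2 S3 S4 where sh: "shape S0 S1 S2 S3 S4" and
    max: "tree_weight S1 \<le> tree_weight S0" "tree_weight S2 \<le> tree_weight S0"
      "tree_weight S3 \<le> tree_weight S0" "tree_weight S4 \<le> tree_weight S0"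
    using shape_heaviest_first[OF assms] by blast
  obtain l0 l1 l2 where S0: "S0 = T_tree l0 l1 l2" by (rule shape_first_T_tree[OF sh])
  have w0: "tree_weight S0 = l0 + 4 * l1 + 30 * l2" by (simp add: S0 tree_weight_T_tree)
  have "\<not> core_negative (tree_weight S0) (tree_weight S1) (tree_weight S2) (tree_weight S3) (tree_weight S4)"
    using shape_no_negative_plane[OF sh] negative_plane_core[OF shape_small_branches[OF sh]] by blast
  from not_core_negative_weights[OF this max shape_weight[OF sh]]
  have "S2 = K1" "S3 = K1" and "(S1 = K1 \<and> S4 = K1) \<or> (S1 = star 1 \<and> S4 = K1 \<and> tree_weight S0 \<le> 29) \<or>
      (S1 = K1 \<and> S4 = star 1 \<and> tree_weight S0 \<le> 29) \<or> (S1 = star 1 \<and> S4 = star 1 \<and> tree_weight S0 \<le> 17)"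
    using tree_weight_eq_0_iff tree_weight_eq_1 by blast+
  then consider "S1 = K1" "S4 = K1" | "S1 = star 1" "S4 = K1" "tree_weight S0 \<le> 29"
    | "S1 = K1" "S4 = star 1" "tree_weight S0 \<le> 29" | "S1 = star 1" "S4 = star 1" "tree_weight S0 \<le> 17"
    by blast
  then show ?thesis
  proof cases
    case 1
    then show ?thesis using sh S0 \<open>S2 = K1\<close> \<open>S3 = K1\<close> by blast
  next
    case 2
    then have "l2 = 0" "l0 + 4 * l1 \<le> 29" using w0 by auto
    then show ?thesis using sh S0 \<open>S2 = K1\<close> \<open>S3 = K1\<close> 2 by blast
  next
    case 3
    then have "l2 = 0" "l0 + 4 * l1 \<le> 29" using w0 by auto
    then show ?thesis using shape_reflect[OF sh] S0 \<open>S2 = K1\<close> \<open>S3 = K1\<close> 3 by blast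
  next
    case 4
    then have "l2 = 0" "l0 + 4 * l1 \<le> 17" using w0 by auto
    then show ?thesis using sh S0 \<open>S2 = K1\<close> \<open>S3 = K1\<close> 4 by blast
  qed
qed

end

section \<open>Graphs with a positive hyperplane\<close>

lemma branch_energy_ge:
  assumes "B = K1 \<or> B = P2"
  shows "- (branch_weight B / 2) * x\<^sup>2 \<le> branch_energy x B k"
  using assms branch_distinct by (auto simp: branch_weight_def branch_energy_K1 branch_energy_P2)

lemma addrs_K1: "addrs K1 = {[]}"
  by (simp add: K1_def addrs_Node)

lemma addrs_P2: "addrs P2 = {[], [0]}"
  by (auto simp: P2_def addrs_Node addrs_K1)

lemma addrs_K12: "addrs K12 = {[], [0], [1]}"
  by (auto simp: K12_def addrs_Node addrs_K1 less_Suc_eq)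

lemma branch_energy_0_pos:
  assumes "B = K1 \<or> B = P2" "p \<in> addrs B" "k p \<noteq> 0"
  shows "0 < branch_energy 0 B k"
  using assms(1)
proof
  assume "B = K1"
  then show ?thesis using assms by (simp add: addrs_K1 branch_energy_K1)
next
  assume B: "B = P2"
  then consider "p = []" | "p = [0]" using assms(2) by (auto simp: addrs_P2)
  then show ?thesis
  proof cases
    case 1
    then show ?thesis using assms by (simp add: B branch_energy_P2 add_nonneg_pos)
  next
    case 2
    then show ?thesis using assms
      by (cases "k [] = 0") (simp_all add: B branch_energy_P2 add_nonneg_pos)
  qed
qed

lemma branch_energy_0_nonneg:
  assumes "B = K1 \<or> B = P2 \<or> B = K12"
  shows "0 \<le> branch_energy 0 B k"
  using assms by (auto simp: branch_energy_K1 branch_energy_P2 branch_energy_K12)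

text \<open>Trees with pendant vertices and pendant paths of order two only. Their energy has a minimum for
  each value at the root, attained at a single vector.\<close>

definition light_tree :: "rtree \<Rightarrow> bool" where
  "light_tree T \<longleftrightarrow> (\<forall>ts. T = Node ts \<longrightarrow> set ts \<subseteq> {K1, P2})"

lemma tree_energy_ge:
  assumes "light_tree T"
  shows "- (tree_weight T / 2) * (h [])\<^sup>2 \<le> tree_energy T h"
proof -
  obtain ts where T: "T = Node ts" by (cases T)
  have "- (tree_weight T / 2) * (h [])\<^sup>2 = (\<Sum>i<length ts. - (branch_weight (ts ! i) / 2) * (h [])\<^sup>2)"
    by (simp add: T tree_weight_sum sum_divide_distrib sum_distrib_right flip: sum_negf)
  also have "\<dots> \<le> tree_energy T h"
    unfolding T tree_energy_Node
  proof (intro sum_mono branch_energy_ge)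
    fix i assume "i \<in> {..<length ts}"
    then have "ts ! i \<in> set ts" by simp
    then show "ts ! i = K1 \<or> ts ! i = P2" using assms unfolding light_tree_def T by blast
  qed
  finally show ?thesis .
qed

lemma tree_energy_root_0_pos:
  assumes light: "light_tree T" and root: "h [] = 0" and p: "p \<in> addrs T" "h p \<noteq> 0"
  shows "0 < tree_energy T h"
proof -
  obtain ts where T: "T = Node ts" by (cases T)
  obtain j q where j: "p = j # q" "j < length ts" "q \<in> addrs (ts ! j)"
    using p root by (auto simp: T addrs_Node)
  have B: "ts ! i = K1 \<or> ts ! i = P2" if "i < length ts" for i
    using light nth_mem[OF that] unfolding light_tree_def T by blast
  show ?thesis
    unfolding T tree_energy_Node root
  proof (rule sum_pos2[of _ j])
    show "0 < branch_energy 0 (ts ! j) (\<lambda>p. h (j # p))"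
      using branch_energy_0_pos[OF B[OF j(2)] j(3)] p(2) j(1) by simp
    show "0 \<le> branch_energy 0 (ts ! i) (\<lambda>p. h (i # p))" if "i \<in> {..<length ts}" for i
      using branch_energy_0_nonneg B that by blast
  qed (use j in auto)
qed

lemma light_tree_K1 [simp]: "light_tree K1"
  by (simp add: light_tree_def K1_def)

lemma light_tree_star_1 [simp]: "light_tree (star (Suc 0))"
  by (simp add: light_tree_def star_def)

lemma light_tree_T_tree [simp]: "light_tree (T_tree l0 l1 0)"
  by (auto simp: light_tree_def T_tree_conv)

lemma tree_weight_K1: "tree_weight K1 = 0"
  by (simp add: tree_weight_eq_0_iff)

lemma tree_weight_star_1: "tree_weight (star 1) = 1"
  by (simp add: star_def tree_weight.simps branch_weight_def)

text \<open>The energy is at least the form on the cycle, and if all values on the cycle vanish, the branches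
  have positive energy unless they vanish as well.\<close>

lemma positive_hyperplane_core:
  assumes light: "light_tree T0" "light_tree T1" "light_tree T2" "light_tree T3" "light_tree T4"
    and pos: "\<And>x. A * x 0 + B * x 1 = 0 \<Longrightarrow> (\<exists>i<5. x i \<noteq> 0) \<Longrightarrow>
      0 < core (tree_weight T0) (tree_weight T1) (tree_weight T2) (tree_weight T3) (tree_weight T4) x"
  shows "positive_hyperplane (C_graph [T0, T1, T2, T3, T4])"
proof (rule positive_hyperplane_two_point[where u = "(0, [])" and v = "(1, [])" and a = A and b = B])
  let ?Ts = "[T0, T1, T2, T3, T4]"
  show "(0, []) \<in> pverts (C_graph ?Ts)" "(1, []) \<in> pverts (C_graph ?Ts)" by (simp_all add: pverts_C_graph)
  fix h v assume hyp: "A * h (0, []) + B * h (1, []) = 0" and v: "v \<in> pverts (C_graph ?Ts)" "h v \<noteq> 0"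
  define x where "x i = h (i, [])" for i :: nat
  have bound: "core (tree_weight T0) (tree_weight T1) (tree_weight T2) (tree_weight T3) (tree_weight T4) x
      \<le> energy (C_graph ?Ts) h"
    using tree_energy_ge[OF light(1), of "\<lambda>p. h (0, p)"] tree_energy_ge[OF light(2), of "\<lambda>p. h (1, p)"]
      tree_energy_ge[OF light(3), of "\<lambda>p. h (2, p)"] tree_energy_ge[OF light(4), of "\<lambda>p. h (3, p)"]
      tree_energy_ge[OF light(5), of "\<lambda>p. h (4, p)"]
    unfolding energy_C5 core_def x_def by (simp add: algebra_simps)
  show "0 < energy (C_graph ?Ts) h"
  proof (cases "\<exists>i<5. x i \<noteq> 0")
    case True
    then show ?thesis using pos[of x] hyp bound by (simp add: x_def)
  next
    case False
    then have root: "h (i, []) = 0" if "i < 5" for i using that by (simp add: x_def)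
    have E: "energy (C_graph ?Ts) h = 2 * (\<Sum>i<5. tree_energy (?Ts ! i) (\<lambda>p. h (i, p)))"
      unfolding energy_C5 by (simp add: root lessThan_5 numeral_2_eq_2 eval_nat_numeral)
    obtain i p where v': "v = (i, p)" by (cases v)
    have i: "i < 5" "p \<in> addrs (?Ts ! i)" using v by (auto simp: v' pverts_C_graph)
    have lt: "light_tree (?Ts ! k)" if "k < 5" for k
      using light that by (auto simp: less_5_iff)
    have nonneg: "0 \<le> tree_energy (?Ts ! k) (\<lambda>p. h (k, p))" if "k < 5" for k
      using tree_energy_ge[OF lt[OF that], of "\<lambda>p. h (k, p)"] root[OF that] by simp
    have "0 < tree_energy (?Ts ! i) (\<lambda>p. h (i, p))"
      using tree_energy_root_0_pos[OF lt[OF i(1)], of "\<lambda>p. h (i, p)" p] root[OF i(1)] i v by (simp add: v')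
    then have "0 < (\<Sum>i<5. tree_energy (?Ts ! i) (\<lambda>p. h (i, p)))"
      using i(1) nonneg by (intro sum_pos2[of _ i]) auto
    then show ?thesis using E by simp
  qed
qed simp

lemma four_squares_nonpos_imp_zero:
  fixes a b c d p q r t :: real
  assumes "0 < a" "0 < b" "0 < c" "0 < d" "a * p\<^sup>2 + b * q\<^sup>2 + c * r\<^sup>2 + d * t\<^sup>2 \<le> 0"
  shows "p = 0 \<and> q = 0 \<and> r = 0 \<and> t = 0"
proof -
  have "0 \<le> a * p\<^sup>2" "0 \<le> b * q\<^sup>2" "0 \<le> c * r\<^sup>2" "0 \<le> d * t\<^sup>2" using assms(1-4) by simp_all
  with assms(5) have "a * p\<^sup>2 = 0" "b * q\<^sup>2 = 0" "c * r\<^sup>2 = 0" "d * t\<^sup>2 = 0" by linarith+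
  then show ?thesis using assms(1-4) by simp
qed

text \<open>Eliminating $x_3$, $x_2$ and $x_4$ by completing squares leaves a binary form in $x_0$ and $x_1$
  with one negative square, which vanishes on the hyperplane. The remaining coefficient $4\sqrt 6 - 9$
  drops by one for each additional unit of weight at $x_1$, so it would be negative for weight $18$.\<close>

lemma core_1_17_1_pos:
  assumes "3 * x 0 + (6 + sqrt 6) * x 1 = 0" "\<exists>i<5. x i \<noteq> 0"
  shows "0 < core 1 17 1 0 0 x"
proof -
  let ?s = "sqrt 6"
  have "core 1 17 1 0 0 x = 4 * (x 3 - ?s / 4 * (x 2 + x 4))\<^sup>2 + 3 / 2 * (x 2 - x 4 - 2 * ?s / 3 * x 1)\<^sup>2
      + (x 4 - ?s * (x 1 + x 0))\<^sup>2 + (4 * ?s - 9) * (x 1)\<^sup>2 - 3 * (x 0 + (6 + ?s) / 3 * x 1)\<^sup>2"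
    by (simp add: core_def power2_eq_square add_divide_distrib diff_divide_distrib algebra_simps sqrt6_mult)
  also have "x 0 + (6 + ?s) / 3 * x 1 = 0" using assms(1) by (simp add: field_simps)
  finally have E: "core 1 17 1 0 0 x = 4 * (x 3 - ?s / 4 * (x 2 + x 4))\<^sup>2 + 3 / 2 * (x 2 - x 4 - 2 * ?s / 3 * x 1)\<^sup>2
      + (x 4 - ?s * (x 1 + x 0))\<^sup>2 + (4 * ?s - 9) * (x 1)\<^sup>2" by simp
  have c: "0 < 4 * ?s - 9" using sqrt6_bounds by simp
  show ?thesis
  proof (rule ccontr)
    assume "\<not> 0 < core 1 17 1 0 0 x"
    then have le: "core 1 17 1 0 0 x \<le> 0" by simp
    have "x 3 - ?s / 4 * (x 2 + x 4) = 0 \<and> x 2 - x 4 - 2 * ?s / 3 * x 1 = 0 \<and>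
        x 4 - ?s * (x 1 + x 0) = 0 \<and> x 1 = 0"
      by (rule four_squares_nonpos_imp_zero[of 4 "3 / 2" 1 "4 * ?s - 9"])
        (simp, simp, simp, rule c, use le in \<open>simp only: E mult_1_left\<close>)
    moreover have "x 1 = 0 \<Longrightarrow> x 0 = 0" using assms(1) by simp
    ultimately have "x 0 = 0 \<and> x 1 = 0 \<and> x 2 = 0 \<and> x 3 = 0 \<and> x 4 = 0" by auto
    then show False using assms(2) by (auto simp: less_5_iff)
  qed
qed

text \<open>As before, with the remaining coefficient $6\sqrt 6 - 14$, which is less than $1$: the weight $29$ at
  $x_1$ cannot be increased.\<close>

lemma core_1_29_pos:
  assumes "3 * x 0 + (9 + 4 * sqrt 6) * x 1 = 0" "\<exists>i<5. x i \<noteq> 0"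
  shows "0 < core 1 29 0 0 0 x"
proof -
  let ?s = "sqrt 6"
  have "core 1 29 0 0 0 x = 4 * (x 3 - ?s / 4 * (x 2 + x 4))\<^sup>2 + 5 / 2 * (x 2 - 3 / 5 * x 4 - 2 * ?s / 5 * x 1)\<^sup>2
      + 8 / 5 * (x 4 - 3 * ?s / 8 * x 1 - 5 * ?s / 8 * x 0)\<^sup>2 + (6 * ?s - 14) * (x 1)\<^sup>2
      - 3 / 4 * (x 0 + (9 + 4 * ?s) / 3 * x 1)\<^sup>2"
    by (simp add: core_def power2_eq_square add_divide_distrib diff_divide_distrib algebra_simps sqrt6_mult)
  also have "x 0 + (9 + 4 * ?s) / 3 * x 1 = 0" using assms(1) by (simp add: field_simps)
  finally have E: "core 1 29 0 0 0 x = 4 * (x 3 - ?s / 4 * (x 2 + x 4))\<^sup>2 + 5 / 2 * (x 2 - 3 / 5 * x 4 - 2 * ?s / 5 * x 1)\<^sup>2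
      + 8 / 5 * (x 4 - 3 * ?s / 8 * x 1 - 5 * ?s / 8 * x 0)\<^sup>2 + (6 * ?s - 14) * (x 1)\<^sup>2" by simp
  have c: "0 < 6 * ?s - 14" using sqrt6_bounds by simp
  show ?thesis
  proof (rule ccontr)
    assume "\<not> 0 < core 1 29 0 0 0 x"
    then have le: "core 1 29 0 0 0 x \<le> 0" by simp
    have "x 3 - ?s / 4 * (x 2 + x 4) = 0 \<and> x 2 - 3 / 5 * x 4 - 2 * ?s / 5 * x 1 = 0 \<and>
        x 4 - 3 * ?s / 8 * x 1 - 5 * ?s / 8 * x 0 = 0 \<and> x 1 = 0"
      by (rule four_squares_nonpos_imp_zero[of 4 "5 / 2" "8 / 5" "6 * ?s - 14"])
        (simp, simp, simp, rule c, use le in \<open>simp only: E\<close>)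
    moreover have "x 1 = 0 \<Longrightarrow> x 0 = 0" using assms(1) by simp
    ultimately have "x 0 = 0 \<and> x 1 = 0 \<and> x 2 = 0 \<and> x 3 = 0 \<and> x 4 = 0" by auto
    then show False using assms(2) by (auto simp: less_5_iff)
  qed
qed

lemma positive_hyperplane_two_pendants:
  assumes "l0 + 4 * l1 \<le> 17"
  shows "positive_hyperplane (C_graph [star 1, T_tree l0 l1 0, star 1, K1, K1])"
proof (rule positive_hyperplane_core[where A = 3 and B = "6 + sqrt 6"])
  fix x :: "nat \<Rightarrow> real"
  assume x: "3 * x 0 + (6 + sqrt 6) * x 1 = 0" "\<exists>i<5. x i \<noteq> 0"
  have "real (l0 + 4 * l1) \<le> 17" using assms by linarith
  then have "core 1 17 1 0 0 x \<le> core 1 (real (l0 + 4 * l1)) 1 0 0 x" by (intro core_antimono) auto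
  with core_1_17_1_pos[OF x]
  show "0 < core (tree_weight (star 1)) (tree_weight (T_tree l0 l1 0)) (tree_weight (star 1))
      (tree_weight K1) (tree_weight K1) x"
    by (simp add: tree_weight_K1 tree_weight_star_1[simplified] tree_weight_T_tree)
qed auto

lemma positive_hyperplane_one_pendant:
  assumes "l0 + 4 * l1 \<le> 29"
  shows "positive_hyperplane (C_graph [star 1, T_tree l0 l1 0, K1, K1, K1])"
proof (rule positive_hyperplane_core[where A = 3 and B = "9 + 4 * sqrt 6"])
  fix x :: "nat \<Rightarrow> real"
  assume x: "3 * x 0 + (9 + 4 * sqrt 6) * x 1 = 0" "\<exists>i<5. x i \<noteq> 0"
  have "real (l0 + 4 * l1) \<le> 29" using assms by linarith
  then have "core 1 29 0 0 0 x \<le> core 1 (real (l0 + 4 * l1)) 0 0 0 x" by (intro core_antimono) auto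
  with core_1_29_pos[OF x]
  show "0 < core (tree_weight (star 1)) (tree_weight (T_tree l0 l1 0)) (tree_weight K1)
      (tree_weight K1) (tree_weight K1) x"
    by (simp add: tree_weight_K1 tree_weight_star_1[simplified] tree_weight_T_tree)
qed auto

lemma tree_energy_K1: "tree_energy K1 h = 0"
  by (simp add: K1_def tree_energy_Node)

lemma tree_energy_snoc:
  "tree_energy (Node (ts @ [B])) h = tree_energy (Node ts) h + branch_energy (h []) B (\<lambda>p. h (length ts # p))"
  by (simp add: tree_energy_Node nth_append)

lemma addrs_snoc: "addrs (Node (ts @ [B])) = addrs (Node ts) \<union> Cons (length ts) ` addrs B"
proof -
  have "(\<Union>i<length ts. Cons i ` addrs ((ts @ [B]) ! i)) = (\<Union>i<length ts. Cons i ` addrs (ts ! i))"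
    by (intro SUP_cong refl) (simp add: nth_append)
  then show ?thesis by (simp add: addrs_Node lessThan_Suc Un_commute)
qed

text \<open>Successive elimination of the path $x_1, x_2, x_3, x_4$ that is left when the root is removed from
  the cycle. The pivots are positive, so the path is positive definite.\<close>

lemma core_root_identity:
  "core M 0 0 0 0 x = 4 * (x 1 - sqrt 6 / 4 * (x 0 + x 2))\<^sup>2
     + 5 / 2 * (x 2 - 3 / 5 * x 0 - 2 * sqrt 6 / 5 * x 3)\<^sup>2
     + 8 / 5 * (x 3 - 3 * sqrt 6 / 8 * x 0 - 5 * sqrt 6 / 8 * x 4)\<^sup>2
     + 1 / 4 * (x 4 - (9 + 4 * sqrt 6) * x 0)\<^sup>2 + (- 44 - 18 * sqrt 6 - M) * (x 0)\<^sup>2"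
  by (simp add: core_def power2_eq_square add_divide_distrib diff_divide_distrib algebra_simps sqrt6_mult)

lemma core_root_pos:
  assumes M: "M < - 44 - 18 * sqrt 6" and nz: "\<exists>i<5. x i \<noteq> 0"
  shows "0 < core M 0 0 0 0 x"
proof (rule ccontr)
  assume "\<not> 0 < core M 0 0 0 0 x"
  then have le: "core M 0 0 0 0 x \<le> 0" by simp
  have c: "0 \<le> (- 44 - 18 * sqrt 6 - M) * (x 0)\<^sup>2" using M by simp
  have x0: "x 0 = 0"
  proof (rule ccontr)
    assume "x 0 \<noteq> 0"
    then have "0 < (- 44 - 18 * sqrt 6 - M) * (x 0)\<^sup>2" using M by simp
    then have "0 < core M 0 0 0 0 x" unfolding core_root_identity by (intro add_nonneg_pos add_nonneg_nonneg) simp_all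
    with le show False by simp
  qed
  have "x 1 - sqrt 6 / 4 * (x 0 + x 2) = 0 \<and> x 2 - 3 / 5 * x 0 - 2 * sqrt 6 / 5 * x 3 = 0 \<and>
      x 3 - 3 * sqrt 6 / 8 * x 0 - 5 * sqrt 6 / 8 * x 4 = 0 \<and> x 4 - (9 + 4 * sqrt 6) * x 0 = 0"
  proof (rule four_squares_nonpos_imp_zero[of 4 "5 / 2" "8 / 5" "1 / 4"])
    show "4 * (x 1 - sqrt 6 / 4 * (x 0 + x 2))\<^sup>2 + 5 / 2 * (x 2 - 3 / 5 * x 0 - 2 * sqrt 6 / 5 * x 3)\<^sup>2
     + 8 / 5 * (x 3 - 3 * sqrt 6 / 8 * x 0 - 5 * sqrt 6 / 8 * x 4)\<^sup>2
     + 1 / 4 * (x 4 - (9 + 4 * sqrt 6) * x 0)\<^sup>2 \<le> 0"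
      using le c unfolding core_root_identity by linarith
  qed simp_all
  then have "x 0 = 0 \<and> x 1 = 0 \<and> x 2 = 0 \<and> x 3 = 0 \<and> x 4 = 0" using x0 by auto
  then show False using nz by (auto simp: less_5_iff)
qed

lemma core_root_0_pos:
  assumes "x 0 = 0" "\<exists>i<5. x i \<noteq> 0"
  shows "0 < core M 0 0 0 0 x"
proof -
  \<comment> \<open>The weight at a vertex with value $0$ does not matter, so a very negative one may be chosen.\<close>
  have "0 < core (- 100) 0 0 0 0 x" using assms(2) sqrt6_bounds by (intro core_root_pos) auto
  also have "core (- 100) 0 0 0 0 x = core M 0 0 0 0 x" using assms(1) by (simp add: core_def)
  finally show ?thesis .
qed

lemma nonneg_hyperplane_T_tree: "nonneg_hyperplane (C_graph [T_tree l0 l1 l2, K1, K1, K1, K1])"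
proof (rule nonneg_hyperplane_two_point[where u = "(0, [])" and v = "(0, [])" and a = 1 and b = 0])
  let ?Ts = "[T_tree l0 l1 l2, K1, K1, K1, K1]"
  fix h :: "nat \<times> nat list \<Rightarrow> real"
  assume "1 * h (0, []) + 0 * h (0, []) = 0"
  then have root: "h (0, []) = 0" by simp
  define x where "x i = h (i, [])" for i :: nat
  let ?ts = "replicate l0 K1 @ replicate l1 P2 @ replicate l2 K12"
  have T: "0 \<le> tree_energy (T_tree l0 l1 l2) (\<lambda>p. h (0, p))"
    unfolding T_tree_conv tree_energy_Node root
  proof (intro sum_nonneg branch_energy_0_nonneg)
    fix i assume "i \<in> {..<length ?ts}"
    then have "?ts ! i \<in> set ?ts" by (intro nth_mem) simp
    then show "?ts ! i = K1 \<or> ?ts ! i = P2 \<or> ?ts ! i = K12" by (auto split: if_splits)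
  qed
  have "0 \<le> core 0 0 0 0 0 x"
  proof (cases "\<exists>i<5. x i \<noteq> 0")
    case True
    then show ?thesis using core_root_0_pos[of x 0] root by (simp add: x_def)
  next
    case False
    then show ?thesis by (simp add: core_def)
  qed
  moreover have "energy (C_graph ?Ts) h = core 0 0 0 0 0 x + 2 * tree_energy (T_tree l0 l1 l2) (\<lambda>p. h (0, p))"
    unfolding energy_C5 core_def x_def by (simp add: tree_energy_K1 algebra_simps)
  ultimately show "0 \<le> energy (C_graph ?Ts) h" using T by simp
qed (simp_all add: pverts_C_graph)

lemma positive_hyperplane_T_tree_0: "positive_hyperplane (C_graph [T_tree l0 l1 0, K1, K1, K1, K1])"
proof (rule positive_hyperplane_core[where A = 1 and B = 0])
  fix x :: "nat \<Rightarrow> real"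
  assume "1 * x 0 + 0 * x 1 = 0" "\<exists>i<5. x i \<noteq> 0"
  then show "0 < core (tree_weight (T_tree l0 l1 0)) (tree_weight K1) (tree_weight K1) (tree_weight K1) (tree_weight K1) x"
    using core_root_0_pos[of x "tree_weight (T_tree l0 l1 0)"] by (simp add: tree_weight_K1)
qed simp_all

text \<open>The vectors vanishing at the root include the null vector of the star with two leaves. The
  hyperplane is tilted: the value at the center of the star is prescribed as $-(L + 30)$ times the
  value at the root, where $L$ is the weight of the rest of the tree. The term $-\sqrt 6\, x a$ then
  becomes a large positive multiple of $x^2$, and the null vector is excluded.\<close>

lemma positive_hyperplane_T_tree_1: "positive_hyperplane (C_graph [T_tree l0 l1 1, K1, K1, K1, K1])"
proof -
  let ?Ts = "[T_tree l0 l1 1, K1, K1, K1, K1]"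
  define L where "L = real (tree_weight (T_tree l0 l1 0))"
  define ts where "ts = replicate l0 K1 @ replicate l1 P2"
  have T1: "T_tree l0 l1 1 = Node (ts @ [K12])" and T0: "T_tree l0 l1 0 = Node ts"
    by (simp_all add: T_tree_conv ts_def)
  let ?j = "length ts"
  show ?thesis
  proof (rule positive_hyperplane_two_point[where u = "(0, [?j])" and v = "(0, [])" and a = 1 and b = "L + 30"])
    show "(0, [?j]) \<in> pverts (C_graph ?Ts)"
      unfolding T1 by (auto simp: pverts_C_graph addrs_snoc)
    show "(0, []) \<in> pverts (C_graph ?Ts)" by (simp add: pverts_C_graph)
    fix h v
    assume hyp: "1 * h (0, [?j]) + (L + 30) * h (0, []) = 0"
      and v: "v \<in> pverts (C_graph ?Ts)" "h v \<noteq> 0"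
    define x where "x i = h (i, [])" for i :: nat
    have a: "h (0, [?j]) = - ((L + 30) * x 0)" using hyp by (simp add: x_def)
    define sq where "sq = (h (0, [?j, 0]) - sqrt 6 / 2 * h (0, [?j]))\<^sup>2 + (h (0, [?j, 1]) - sqrt 6 / 2 * h (0, [?j]))\<^sup>2"
    have light: "light_tree (Node ts)" using light_tree_T_tree[of l0 l1] unfolding T0 .
    let ?E0 = "tree_energy (Node ts) (\<lambda>p. h (0, p))"
    have E: "energy (C_graph ?Ts) h = core 0 0 0 0 0 x + 2 * ?E0 + 2 * (sq + (1 + sqrt 6 * (L + 30)) * (x 0)\<^sup>2)"
      unfolding energy_C5 T1 tree_energy_snoc branch_energy_K12 core_def
      by (simp add: tree_energy_K1 a sq_def x_def power2_eq_square algebra_simps)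
    have sq: "0 \<le> sq" by (simp add: sq_def)
    have ge: "- (L / 2) * (x 0)\<^sup>2 \<le> ?E0"
      using tree_energy_ge[OF light, of "\<lambda>p. h (0, p)"] by (simp add: L_def T0 x_def)
    show "0 < energy (C_graph ?Ts) h"
    proof (cases "\<exists>i<5. x i \<noteq> 0")
      case True
      have "0 \<le> L" by (simp add: L_def)
      then have "L \<le> 2 * (sqrt 6 * L)" using sqrt6_bounds mult_right_mono[of 1 "sqrt 6" L] by simp
      then have "L - 2 * (1 + sqrt 6 * (L + 30)) < - 44 - 18 * sqrt 6" using sqrt6_bounds by (simp add: algebra_simps)
      then have "0 < core (L - 2 * (1 + sqrt 6 * (L + 30))) 0 0 0 0 x" using True by (rule core_root_pos)
      also have "\<dots> = core 0 0 0 0 0 x - L * (x 0)\<^sup>2 + 2 * ((1 + sqrt 6 * (L + 30)) * (x 0)\<^sup>2)"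
        by (simp add: core_def algebra_simps)
      also have "\<dots> \<le> energy (C_graph ?Ts) h" unfolding E using ge sq by simp
      finally show ?thesis .
    next
      case False
      then have root: "h (i, []) = 0" if "i < 5" for i using that by (simp add: x_def)
      have x0: "x 0 = 0" using root by (simp add: x_def)
      then have a0: "h (0, [?j]) = 0" using a by simp
      obtain i p where v': "v = (i, p)" by (cases v)
      have "i = 0"
      proof (rule ccontr)
        assume "i \<noteq> 0"
        then have "p = []" using v by (auto simp: v' pverts_C_graph nth_Cons' addrs_K1 split: if_splits)
        then show False using v root by (simp add: v' pverts_C_graph)
      qed
      have "p \<in> addrs (Node (ts @ [K12]))"
        using v(1) \<open>i = 0\<close> unfolding v' pverts_C_graph T1 by simp
      then have p: "p \<in> addrs (Node ts) \<or> p \<in> Cons ?j ` addrs K12" "h (0, p) \<noteq> 0"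
        using v(2) \<open>i = 0\<close> by (auto simp: v' addrs_snoc)
      have core0: "core 0 0 0 0 0 x = 0" using False by (simp add: core_def)
      have E0: "0 \<le> ?E0" using ge x0 by simp
      from p(1) show ?thesis
      proof
        assume "p \<in> addrs (Node ts)"
        then have "0 < ?E0" using tree_energy_root_0_pos[OF light, of "\<lambda>p. h (0, p)" p] p(2) root by simp
        then show ?thesis unfolding E core0 x0 using sq by simp
      next
        assume "p \<in> Cons ?j ` addrs K12"
        then have "p = [?j, 0] \<or> p = [?j, 1]" using p(2) a0 by (auto simp: addrs_K12)
        then have "0 < sq" using p(2) by (auto simp: sq_def a0 add_pos_nonneg add_nonneg_pos)
        then show ?thesis unfolding E core0 x0 using E0 by simp
      qed
    qed
  qed simp
qed

text \<open>The vector with value $1$ at the center of a star, $\sqrt 6/2$ at its leaves and $0$ elsewhere has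
  energy $0$, and for two different stars the supports are disjoint and not adjacent.\<close>

lemma null_plane_T_tree:
  assumes "2 \<le> l2"
  shows "null_plane (C_graph [T_tree l0 l1 l2, K1, K1, K1, K1])"
proof -
  let ?Ts = "[T_tree l0 l1 l2, K1, K1, K1, K1]"
  let ?ts = "replicate l0 K1 @ replicate l1 P2 @ replicate l2 K12"
  define j where "j = l0 + l1"
  have len: "length ?ts = j + l2" by (simp add: j_def)
  have nth: "?ts ! j = K12" "?ts ! Suc j = K12" using assms by (auto simp: j_def nth_append)
  define y :: "nat list \<Rightarrow> real" where "y p = (if p = [] then 1 else sqrt 6 / 2)" for p
  define b where "b k = (\<lambda>(i :: nat, p). case p of [] \<Rightarrow> 0 | m # q \<Rightarrow> if i = 0 \<and> m = k then y q else 0)" for k :: nat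
  have "energy (C_graph ?Ts) (\<lambda>v. \<alpha> * b j v + \<beta> * b (Suc j) v) = 0" for \<alpha> \<beta>
  proof -
    have "branch_energy 0 (?ts ! i) (\<lambda>p. \<alpha> * b j (0, i # p) + \<beta> * b (Suc j) (0, i # p)) = 0" if "i < length ?ts" for i
    proof -
      have z: "branch_energy 0 K12 (\<lambda>p. c * y p) = 0" for c
        by (simp add: branch_energy_K12 y_def)
      have "?ts ! i \<in> set ?ts" using that by (intro nth_mem)
      then have "?ts ! i = K1 \<or> ?ts ! i = P2 \<or> ?ts ! i = K12" by (auto split: if_splits)
      then have z': "branch_energy 0 (?ts ! i) (\<lambda>p. 0) = 0"
        by (auto simp: branch_energy_K1 branch_energy_P2 branch_energy_K12)
      consider "i = j" | "i = Suc j" | "i \<noteq> j" "i \<noteq> Suc j" by blast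
      then show ?thesis
      proof cases
        case 1
        then show ?thesis using z[of \<alpha>] nth by (simp add: b_def)
      next
        case 2
        then show ?thesis using z[of \<beta>] nth by (simp add: b_def)
      next
        case 3
        then show ?thesis using z' by (simp add: b_def)
      qed
    qed
    then have "tree_energy (T_tree l0 l1 l2) (\<lambda>p. \<alpha> * b j (0, p) + \<beta> * b (Suc j) (0, p)) = 0"
      unfolding T_tree_conv tree_energy_Node by (intro sum.neutral ballI) (simp add: b_def[of _ ] del: append_assoc)
    then show ?thesis unfolding energy_C5 by (simp add: tree_energy_K1 b_def)
  qed
  moreover have "\<exists>v\<in>pverts (C_graph ?Ts). \<alpha> * b j v + \<beta> * b (Suc j) v \<noteq> 0" if "(\<alpha>, \<beta>) \<noteq> (0, 0)" for \<alpha> \<beta> :: real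
  proof -
    have "[k] \<in> addrs (T_tree l0 l1 l2)" if "k < length ?ts" for k
      using that unfolding T_tree_conv by (auto simp: addrs_Node intro!: bexI[of _ k])
    then have "(0, [j]) \<in> pverts (C_graph ?Ts)" "(0, [Suc j]) \<in> pverts (C_graph ?Ts)"
      using assms len by (auto simp: pverts_C_graph)
    moreover have "b j (0, [j]) = 1" "b j (0, [Suc j]) = 0" "b (Suc j) (0, [j]) = 0" "b (Suc j) (0, [Suc j]) = 1"
      by (auto simp: b_def y_def)
    ultimately show ?thesis
      using that by (cases "\<alpha> = 0") (auto intro: bexI[of _ "(0, [j])"] bexI[of _ "(0, [Suc j])"])
  qed
  ultimately show ?thesis unfolding null_plane_def
    by (rule_tac exI[of _ "b j"], rule_tac exI[of _ "b (Suc j)"]) simp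
qed

section \<open>The second eigenvalue of unicyclic graphs of girth five\<close>

lemma (in spectral_graph) nl_eigenvalue_negative_plane:
  "negative_plane G \<Longrightarrow> nl_eigenvalue 2 G < 1 - sqrt 6 / 3"
  unfolding negative_plane_def using nl_eigenvalue_less by blast

lemma (in spectral_graph) nl_eigenvalue_null_plane:
  "pverts G = UNIV \<Longrightarrow> null_plane G \<Longrightarrow> nl_eigenvalue 2 G \<le> 1 - sqrt 6 / 3"
  unfolding null_plane_def using nl_eigenvalue_le by (metis UNIV_I)

lemma (in spectral_graph) nl_eigenvalue_nonneg_hyperplane:
  "pverts G = UNIV \<Longrightarrow> nonneg_hyperplane G \<Longrightarrow> 1 - sqrt 6 / 3 \<le> nl_eigenvalue 2 G"
  unfolding nonneg_hyperplane_def using nl_eigenvalue_ge by metis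

lemma (in spectral_graph) nl_eigenvalue_positive_hyperplane:
  "pverts G = UNIV \<Longrightarrow> positive_hyperplane G \<Longrightarrow> 1 - sqrt 6 / 3 < nl_eigenvalue 2 G"
  unfolding positive_hyperplane_def using nl_eigenvalue_greater by (metis UNIV_I)

text \<open>A connected graph with at least two vertices has no isolated vertex, so the normalized
  Laplacian is defined without division by zero.\<close>

lemma unicyclic_spectral_graph:
  fixes U :: "'v::finite pair_pre_digraph"
  assumes V: "pverts U = UNIV" "2 \<le> card (pverts U)" and U: "unicyclic U"
  shows "spectral_graph U"
proof
  show "2 \<le> CARD('v)" using V by simp
  show "(v, u) \<in> parcs U" if "(u, v) \<in> parcs U" for u v by (rule unicyclic_arcs(2)[OF U that])
  fix u :: 'v
  have "UNIV \<noteq> {u}" using V by (metis card.empty card.insert empty_iff finite.emptyI not_less_eq_eq numeral_2_eq_2 order_refl)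
  then obtain v where "v \<noteq> u" by blast
  moreover have "(u, v) \<in> (parcs U)\<^sup>*" using unicyclic_arcs(3)[OF U] V by simp
  ultimately obtain w where "(u, w) \<in> parcs U" by (metis converse_rtranclE)
  then have "out_arcs (with_proj U) u \<noteq> {}" by (auto simp: out_arcs_def)
  then show "0 < out_degree (with_proj U) u" by (simp add: out_degree_def card_gt_0_iff)
qed

lemma S_graph_conv: "1 \<le> k \<Longrightarrow> S_graph [2, k, 2, 1, 1] = C_graph [star 1, T_tree (k - 1) 0 0, star 1, K1, K1]"
  by (simp add: S_graph_def T_tree_def star_def K1_def)

theorem theorem3p1:
  fixes U :: "'v::finite pair_pre_digraph" and n :: nat
  assumes "pverts U = UNIV"
    and "card (pverts U) = n"
    and "n \<ge> 21"
    and "unicyclic U"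
    and "unicyclic_girth U = 5"
  shows "(nl_eigenvalue 2 U \<ge> 1 - sqrt 6 / 3 \<longleftrightarrow>
      (\<exists>k. 15 \<le> k \<and> k \<le> 18 \<and> U \<simeq>\<^sub>g S_graph [2, k, 2, 1, 1]) \<or>
      (U \<simeq>\<^sub>g C_graph [star 1, T_tree 12 1 0, star 1, K1, K1] \<or>
       U \<simeq>\<^sub>g C_graph [star 1, T_tree 13 1 0, star 1, K1, K1]) \<or>
      (\<exists>l0 l1. U \<simeq>\<^sub>g C_graph [star 1, T_tree l0 l1 0, K1, K1, K1] \<and>
         15 \<le> l0 + 2 * l1 \<and> l0 + 2 * l1 \<le> 29 \<and> 0 \<le> l1 \<and> l1 \<le> 7 \<and>
         ((l1 = 7 \<and> l0 = 1) \<or>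
          (l1 = 6 \<and> 3 \<le> l0 \<and> l0 \<le> 5) \<or>
          (l1 = 5 \<and> 5 \<le> l0 \<and> l0 \<le> 9) \<or>
          (l1 = 4 \<and> 7 \<le> l0 \<and> l0 \<le> 13) \<or>
          (l1 = 3 \<and> 9 \<le> l0 \<and> l0 \<le> 17) \<or>
          (l1 = 2 \<and> 11 \<le> l0 \<and> l0 \<le> 21) \<or>
          (l1 = 1 \<and> 13 \<le> l0 \<and> l0 \<le> 25) \<or>
          (l1 = 0 \<and> 15 \<le> l0 \<and> l0 \<le> 29))) \<or>
      (\<exists>l0 l1 l2. U \<simeq>\<^sub>g C_graph [T_tree l0 l1 l2, K1, K1, K1, K1] \<and>
         l0 + 2 * l1 + 3 * l2 + 5 = n \<and> n \<ge> 21)) \<and>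
    (nl_eigenvalue 2 U = 1 - sqrt 6 / 3 \<longleftrightarrow>
      (\<exists>l0 l1 l2. U \<simeq>\<^sub>g C_graph [T_tree l0 l1 l2, K1, K1, K1, K1] \<and>
         l0 + 2 * l1 + 3 * l2 + 5 = n \<and> l2 \<ge> 2))"
    (is "(?ge \<longleftrightarrow> ?i \<or> ?ii \<or> ?iii \<or> ?iv) \<and> (?eq \<longleftrightarrow> ?v)")
proof -
  let ?c = "1 - sqrt 6 / 3"
  have arcs: "parcs U \<subseteq> pverts U \<times> pverts U"
    using unicyclic_arcs(1)[OF assms(4)] by auto
  interpret spectral_graph U
    using assms by (intro unicyclic_spectral_graph) auto
  note iso = planes_iso[OF arcs]
  note below = nl_eigenvalue_negative_plane
    and at_most = nl_eigenvalue_null_plane[OF assms(1)]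
    and at_least = nl_eigenvalue_nonneg_hyperplane[OF assms(1)]
    and above = nl_eigenvalue_positive_hyperplane[OF assms(1)]
  have two: "?c < nl_eigenvalue 2 U"
    if "U \<simeq>\<^sub>g C_graph [star 1, T_tree l0 l1 0, star 1, K1, K1]" "l0 + 4 * l1 \<le> 17" for l0 l1
    using iso(4)[OF that(1) positive_hyperplane_two_pendants[OF that(2)]] by (rule above)
  have i: "?c < nl_eigenvalue 2 U" if ?i
  proof -
    from that obtain k where k: "15 \<le> k" "k \<le> 18" "U \<simeq>\<^sub>g S_graph [2, k, 2, 1, 1]" by blast
    then have "U \<simeq>\<^sub>g C_graph [star 1, T_tree (k - 1) 0 0, star 1, K1, K1]"
      using S_graph_conv[of k] by simp
    then show ?thesis by (rule two) (use k in simp)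
  qed
  have ii: "?c < nl_eigenvalue 2 U" if ?ii
    using that two[of 12 1] two[of 13 1] by auto
  have iii: "?c < nl_eigenvalue 2 U" if ?iii
  proof -
    from that obtain l0 l1 where l: "U \<simeq>\<^sub>g C_graph [star 1, T_tree l0 l1 0, K1, K1, K1]" "l0 + 4 * l1 \<le> 29"
      by auto
    show ?thesis using iso(4)[OF l(1) positive_hyperplane_one_pendant[OF l(2)]] by (rule above)
  qed
  have iv: "?c \<le> nl_eigenvalue 2 U" "l2 \<le> 1 \<Longrightarrow> ?c < nl_eigenvalue 2 U" "2 \<le> l2 \<Longrightarrow> nl_eigenvalue 2 U \<le> ?c"
    if U: "U \<simeq>\<^sub>g C_graph [T_tree l0 l1 l2, K1, K1, K1, K1]" for l0 l1 l2
  proof -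
    show "?c \<le> nl_eigenvalue 2 U" using iso(3)[OF U nonneg_hyperplane_T_tree] by (rule at_least)
    show "nl_eigenvalue 2 U \<le> ?c" if "2 \<le> l2" using iso(2)[OF U null_plane_T_tree[OF that]] by (rule at_most)
    show "?c < nl_eigenvalue 2 U" if "l2 \<le> 1"
    proof -
      have "l2 = 0 \<or> l2 = 1" using that by auto
      then have "positive_hyperplane (C_graph [T_tree l0 l1 l2, K1, K1, K1, K1])"
        using positive_hyperplane_T_tree_0 positive_hyperplane_T_tree_1 by auto
      from iso(4)[OF U this] show ?thesis by (rule above)
    qed
  qed
  have listed: "?i \<or> ?ii \<or> ?iii \<or> ?iv" if ge: ?ge
  proof -
    interpret C5_graph U
    proof
      show "\<not> negative_plane U" using below ge by auto
      show "21 \<le> card (pverts U)" using assms by simp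
    qed (rule arcs)
    obtain Ts where Ts: "length Ts = unicyclic_girth U" "U \<simeq>\<^sub>g C_graph Ts"
      "\<forall>ts. Node ts \<in> set Ts \<longrightarrow> sorted (map (card \<circ> addrs) ts)"
      by (rule unicyclic_iso_C_graph[OF assms(4)])
    then have "length Ts = 5" using assms(5) by simp
    then obtain T0 T1 T2 T3 T4 where "Ts = [T0, T1, T2, T3, T4]"
      by (auto simp: numeral_eq_Suc length_Suc_conv)
    with Ts have "shape T0 T1 T2 T3 T4" by (auto simp: shape_def)
    from shape_classification[OF this] obtain l0 l1 l2 where
      "shape (T_tree l0 l1 l2) K1 K1 K1 K1 \<or>
       (l2 = 0 \<and> l0 + 4 * l1 \<le> 29 \<and> shape (T_tree l0 l1 0) (star 1) K1 K1 K1) \<or>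
       (l2 = 0 \<and> l0 + 4 * l1 \<le> 17 \<and> shape (T_tree l0 l1 0) (star 1) K1 K1 (star 1))"
      by blast
    then consider
        (none) "shape (T_tree l0 l1 l2) K1 K1 K1 K1"
      | (one) "l0 + 4 * l1 \<le> 29" "shape (T_tree l0 l1 0) (star 1) K1 K1 K1"
      | (both) "l0 + 4 * l1 \<le> 17" "shape (T_tree l0 l1 0) (star 1) K1 K1 (star 1)"
      by blast
    then show ?thesis
    proof cases
      case none
      then have "n = l0 + 2 * l1 + 3 * l2 + 5"
        using shape_card[OF none] assms(2) by (simp add: card_addrs_T_tree card_addrs_K1)
      then have ?iv using none assms(3) unfolding shape_def by (intro exI[of _ l0] exI[of _ l1] exI[of _ l2]) simp
      then show ?thesis by blast
    next
      case one
      have n: "n = l0 + 2 * l1 + 6"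
        using shape_card[OF one(2)] assms(2) card_addrs_star_1 by (simp add: card_addrs_T_tree card_addrs_K1)
      have "shape (star 1) (T_tree l0 l1 0) K1 K1 K1"
        using shape_rotate[OF shape_rotate[OF shape_rotate[OF shape_rotate[OF shape_reflect[OF one(2)]]]]] .
      then have U: "U \<simeq>\<^sub>g C_graph [star 1, T_tree l0 l1 0, K1, K1, K1]" by (simp add: shape_def)
      have "15 \<le> l0 + 2 * l1" using n assms(3) by linarith
      moreover have "l1 = 0 \<or> l1 = 1 \<or> l1 = 2 \<or> l1 = 3 \<or> l1 = 4 \<or> l1 = 5 \<or> l1 = 6 \<or> l1 = 7"
        using calculation one(1) by linarith
      ultimately have ?iii
        using one(1) by (rule_tac exI[of _ l0], rule_tac exI[of _ l1], intro conjI[OF U]) (elim disjE; simp)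
      then show ?thesis by blast
    next
      case both
      have n: "n = l0 + 2 * l1 + 7"
        using shape_card[OF both(2)] assms(2) card_addrs_star_1 by (simp add: card_addrs_T_tree card_addrs_K1)
      have "shape (star 1) (T_tree l0 l1 0) (star 1) K1 K1"
        using shape_rotate[OF shape_rotate[OF shape_rotate[OF shape_rotate[OF both(2)]]]] .
      then have U: "U \<simeq>\<^sub>g C_graph [star 1, T_tree l0 l1 0, star 1, K1, K1]" by (simp add: shape_def)
      have "14 \<le> l0 + 2 * l1" using n assms(3) by linarith
      then have "l1 = 0 \<and> 14 \<le> l0 \<and> l0 \<le> 17 \<or> l1 = 1 \<and> (l0 = 12 \<or> l0 = 13)"
        using both(1) by presburger
      then consider "l1 = 0" "14 \<le> l0" "l0 \<le> 17" | "l1 = 1" "l0 = 12 \<or> l0 = 13"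
        by auto
      then show ?thesis
      proof cases
        case 1
        then have ?i using U S_graph_conv[of "Suc l0"] by (intro exI[of _ "Suc l0"]) simp
        then show ?thesis by blast
      next
        case 2
        then have ?ii using U by auto
        then show ?thesis by blast
      qed
    qed
  qed
  have iv_ge: ?ge if ?iv using that by (elim exE conjE) (rule iv(1))
  have iff: "(g \<longleftrightarrow> p \<or> q \<or> r \<or> s)"
    if "g \<Longrightarrow> p \<or> q \<or> r \<or> s" "p \<Longrightarrow> g" "q \<Longrightarrow> g" "r \<Longrightarrow> g" "s \<Longrightarrow> g" for g p q r s :: bool
    using that by blast
  have last: s if "p \<or> q \<or> r \<or> s" "\<not> p" "\<not> q" "\<not> r" for p q r s :: bool
    using that by blast
  have "?ge \<longleftrightarrow> ?i \<or> ?ii \<or> ?iii \<or> ?iv"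
    by (rule iff) (rule listed iv_ge i[THEN less_imp_le] ii[THEN less_imp_le] iii[THEN less_imp_le]; assumption)+
  moreover have "?eq \<longleftrightarrow> ?v"
  proof
    assume eq: ?eq
    then have nless: "\<not> ?c < nl_eigenvalue 2 U" and ge: ?ge by simp_all
    have ?iv
    proof (rule last[OF listed[OF ge]])
      show "\<not> ?i" using i nless by (rule contrapos_nn[rotated])
      show "\<not> ?ii" using ii nless by (rule contrapos_nn[rotated])
      show "\<not> ?iii" using iii nless by (rule contrapos_nn[rotated])
    qed
    then obtain l0 l1 l2 where l: "U \<simeq>\<^sub>g C_graph [T_tree l0 l1 l2, K1, K1, K1, K1]"
      "l0 + 2 * l1 + 3 * l2 + 5 = n" by blast
    then have "2 \<le> l2" using iv(2)[OF l(1)] eq by fastforce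
    with l show ?v by blast
  next
    assume ?v
    then obtain l0 l1 l2 where l: "U \<simeq>\<^sub>g C_graph [T_tree l0 l1 l2, K1, K1, K1, K1]" "2 \<le> l2" by blast
    show ?eq using iv(1)[OF l(1)] iv(3)[OF l] by (rule antisym[rotated])
  qed
  ultimately show ?thesis by (rule conjI)
qed

end
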